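(* Assume that (i) there exists $y^\ast=\operatorname{argmax}_{x\in\mathcal I}\{g(x)/\psi(x)\}\in\mathcal I$; (ii) $(\mathcal G_rg)(x)\le0$ for all $x\in[y^\ast,b)\setminus\mathcal P$; (iii) $g'(x+)\le g'(x-)$ for all $x\in[y^\ast,b)\cap\mathcal P$; and that $\lim_{x\to b}g(x)/\psi(x)=0$. Then, with $\hat f(x)=g(x)-\psi(x)g'(x+)/\psi'(x)$ on $[y^\ast,b)$, $$V(x)=V_{y^\ast}(x)=\mathbb E_x\big[\hat f(M_T)\mathbb 1_{[y^\ast,b)}(M_T)\big]\quad\text{for all }x\in\mathcal I.$$
   Context: $X$ is a regular linear diffusion on $\mathcal I=(a,b)$, not killed in the interior, generator $\mathcal A=\frac12\sigma^2\frac{d^2}{dx^2}+\mu\frac{d}{dx}$ ($\mu,\sigma$ continuous, $\sigma>0$); $r>0$, $\mathcal G_r=\mathcal A-r$; $\psi$ is the increasing positive fundamental solution of $\mathcal G_ru=0$. The payoff $g$ is continuous, takes nonnegative values somewhere, satisfies $\mathbb E_x[\sup_{t\ge0}e^{-rt}g(X_t)]<\infty$, is $C^2$ on $\mathcal I\setminus\mathcal P$ for a finite set $\mathcal P$, with finite one-sided first and second derivatives on $\mathcal P$. $V(x)=\sup_\tau\mathbb E_x[e^{-r\tau}g(X_\tau)]$. $V_{y}(x)=g(x)$ for $x\ge y$ and $V_y(x)=\psi(x)g(y)/\psi(y)$ for $x<y$. $T\sim\mathrm{Exp}(r)$ independent of $X$, $M_t=\sup_{s\le t}X_s$. *)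

theory Defs
  imports "HOL-Probability.Probability"
begin

definition Ival :: "ereal \<Rightarrow> ereal \<Rightarrow> real set" where
  "Ival a b = {x. a < ereal x \<and> ereal x < b}"

definition gen :: "(real \<Rightarrow> real) \<Rightarrow> (real \<Rightarrow> real) \<Rightarrow> (real \<Rightarrow> real) \<Rightarrow> real \<Rightarrow> real" where
  "gen \<mu> \<sigma> f x = (\<sigma> x)^2 / 2 * deriv (deriv f) x + \<mu> x * deriv f x"

definition C2c :: "real set \<Rightarrow> (real \<Rightarrow> real) \<Rightarrow> bool" where
  "C2c I f \<longleftrightarrow> (\<forall>x. f differentiable at x) \<and> (\<forall>x. deriv f differentiable at x) \<and>
     continuous_on UNIV (deriv (deriv f)) \<and>
     (\<exists>K. compact K \<and> K \<subseteq> I \<and> (\<forall>x. x \<notin> K \<longrightarrow> f x = 0))"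

definition is_stopping_time :: "(real \<Rightarrow> 'w measure) \<Rightarrow> ('w \<Rightarrow> ennreal) \<Rightarrow> bool" where
  "is_stopping_time F \<tau> \<longleftrightarrow> (\<forall>t\<ge>0. {\<omega> \<in> space (F t). \<tau> \<omega> \<le> ennreal t} \<in> sets (F t))"

text \<open>The martingale-problem process
  f(X_t) 1{t<zeta} - int_0^t 1{s<zeta} (A f)(X_s) ds  (f extended by 0 at the cemetery).\<close>
definition mp_proc :: "(real \<Rightarrow> real) \<Rightarrow> (real \<Rightarrow> real) \<Rightarrow> (real \<Rightarrow> real) \<Rightarrow>
    (real \<Rightarrow> 'w \<Rightarrow> real) \<Rightarrow> ('w \<Rightarrow> ennreal) \<Rightarrow> real \<Rightarrow> 'w \<Rightarrow> real" where
  "mp_proc \<mu> \<sigma> f X \<zeta> t \<omega> =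
     (if ennreal t < \<zeta> \<omega> then f (X t \<omega>) else 0)
     - (LINT s:{0..t}|lborel. (if ennreal s < \<zeta> \<omega> then gen \<mu> \<sigma> f (X s \<omega>) else 0))"

text \<open>A (regular) linear diffusion on (a,b), not killed in the interior, with generator
  1/2 sigma^2 d^2/dx^2 + mu d/dx, realised on a filtered space (Omega, F) with laws P x
  (starting point x), paths X, lifetime zeta (killing only by exiting through a boundary),
  characterised by the martingale problem for C^2 functions compactly supported in (a,b).\<close>
definition diffusion_model :: "ereal \<Rightarrow> ereal \<Rightarrow> (real \<Rightarrow> real) \<Rightarrow> (real \<Rightarrow> real) \<Rightarrow>
    'w measure \<Rightarrow> (real \<Rightarrow> 'w measure) \<Rightarrow> (real \<Rightarrow> 'w measure) \<Rightarrow>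
    (real \<Rightarrow> 'w \<Rightarrow> real) \<Rightarrow> ('w \<Rightarrow> ennreal) \<Rightarrow> bool" where
  "diffusion_model a b \<mu> \<sigma> \<Omega> P F X \<zeta> \<longleftrightarrow>
     a < b \<and>
     continuous_on (Ival a b) \<mu> \<and> continuous_on (Ival a b) \<sigma> \<and> (\<forall>x\<in>Ival a b. 0 < \<sigma> x) \<and>
     (\<forall>t. space (F t) = space \<Omega> \<and> sets (F t) \<subseteq> sets \<Omega>) \<and>
     (\<forall>s t. 0 \<le> s \<longrightarrow> s \<le> t \<longrightarrow> sets (F s) \<subseteq> sets (F t)) \<and>
     (\<forall>t\<ge>0. X t \<in> borel_measurable (F t)) \<and>
     is_stopping_time F \<zeta> \<and>
     (\<forall>\<omega>\<in>space \<Omega>. 0 < \<zeta> \<omega> \<and>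
        (\<forall>t. 0 \<le> t \<and> ennreal t < \<zeta> \<omega> \<longrightarrow> X t \<omega> \<in> Ival a b) \<and>
        continuous_on {t. 0 \<le> t \<and> ennreal t < \<zeta> \<omega>} (\<lambda>t. X t \<omega>)) \<and>
     (\<forall>x\<in>Ival a b. prob_space (P x) \<and> sets (P x) = sets \<Omega> \<and>
        (AE \<omega> in P x. X 0 \<omega> = x) \<and>
        (\<forall>f. C2c (Ival a b) f \<longrightarrow> (\<forall>s t. 0 \<le> s \<longrightarrow> s \<le> t \<longrightarrow>
            integrable (P x) (mp_proc \<mu> \<sigma> f X \<zeta> t) \<and>
            mp_proc \<mu> \<sigma> f X \<zeta> t \<in> borel_measurable (F t) \<and>
            (\<forall>A\<in>sets (F s). (LINT \<omega>:A|P x. mp_proc \<mu> \<sigma> f X \<zeta> t \<omega>)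
                             = (LINT \<omega>:A|P x. mp_proc \<mu> \<sigma> f X \<zeta> s \<omega>)))))"

text \<open>First hitting time of level y (infinity if never hit before the lifetime).\<close>
definition hit_time :: "(real \<Rightarrow> 'w \<Rightarrow> real) \<Rightarrow> ('w \<Rightarrow> ennreal) \<Rightarrow> real \<Rightarrow> 'w \<Rightarrow> ennreal" where
  "hit_time X \<zeta> y \<omega> = Inf {ennreal t | t. 0 \<le> t \<and> ennreal t < \<zeta> \<omega> \<and> X t \<omega> = y}"

definition disc_time :: "real \<Rightarrow> ennreal \<Rightarrow> real" where
  "disc_time r \<tau> = (if \<tau> = \<top> then 0 else exp (- r * enn2real \<tau>))"

definition psi_fundamental :: "ereal \<Rightarrow> ereal \<Rightarrow> (real \<Rightarrow> real) \<Rightarrow> (real \<Rightarrow> real) \<Rightarrow> real \<Rightarrow>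
    (real \<Rightarrow> 'w measure) \<Rightarrow> (real \<Rightarrow> 'w \<Rightarrow> real) \<Rightarrow> ('w \<Rightarrow> ennreal) \<Rightarrow> (real \<Rightarrow> real) \<Rightarrow> bool" where
  "psi_fundamental a b \<mu> \<sigma> r P X \<zeta> \<psi> \<longleftrightarrow>
     (\<forall>x\<in>Ival a b. 0 < \<psi> x) \<and> strict_mono_on (Ival a b) \<psi> \<and>
     (\<forall>x\<in>Ival a b. \<psi> differentiable at x \<and> deriv \<psi> differentiable at x) \<and>
     continuous_on (Ival a b) (deriv (deriv \<psi>)) \<and>
     (\<forall>x\<in>Ival a b. gen \<mu> \<sigma> \<psi> x - r * \<psi> x = 0) \<and>
     (\<forall>x\<in>Ival a b. \<forall>y\<in>Ival a b. x \<le> y \<longrightarrow>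
        (\<integral>\<omega>. disc_time r (hit_time X \<zeta> y \<omega>) \<partial>P x) = \<psi> x / \<psi> y)"

definition disc_payoff :: "real \<Rightarrow> (real \<Rightarrow> real) \<Rightarrow> (real \<Rightarrow> 'w \<Rightarrow> real) \<Rightarrow> ('w \<Rightarrow> ennreal) \<Rightarrow>
    ('w \<Rightarrow> ennreal) \<Rightarrow> 'w \<Rightarrow> real" where
  "disc_payoff r g X \<zeta> \<tau> \<omega> =
     (if \<tau> \<omega> < \<zeta> \<omega> then exp (- r * enn2real (\<tau> \<omega>)) * g (X (enn2real (\<tau> \<omega>)) \<omega>) else 0)"

definition value_fn :: "(real \<Rightarrow> 'w measure) \<Rightarrow> (real \<Rightarrow> 'w measure) \<Rightarrow> real \<Rightarrow> (real \<Rightarrow> real) \<Rightarrow>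
    (real \<Rightarrow> 'w \<Rightarrow> real) \<Rightarrow> ('w \<Rightarrow> ennreal) \<Rightarrow> real \<Rightarrow> real" where
  "value_fn P F r g X \<zeta> x = (SUP \<tau> \<in> {\<tau>. is_stopping_time F \<tau>}. integral\<^sup>L (P x) (disc_payoff r g X \<zeta> \<tau>))"

definition Vy :: "(real \<Rightarrow> real) \<Rightarrow> (real \<Rightarrow> real) \<Rightarrow> real \<Rightarrow> real \<Rightarrow> real" where
  "Vy \<psi> g y x = (if y \<le> x then g x else \<psi> x * g y / \<psi> y)"

definition rderiv :: "(real \<Rightarrow> real) \<Rightarrow> real \<Rightarrow> real" where
  "rderiv g x = (THE d. (g has_real_derivative d) (at x within {x..}))"

definition lderiv :: "(real \<Rightarrow> real) \<Rightarrow> real \<Rightarrow> real" where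
  "lderiv g x = (THE d. (g has_real_derivative d) (at x within {..x}))"

definition onesided_C2_at :: "(real \<Rightarrow> real) \<Rightarrow> real \<Rightarrow> bool" where
  "onesided_C2_at g p \<longleftrightarrow>
     (\<exists>d1 d2. (g has_real_derivative d1) (at p within {p..}) \<and>
        ((\<lambda>y. if y = p then d1 else deriv g y) has_real_derivative d2) (at p within {p..})) \<and>
     (\<exists>d1 d2. (g has_real_derivative d1) (at p within {..p}) \<and>
        ((\<lambda>y. if y = p then d1 else deriv g y) has_real_derivative d2) (at p within {..p}))"

definition running_max :: "(real \<Rightarrow> 'w \<Rightarrow> real) \<Rightarrow> ('w \<Rightarrow> ennreal) \<Rightarrow> ('w \<Rightarrow> real) \<Rightarrow> 'w \<Rightarrow> ereal" where
  "running_max X \<zeta> T \<omega> = Sup {ereal (X s \<omega>) | s. 0 \<le> s \<and> s \<le> T \<omega> \<and> ennreal s < \<zeta> \<omega>}"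

definition fhat :: "(real \<Rightarrow> real) \<Rightarrow> (real \<Rightarrow> real) \<Rightarrow> real \<Rightarrow> real" where
  "fhat g \<psi> x = g x - \<psi> x * rderiv g x / deriv \<psi> x"

definition at_upper :: "ereal \<Rightarrow> real filter" where
  "at_upper b = (if b = \<infinity> then at_top else at_left (real_of_ereal b))"

definition indep_rv :: "'w measure \<Rightarrow> 'a measure \<Rightarrow> ('w \<Rightarrow> 'a) \<Rightarrow> 'b measure \<Rightarrow> ('w \<Rightarrow> 'b) \<Rightarrow> bool" where
  "indep_rv M Ma A Mb B \<longleftrightarrow> A \<in> measurable M Ma \<and> B \<in> measurable M Mb \<and>
     prob_space.indep_sets M (case_bool {A -` S \<inter> space M | S. S \<in> sets Ma}
                                        {B -` S \<inter> space M | S. S \<in> sets Mb}) UNIV"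

end

theory Submission
  imports Defs
begin

text \<open>
  Write \<open>V\<^sub>y = \<psi> v\<close> for \<open>y = ystar\<close>, and let \<open>\<rho>\<close> be the reciprocal of the scale density. Then
  \<open>\<rho> \<psi>\<^sup>2 v'\<close> is zero below \<open>y\<close> and, by the assumptions on the generator, the kinks and the argmax,
  nonincreasing and nonpositive on the whole interval; together with the limit at \<open>b\<close> this makes
  \<open>V\<^sub>y\<close> nonnegative.

  Upper bound: smoothing the monotone function \<open>\<rho> \<psi>\<^sup>2 v'\<close> approximates \<open>V\<^sub>y\<close> from above by
  smooth supersolutions, to which the martingale problem applies. Stopping on a grid of mesh \<open>h\<close>
  while the grid values of the path stay in a compact interval gives a supermartingale inequality up to
  an error that vanishes as \<open>h\<close> tends to zero, because a path that is outside the compact interval at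
  time \<open>s\<close> was already outside it at the preceding grid point. Fatou's lemma removes the
  discretisation and the localisation. The bound is attained by stopping at once or at the hitting
  time of \<open>y\<close>.

  Representation: independence turns the Laplace transforms of hitting times into
  \<open>P\<^sub>x(M\<^sub>T > z) = \<psi> x / \<psi> z\<close>, so \<open>M\<^sub>T\<close> has density \<open>\<psi> x \<psi>' / \<psi>\<^sup>2\<close> on \<open>(x, b)\<close>. The integrand
  \<open>fhat \<psi>' / \<psi>\<^sup>2\<close> is \<open>- (g / \<psi>)'\<close>, and the fundamental theorem of calculus concludes.
\<close>

section \<open>Twice continuously differentiable functions and smoothing of monotone functions\<close>

text \<open>The martingale problem speaks only of compactly supported C^2 functions and of
  deterministic times, whereas \<open>Vy\<close> may have kinks at \<open>ystar\<close> and on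
  \<open>Pset\<close> and the payoff is collected at an arbitrary stopping time. This forces two
  approximations, of the function by smooth supersolutions and of the time by a grid.

  The form \<psi> v is chosen because \<psi> removes the zero-order term: with s = \<rho> \<psi>^2
  one has (gen - r)(\<psi> v) = \<sigma>^2 \<psi> / (2 s) times (s v')'. The sign of the generator
  on the smooth pieces and the downward jumps of the derivative at the kinks thus become one
  statement, monotonicity of s v', and monotonicity survives averaging.

  The approximation \<open>f\<close> must lie above \<open>Vy\<close> on a compact interval, so that
  the bound passes on to \<open>g\<close>, but it has to be close to \<open>Vy\<close> only at the
  starting point. Nonnegativity of \<open>f\<close>, inherited from that of \<open>Vy\<close>,
  allows everything lost by killing, or by leaving the compact interval, to be dropped.\<close>

lemma Ival_eq_einterval: "Ival a b = einterval a b"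
  by (simp add: Ival_def einterval_def)

lemma open_Ival [simp]: "open (Ival a b)"
  by (simp add: Ival_eq_einterval)

lemma Ival_between: "x \<in> Ival a b \<Longrightarrow> y \<in> Ival a b \<Longrightarrow> x \<le> z \<Longrightarrow> z \<le> y \<Longrightarrow> z \<in> Ival a b"
  unfolding Ival_def by (simp, metis ereal_less_eq(3) le_less_trans less_le_trans)

lemma Icc_subset_Ival: "x \<in> Ival a b \<Longrightarrow> y \<in> Ival a b \<Longrightarrow> {x..y} \<subseteq> Ival a b"
  by (meson Ival_between atLeastAtMost_iff subsetI)

lemma Ival_margin:
  assumes "\<alpha> \<in> Ival a b" "\<beta> \<in> Ival a b"
  obtains d where "d > 0" "\<alpha> - d \<in> Ival a b" "\<beta> + d \<in> Ival a b"
proof -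
  obtain d1 where d1: "d1 > 0" "ball \<alpha> d1 \<subseteq> Ival a b"
    using assms open_contains_ball open_Ival by metis
  obtain d2 where d2: "d2 > 0" "ball \<beta> d2 \<subseteq> Ival a b"
    using assms open_contains_ball open_Ival by metis
  define d where "d = min d1 d2 / 2"
  have "d > 0" "\<alpha> - d \<in> ball \<alpha> d1" "\<beta> + d \<in> ball \<beta> d2"
    using d1(1) d2(1) by (auto simp: d_def dist_real_def)
  then show ?thesis using that d1(2) d2(2) by blast
qed

lemma Ival_antiderivative:
  fixes f :: "real \<Rightarrow> real"
  assumes "a < b" "continuous_on (Ival a b) f"
  obtains F where "\<And>x. x \<in> Ival a b \<Longrightarrow> (F has_real_derivative f x) (at x)"
proof -
  have "\<exists>F. \<forall>x::real. a < x \<longrightarrow> x < b \<longrightarrow> (F has_vector_derivative f x) (at x)"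
    using assms continuous_on_eq_continuous_at[OF open_Ival[of a b]]
    by (intro einterval_antiderivative) (auto simp: Ival_def)
  then show ?thesis
    using that by (auto simp: Ival_def has_real_derivative_iff_has_vector_derivative)
qed

text \<open>Phrased with \<open>deriv\<close> as in \<open>C2c\<close>, so that
  \<open>C2_on UNIV\<close> is its smoothness clause, while smaller open sets admit factors such as
  \<open>\<psi>\<close> that are smooth only on the interval.\<close>

definition C2_on :: "real set \<Rightarrow> (real \<Rightarrow> real) \<Rightarrow> bool" where
  "C2_on S f \<longleftrightarrow> (\<forall>x\<in>S. f differentiable at x \<and> deriv f differentiable at x) \<and>
     continuous_on S (deriv (deriv f))"

text \<open>\<open>f1\<close> and \<open>f2\<close> are explicit candidates. Since \<open>S\<close>
  is open, \<open>deriv f\<close> agrees with \<open>f1\<close> near each point of \<open>S\<close>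
  and inherits its derivative.\<close>

lemma C2_onI_deriv2:
  assumes "open S"
    and f1: "\<And>x. x \<in> S \<Longrightarrow> (f has_real_derivative f1 x) (at x)"
    and f2: "\<And>x. x \<in> S \<Longrightarrow> (f1 has_real_derivative f2 x) (at x)"
    and c: "continuous_on S f2"
  shows "C2_on S f" "\<And>x. x \<in> S \<Longrightarrow> deriv f x = f1 x" "\<And>x. x \<in> S \<Longrightarrow> deriv (deriv f) x = f2 x"
proof -
  show e1: "deriv f x = f1 x" if "x \<in> S" for x
    using f1 that DERIV_imp_deriv by blast
  have d2: "(deriv f has_real_derivative f2 x) (at x)" if "x \<in> S" for x
    using has_field_derivative_transform_within_open[OF f2[OF that] \<open>open S\<close> that] e1 by metis
  then show e2: "deriv (deriv f) x = f2 x" if "x \<in> S" for x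
    using that DERIV_imp_deriv by blast
  have "continuous_on S (deriv (deriv f))"
    using c e2 continuous_on_cong by metis
  then show "C2_on S f"
    unfolding C2_on_def real_differentiable_def using f1 d2 by blast
qed

lemma C2_onD:
  assumes "C2_on S f" "x \<in> S"
  shows "(f has_real_derivative deriv f x) (at x)"
    and "(deriv f has_real_derivative deriv (deriv f) x) (at x)"
    and "isCont f x" "isCont (deriv f) x"
  using assms unfolding C2_on_def DERIV_deriv_iff_real_differentiable
  by (simp_all add: differentiable_imp_continuous_within)

lemma C2_on_continuous:
  assumes "C2_on S f"
  shows "continuous_on S f" "continuous_on S (deriv f)" "continuous_on S (deriv (deriv f))"
  using C2_onD(3,4)[OF assms] assms
  by (simp_all add: C2_on_def continuous_at_imp_continuous_on)

lemma C2_on_Un: "open S \<Longrightarrow> open U \<Longrightarrow> C2_on S f \<Longrightarrow> C2_on U f \<Longrightarrow> C2_on (S \<union> U) f"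
  unfolding C2_on_def by (simp add: continuous_on_open_Un ball_Un)

lemma C2_on_transform:
  assumes "open S" "C2_on S f" "\<And>x. x \<in> S \<Longrightarrow> h x = f x"
  shows "C2_on S h"
proof (rule C2_onI_deriv2(1)[OF \<open>open S\<close>])
  show "(h has_real_derivative deriv f x) (at x)" if "x \<in> S" for x
    using has_field_derivative_transform_within_open[OF C2_onD(1)[OF assms(2) that] \<open>open S\<close> that]
      assms(3) by metis
qed (fact C2_onD(2)[OF assms(2)] C2_on_continuous(3)[OF assms(2)])+

lemma C2_on_mult:
  assumes "open S" "C2_on S f" "C2_on S h"
  shows "C2_on S (\<lambda>x. f x * h x)"
proof (rule C2_onI_deriv2(1)[OF \<open>open S\<close>])
  show "((\<lambda>x. f x * h x) has_real_derivative deriv f x * h x + deriv h x * f x) (at x)"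
    if "x \<in> S" for x
    using C2_onD(1)[OF assms(2) that] C2_onD(1)[OF assms(3) that] by (rule DERIV_mult)
  show "((\<lambda>x. deriv f x * h x + deriv h x * f x) has_real_derivative
      (deriv (deriv f) x * h x + deriv h x * deriv f x) + (deriv (deriv h) x * f x + deriv f x * deriv h x)) (at x)"
    if "x \<in> S" for x
    using C2_onD[OF assms(2) that] C2_onD[OF assms(3) that]
    by (intro DERIV_add DERIV_mult)
  show "continuous_on S (\<lambda>x. (deriv (deriv f) x * h x + deriv h x * deriv f x) +
      (deriv (deriv h) x * f x + deriv f x * deriv h x))"
    using C2_on_continuous[OF assms(2)] C2_on_continuous[OF assms(3)]
    by (intro continuous_intros)
qed

lemma C2_on_const [simp]: "C2_on S (\<lambda>x. c)"
  unfolding C2_on_def by simp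

text \<open>The delicate point is the origin, where the difference quotient is at most |h|^(n+1).
  The cube is the first power of the positive part that is twice continuously differentiable, which
  is why cubes build the cutoff.\<close>

lemma max0_power_deriv:
  "((\<lambda>t::real. max 0 t ^ Suc (Suc n)) has_real_derivative real (Suc (Suc n)) * max 0 t ^ Suc n) (at t)"
proof -
  consider "t < 0" | "t = 0" | "t > 0" by linarith
  then show ?thesis
  proof cases
    case 1
    have "((\<lambda>t::real. 0) has_real_derivative 0) (at t)" by simp
    from has_field_derivative_transform_within_open[OF this, of "{..<0}" "\<lambda>t. max 0 t ^ Suc (Suc n)"]
    show ?thesis using 1 by auto
  next
    case 2
    have "((\<lambda>h::real. max 0 h ^ Suc (Suc n) / h) \<longlongrightarrow> 0) (at 0)"
    proof (rule Lim_null_comparison)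
      show "\<forall>\<^sub>F h in at 0. norm (max 0 h ^ Suc (Suc n) / h) \<le> \<bar>h :: real\<bar> ^ Suc n"
        by (auto intro!: always_eventually simp: max_def abs_mult power_abs mult_nonpos_nonneg)
      show "((\<lambda>h::real. \<bar>h\<bar> ^ Suc n) \<longlongrightarrow> 0) (at 0)"
        by (auto intro!: tendsto_eq_intros)
    qed
    then show ?thesis using 2 by (simp add: DERIV_def)
  next
    case 3
    have "((\<lambda>t::real. t ^ Suc (Suc n)) has_real_derivative real (Suc (Suc n)) * t ^ Suc n) (at t)"
      by (rule derivative_eq_intros refl | simp)+
    from has_field_derivative_transform_within_open[OF this, of "{0<..}" "\<lambda>t. max 0 t ^ Suc (Suc n)"]
    show ?thesis using 3 by (auto simp: max_def)
  qed
qed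

lemma max0_cube_comp_C2:
  assumes "C2_on UNIV f"
  shows "C2_on UNIV (\<lambda>x. max 0 (f x) ^ 3)"
proof (rule C2_onI_deriv2(1)[OF open_UNIV])
  show "((\<lambda>x. max 0 (f x) ^ 3) has_real_derivative (3 * max 0 (f x) ^ 2) * deriv f x) (at x)" for x
    using DERIV_chain2[OF max0_power_deriv[of 1] C2_onD(1)[OF assms UNIV_I]]
    by (simp add: numeral_eq_Suc)
  have "((\<lambda>x. max 0 (f x) ^ 2) has_real_derivative (2 * max 0 (f x)) * deriv f x) (at x)" for x
    using DERIV_chain2[OF max0_power_deriv[of 0] C2_onD(1)[OF assms UNIV_I]]
    by (simp add: numeral_eq_Suc)
  from DERIV_mult[OF DERIV_cmult[OF this] C2_onD(2)[OF assms UNIV_I]]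
  show "((\<lambda>x. (3 * max 0 (f x) ^ 2) * deriv f x) has_real_derivative
     3 * ((2 * max 0 (f x)) * deriv f x) * deriv f x + deriv (deriv f) x * (3 * max 0 (f x) ^ 2)) (at x)" for x .
  show "continuous_on UNIV (\<lambda>x. 3 * ((2 * max 0 (f x)) * deriv f x) * deriv f x + deriv (deriv f) x * (3 * max 0 (f x) ^ 2))"
    using C2_on_continuous[OF assms] by (intro continuous_intros)
qed

lemma C2_on_affine: "C2_on UNIV (\<lambda>x. c * x + d)"
proof (rule C2_onI_deriv2(1)[OF open_UNIV])
  show "((\<lambda>x. c * x + d) has_real_derivative c) (at x)" for x
    by (rule derivative_eq_intros refl | simp)+
  show "((\<lambda>x. c) has_real_derivative 0) (at x)" for x by simp
qed simp

lemma C2_on_diff: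
  assumes "open S" "C2_on S f" "C2_on S h"
  shows "C2_on S (\<lambda>x. f x - h x)"
proof (rule C2_onI_deriv2(1)[OF \<open>open S\<close>])
  show "((\<lambda>x. f x - h x) has_real_derivative deriv f x - deriv h x) (at x)" if "x \<in> S" for x
    using C2_onD(1)[OF assms(2) that] C2_onD(1)[OF assms(3) that] by (rule DERIV_diff)
  show "((\<lambda>x. deriv f x - deriv h x) has_real_derivative deriv (deriv f) x - deriv (deriv h) x) (at x)"
    if "x \<in> S" for x
    using C2_onD(2)[OF assms(2) that] C2_onD(2)[OF assms(3) that] by (rule DERIV_diff)
qed (use C2_on_continuous[OF assms(2)] C2_on_continuous[OF assms(3)] in \<open>intro continuous_intros\<close>)

text \<open>\<open>A\<close> and \<open>B\<close> are cubes of positive parts of affine functions: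
  both vanish on [\<alpha>, \<beta>], and one of them is at least 1 beyond the margin
  \<open>d\<close>. The cubed positive part of 1 - A - B is then 1 inside and 0 outside.\<close>

lemma C2_cutoff:
  fixes \<alpha> \<beta> d :: real
  assumes "d > 0" "\<alpha> \<le> \<beta>"
  obtains \<theta> where "C2_on UNIV \<theta>" "\<And>x. 0 \<le> \<theta> x" "\<And>x. \<alpha> \<le> x \<Longrightarrow> x \<le> \<beta> \<Longrightarrow> \<theta> x = 1"
    "\<And>x. x \<notin> {\<alpha> - d..\<beta> + d} \<Longrightarrow> \<theta> x = 0"
proof -
  define A where "A x = max 0 (- (1/d) * x + \<alpha> / d) ^ 3" for x :: real
  define B where "B x = max 0 ((1/d) * x + - \<beta> / d) ^ 3" for x :: real
  define \<theta> where "\<theta> x = max 0 ((1 - A x) - B x) ^ 3" for x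
  have "C2_on UNIV A" "C2_on UNIV B"
    unfolding A_def B_def by (intro max0_cube_comp_C2 C2_on_affine)+
  then have 1: "C2_on UNIV \<theta>"
    unfolding \<theta>_def by (intro max0_cube_comp_C2 C2_on_diff open_UNIV C2_on_const)
  have 2: "0 \<le> \<theta> x" for x by (simp add: \<theta>_def)
  have 3: "\<theta> x = 1" if "\<alpha> \<le> x" "x \<le> \<beta>" for x
  proof -
    have "- (1/d) * x + \<alpha> / d \<le> 0" "(1/d) * x + - \<beta> / d \<le> 0"
      using that assms by (auto simp: field_simps)
    then have "A x = 0" "B x = 0" by (simp_all add: A_def B_def)
    then show ?thesis by (simp add: \<theta>_def)
  qed
  have 4: "\<theta> x = 0" if "x \<notin> {\<alpha> - d..\<beta> + d}" for x
  proof -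
    have nn: "A x \<ge> 0" "B x \<ge> 0" by (simp_all add: A_def B_def)
    have "A x \<ge> 1 \<or> B x \<ge> 1"
    proof (cases "x < \<alpha> - d")
      case True
      then have "- (1/d) * x + \<alpha> / d \<ge> 1" using assms by (auto simp: field_simps)
      then show ?thesis unfolding A_def by (intro disjI1 one_le_power) simp
    next
      case False
      then have "(1/d) * x + - \<beta> / d \<ge> 1" using assms that by (auto simp: field_simps)
      then show ?thesis unfolding B_def by (intro disjI2 one_le_power) simp
    qed
    then have "(1 - A x) - B x \<le> 0" using nn by linarith
    then show ?thesis by (simp add: \<theta>_def)
  qed
  show ?thesis using that[OF 1 2 3 4] .
qed

section \<open>Smoothing of nonincreasing functions\<close>

lemma antimono_integrable_on:
  fixes M :: "real \<Rightarrow> real"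
  assumes "antimono M"
  shows "M integrable_on {c..d}"
proof -
  have "(\<lambda>x. - M x) integrable_on {c..d}"
    using assms by (intro integrable_on_mono_on) (auto simp: mono_on_def antimono_def)
  then show ?thesis using integrable_neg by fastforce
qed

lemma antimono_integral_bounds:
  fixes M :: "real \<Rightarrow> real"
  assumes "antimono M" "0 \<le> h"
  shows "h * M (t + h) \<le> integral {t..t+h} M" "integral {t..t+h} M \<le> h * M t"
proof -
  have "integral {t..t+h} (\<lambda>_. M (t+h)) \<le> integral {t..t+h} M"
    using assms by (intro integral_le antimono_integrable_on) (auto simp: antimono_def)
  then show "h * M (t + h) \<le> integral {t..t+h} M" using assms by simp
  have "integral {t..t+h} M \<le> integral {t..t+h} (\<lambda>_. M t)"
    using assms by (intro integral_le antimono_integrable_on) (auto simp: antimono_def)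
  then show "integral {t..t+h} M \<le> h * M t" using assms by simp
qed

text \<open>Two successive forward averages over windows of length \<open>h\<close>: the first makes
  a monotone function continuous, the second continuously differentiable. An average of a
  nonincreasing function over [t, t + h] lies between its end values, so each average stays below
  the function and above its shift by \<open>h\<close>.\<close>

lemma antimono_smoothing:
  fixes M :: "real \<Rightarrow> real"
  assumes M: "antimono M" and "0 < h"
  obtains N N' where "\<And>t. (N has_real_derivative N' t) (at t)" "continuous_on UNIV N'"
    "\<And>t. N' t \<le> 0" "\<And>t. M (t + 2 * h) \<le> N t" "\<And>t. N t \<le> M t"
proof -
  define M1 where "M1 t = integral {t..t+h} M / h" for t
  have bnd: "M (t + h) \<le> M1 t" "M1 t \<le> M t" for t
    using antimono_integral_bounds[OF M, of h t] \<open>0 < h\<close> by (auto simp: M1_def field_simps)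
  have M1_anti: "M1 t \<le> M1 s" if "s \<le> t" for s t
  proof -
    have sh: "integral {t..t+h} M = integral {s..s+h} (\<lambda>x. M (x + (t - s)))"
      using integral_shift_Icc_real[of s "s + h" M "t - s"] by (simp add: algebra_simps comp_def)
    have "antimono (\<lambda>x. M (x + (t - s)))"
      using M by (auto simp: antimono_def)
    then have "integral {s..s+h} (\<lambda>x. M (x + (t - s))) \<le> integral {s..s+h} M"
      using M that by (intro integral_le antimono_integrable_on) (auto simp: antimono_def)
    then show ?thesis using \<open>0 < h\<close> by (simp add: M1_def sh divide_right_mono)
  qed
  have M1_cont: "isCont M1 t0" for t0
  proof -
    define c where "c = t0 - 1"
    have eq: "M1 t = (integral {c..t+h} M - integral {c..t} M) / h" if "c \<le> t" for t
      using that \<open>0 < h\<close> Henstock_Kurzweil_Integration.integral_combine[of c t "t+h" M]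
        antimono_integrable_on[OF M] by (simp add: M1_def)
    have ci: "continuous_on {c..t0+1+h} (\<lambda>t. integral {c..t} M)"
      by (intro indefinite_integral_continuous_1 antimono_integrable_on M)
    have "continuous_on {c..t0+1} (\<lambda>t. (integral {c..t+h} M - integral {c..t} M) / h)"
      using \<open>0 < h\<close>
      by (intro continuous_intros continuous_on_compose2[OF ci] continuous_on_subset[OF ci]) auto
    then have "continuous_on {c..t0+1} M1"
      by (rule continuous_on_eq) (simp add: eq)
    then show ?thesis
      by (rule continuous_on_interior) (simp add: c_def)
  qed
  obtain W where W: "(W has_real_derivative M1 t) (at t)" for t
    using Ival_antiderivative[of "-\<infinity>" \<infinity> M1] M1_cont
    by (auto simp: Ival_def continuous_at_imp_continuous_on)
  \<comment> \<open>The second average, that of \<open>M1\<close>, written as a difference quotient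
    of an antiderivative so that its derivative is explicit.\<close>
  define N where "N t = (W (t + h) - W t) / h" for t
  define N' where "N' t = (M1 (t + h) - M1 t) / h" for t
  have mvt: "\<exists>\<xi>. t < \<xi> \<and> \<xi> < t + h \<and> N t = M1 \<xi>" for t
  proof -
    obtain \<xi> where "t < \<xi>" "\<xi> < t + h" "W (t + h) - W t = (t + h - t) * M1 \<xi>"
      using MVT2[of t "t + h" W M1] \<open>0 < h\<close> W by auto
    then show ?thesis using \<open>0 < h\<close> by (auto simp: N_def)
  qed
  show ?thesis
  proof (rule that)
    show "(N has_real_derivative N' t) (at t)" for t
      unfolding N_def N'_def
      using W[of "t + h"] W[of t] by (intro DERIV_cdivide DERIV_diff) (simp_all add: DERIV_shift)
    have c: "continuous_on UNIV M1" by (simp add: M1_cont continuous_at_imp_continuous_on)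
    have "continuous_on UNIV (\<lambda>t. M1 (t + h))"
      by (rule continuous_on_compose2[OF c]) (auto intro!: continuous_intros)
    then show "continuous_on UNIV N'"
      unfolding N'_def using \<open>0 < h\<close> c by (intro continuous_on_divide continuous_on_diff) auto
    show "N' t \<le> 0" for t
      using M1_anti[of t "t + h"] \<open>0 < h\<close> by (simp add: N'_def divide_nonpos_pos)
    show "M (t + 2 * h) \<le> N t" for t
    proof -
      obtain \<xi> where \<xi>: "t < \<xi>" "\<xi> < t + h" "N t = M1 \<xi>" using mvt by blast
      have "M (t + 2 * h) \<le> M (\<xi> + h)" using M \<xi> by (auto simp: antimono_def)
      then show ?thesis using bnd(1)[of \<xi>] \<xi> by simp
    qed
    show "N t \<le> M t" for t
    proof -
      obtain \<xi> where \<xi>: "t < \<xi>" "\<xi> < t + h" "N t = M1 \<xi>" using mvt by blast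
      have "M \<xi> \<le> M t" using M \<xi> by (auto simp: antimono_def)
      then show ?thesis using bnd(2)[of \<xi>] \<xi> by simp
    qed
  qed
qed

text \<open>The integrals of \<open>M\<close> and of its shift have everything in common but two end
  strips of length \<open>k\<close>; the difference is of order \<open>k\<close> even where
  \<open>M\<close> jumps.\<close>

lemma antimono_shift_integral:
  fixes M :: "real \<Rightarrow> real"
  assumes M: "antimono M" and "0 \<le> k" "x \<le> q"
  shows "integral {x..q} (\<lambda>t. M t - M (t + k)) \<le> k * (M x - M (q + k))"
proof -
  have i: "M integrable_on {c..d}" for c d by (rule antimono_integrable_on[OF M])
  have "antimono (\<lambda>x. M (x + k))" using M by (auto simp: antimono_def)
  then have i': "(\<lambda>x. M (x + k)) integrable_on {x..q}" by (rule antimono_integrable_on)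
  have "integral {x..q} (\<lambda>t. M t - M (t + k)) = integral {x..q} M - integral {x+k..q+k} M"
    using integral_shift_Icc_real[of x q M k] by (simp add: integral_diff[OF i i'] comp_def add.commute)
  also have "\<dots> = integral {x..x+k} M - integral {q..q+k} M"
    using Henstock_Kurzweil_Integration.integral_combine[of x q "q+k" M]
      Henstock_Kurzweil_Integration.integral_combine[of x "x+k" "q+k" M] i assms by auto
  also have "\<dots> \<le> k * (M x - M (q + k))"
    using antimono_integral_bounds[OF M \<open>0 \<le> k\<close>, of x] antimono_integral_bounds[OF M \<open>0 \<le> k\<close>, of q]
    by (simp add: algebra_simps)
  finally show ?thesis .
qed

section \<open>Supersolutions\<close>

lemma gen_cong_open:
  assumes "open S" "x \<in> S" "\<And>y. y \<in> S \<Longrightarrow> f y = h y"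
  shows "gen \<mu> \<sigma> f x = gen \<mu> \<sigma> h x"
proof -
  have d: "deriv f y = deriv h y" if "y \<in> S" for y
    by (rule deriv_cong_ev) (use assms that in \<open>auto simp: eventually_nhds\<close>)
  moreover have "deriv (deriv f) x = deriv (deriv h) x"
    by (rule deriv_cong_ev) (use assms d in \<open>auto simp: eventually_nhds\<close>)
  ultimately show ?thesis using assms(2) by (simp add: gen_def)
qed

locale increasing_solution =
  fixes a b :: ereal and \<mu> \<sigma> \<psi> :: "real \<Rightarrow> real" and r :: real
  assumes ab: "a < b"
    and cont_mu: "continuous_on (Ival a b) \<mu>"
    and cont_sigma: "continuous_on (Ival a b) \<sigma>"
    and sigma_pos: "x \<in> Ival a b \<Longrightarrow> 0 < \<sigma> x"
    and r_pos: "0 < r"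
    and psi_pos: "x \<in> Ival a b \<Longrightarrow> 0 < \<psi> x"
    and psi_mono: "strict_mono_on (Ival a b) \<psi>"
    and psi_C2: "C2_on (Ival a b) \<psi>"
    and psi_ode: "x \<in> Ival a b \<Longrightarrow> gen \<mu> \<sigma> \<psi> x = r * \<psi> x"
begin

lemmas psi_D = C2_onD[OF psi_C2]
lemmas psi_cont = C2_on_continuous[OF psi_C2]

text \<open>Strict monotonicity alone gives only a nonnegative derivative. At a zero of it the
  equation would force a positive second derivative, hence a negative first derivative just to the
  left.\<close>

lemma psi_deriv_pos:
  assumes x: "x \<in> Ival a b"
  shows "0 < deriv \<psi> x"
proof -
  have nn: "0 \<le> deriv \<psi> y" if "y \<in> Ival a b" for y
    using mono_on_imp_deriv_nonneg[OF strict_mono_on_imp_mono_on[OF psi_mono] psi_D(1)[OF that]] that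
    by (simp add: interior_open)
  have "deriv \<psi> x \<noteq> 0"
  proof
    assume 0: "deriv \<psi> x = 0"
    have "(\<sigma> x)^2 / 2 * deriv (deriv \<psi>) x = r * \<psi> x"
      using psi_ode[OF x] 0 by (simp add: gen_def)
    moreover have "r * \<psi> x > 0" using r_pos psi_pos[OF x] by simp
    ultimately have "deriv (deriv \<psi>) x > 0"
      using sigma_pos[OF x] by (metis half_gt_zero_iff zero_less_mult_pos zero_less_power)
    from DERIV_pos_inc_left[OF psi_D(2)[OF x] this]
    obtain d where d: "d > 0" "\<And>h. h > 0 \<Longrightarrow> h < d \<Longrightarrow> deriv \<psi> (x - h) < 0" using 0 by auto
    obtain e where e: "e > 0" "x - e \<in> Ival a b" using Ival_margin[OF x x] by metis
    define h where "h = min (d/2) e"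
    have "x - h \<in> Ival a b"
      by (rule Ival_between[OF e(2) x]) (use d e in \<open>auto simp: h_def\<close>)
    moreover have "deriv \<psi> (x - h) < 0" by (rule d(2)) (use d e in \<open>auto simp: h_def\<close>)
    ultimately show False using nn by force
  qed
  then show ?thesis using nn[OF x] by simp
qed

text \<open>\<open>\<rho>\<close> is the exponential of an antiderivative of 2 \<mu> / \<sigma>^2,
  the integrating factor that turns the generator into \<sigma>^2 / (2 \<rho>) times (\<rho>
  f')'.\<close>

lemma scale_density_exists:
  obtains \<rho> where "\<And>x. x \<in> Ival a b \<Longrightarrow> 0 < \<rho> x"
    "\<And>x. x \<in> Ival a b \<Longrightarrow> (\<rho> has_real_derivative \<rho> x * (2 * \<mu> x / (\<sigma> x)^2)) (at x)"
proof -
  have c0: "continuous_on (Ival a b) (\<lambda>x. 2 * \<mu> x / (\<sigma> x)^2)"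
    using cont_mu cont_sigma sigma_pos by (intro continuous_intros) force+
  obtain R where R: "\<And>x. x \<in> Ival a b \<Longrightarrow> (R has_real_derivative (2 * \<mu> x / (\<sigma> x)^2)) (at x)"
    by (rule Ival_antiderivative[OF ab c0]) blast
  show ?thesis
    by (rule that[of "\<lambda>x. exp (R x)"]) (auto intro!: derivative_eq_intros R)
qed

text \<open>Writing a function as \<open>\<psi> V\<close> turns the sign of \<open>gen - r\<close> into the monotonicity of
  \<open>\<rho> \<psi>\<^sup>2 V'\<close>. Smoothing this monotone function therefore preserves supersolutions, and since
  the smoothing lies below it, \<open>V\<close> is approximated from above.\<close>

lemma supersolution_approx:
  fixes \<rho> v m :: "real \<Rightarrow> real"
  assumes rho_pos: "\<And>x. x \<in> Ival a b \<Longrightarrow> 0 < \<rho> x"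
    and rho_deriv: "\<And>x. x \<in> Ival a b \<Longrightarrow> (\<rho> has_real_derivative \<rho> x * (2 * \<mu> x / (\<sigma> x)^2)) (at x)"
    and m_anti: "\<And>x y. x \<in> Ival a b \<Longrightarrow> y \<in> Ival a b \<Longrightarrow> x \<le> y \<Longrightarrow> m y \<le> m x"
    and m_nonpos: "\<And>x. x \<in> Ival a b \<Longrightarrow> m x \<le> 0"
    and v_nonneg: "\<And>x. x \<in> Ival a b \<Longrightarrow> 0 \<le> v x"
    and v_int: "\<And>x y. x \<in> Ival a b \<Longrightarrow> y \<in> Ival a b \<Longrightarrow> x \<le> y \<Longrightarrow>
        ((\<lambda>t. m t / (\<rho> t * (\<psi> t)^2)) has_integral (v y - v x)) {x..y}"
    and \<alpha>: "\<alpha> \<in> Ival a b" and \<beta>: "\<beta> \<in> Ival a b" and x0: "\<alpha> \<le> x0" "x0 \<le> \<beta>" and "0 < e"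
  obtains f where "C2c (Ival a b) f" "\<And>x. 0 \<le> f x"
    "\<And>x. \<alpha> \<le> x \<Longrightarrow> x \<le> \<beta> \<Longrightarrow> gen \<mu> \<sigma> f x - r * f x \<le> 0"
    "\<And>x. \<alpha> \<le> x \<Longrightarrow> x \<le> \<beta> \<Longrightarrow> \<psi> x * v x \<le> f x"
    "f x0 \<le> \<psi> x0 * v x0 + e"
proof -
  let ?I = "Ival a b"
  obtain D where D: "D > 0" "\<alpha> - D \<in> ?I" "\<beta> + D \<in> ?I" using Ival_margin[OF \<alpha> \<beta>] by metis
  \<comment> \<open>Half of the margin carries the descent of the cutoff. On the other half the
    cutoff is 1, so that \<open>f\<close> and \<psi> V agree on an open neighbourhood of
    [\<alpha>, \<beta>] and have the same generator on it.\<close>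
  define d where "d = D / 2"
  define p where "p = \<alpha> - D"
  define q where "q = \<beta> + D"
  have d: "d > 0" "\<alpha> - 2 * d = p" "\<beta> + 2 * d = q" using D by (auto simp: d_def p_def q_def)
  have pq: "p \<in> ?I" "q \<in> ?I" "p < \<alpha>" "\<beta> < q" "p < q" "p \<le> x0" "x0 \<le> q"
    using D x0 by (auto simp: p_def q_def)
  have pqI: "x \<in> ?I" if "p \<le> x" "x \<le> q" for x using Ival_between pq(1,2) that by blast
  have x0I: "x0 \<in> ?I" using pqI pq by auto
  define s where "s t = \<rho> t * (\<psi> t)^2" for t
  have s_pos: "0 < s x" if "x \<in> ?I" for x using rho_pos[OF that] psi_pos[OF that] by (simp add: s_def)
  define s' where "s' t = \<rho> t * (2 * \<mu> t / (\<sigma> t)^2) * (\<psi> t)^2 + 2 * \<psi> t * deriv \<psi> t * \<rho> t" for t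
  have s_deriv: "(s has_real_derivative s' x) (at x)" if "x \<in> ?I" for x
    unfolding s_def s'_def
    by (rule derivative_eq_intros rho_deriv[OF that] psi_D(1)[OF that] refl)+ simp
  have rho_cont: "continuous_on ?I \<rho>"
    using rho_deriv DERIV_isCont continuous_at_imp_continuous_on by blast
  have s_cont: "continuous_on ?I s"
    using s_deriv DERIV_isCont continuous_at_imp_continuous_on by blast
  have s'_cont: "continuous_on ?I s'"
    unfolding s'_def using rho_cont psi_cont cont_mu cont_sigma sigma_pos
    by (intro continuous_intros) force+
  \<comment> \<open>Frozen at its end values outside [p, q], because the smoothing asks for an
    antitone function on the whole line.\<close>
  define M where "M t = m (max p (min q t))" for t
  have M_anti: "antimono M"
    unfolding antimono_def M_def using pq by (intro allI impI m_anti pqI) auto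
  have M_nonpos: "M t \<le> 0" for t
    unfolding M_def using pq by (intro m_nonpos pqI) auto
  have M_eq: "M t = m t" if "p \<le> t" "t \<le> q" for t using that by (simp add: M_def)
  obtain C where C: "C > 0" "\<And>x. x \<in> {p..q} \<Longrightarrow> 1 / s x \<le> C"
  proof -
    have "continuous_on {p..q} (\<lambda>x. 1 / s x)"
      using s_pos pqI by (intro continuous_intros continuous_on_subset[OF s_cont]) force+
    then have "bounded ((\<lambda>x. 1 / s x) ` {p..q})"
      by (intro compact_imp_bounded compact_continuous_image) auto
    then obtain C where "C > 0" "\<And>x. x \<in> {p..q} \<Longrightarrow> norm (1 / s x) \<le> C"
      unfolding bounded_pos by auto
    then show ?thesis using that abs_le_D1 real_norm_def by metis
  qed
  \<comment> \<open>The error at \<open>x0\<close> will be at most 2 h E. Using \<open>q + 1\<close>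
    in place of \<open>q + 2 * h\<close> lets \<open>E\<close> be fixed before \<open>h\<close>,
    whence the requirement \<open>2 * h \<le> 1\<close>; the 1 bounds \<open>M x0\<close> from above
    and keeps \<open>E\<close> positive.\<close>
  define E where "E = \<psi> x0 * C * (1 - M (q + 1))"
  have E: "E > 0" unfolding E_def using C psi_pos[OF x0I] M_nonpos[of "q+1"] by simp
  define h where "h = min (1/2) (e / (2 * E))"
  have h: "h > 0" "2 * h \<le> 1" "2 * h * E \<le> e" using E \<open>0 < e\<close> by (auto simp: h_def min_def field_simps)
  obtain N N' where N: "\<And>t. (N has_real_derivative N' t) (at t)" "continuous_on UNIV N'"
    "\<And>t. N' t \<le> 0" "\<And>t. M (t + 2 * h) \<le> N t" "\<And>t. N t \<le> M t"
    using antimono_smoothing[OF M_anti h(1)] by metis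
  have N_cont: "continuous_on UNIV N" using N(1) DERIV_isCont continuous_at_imp_continuous_on by blast
  have c0: "continuous_on ?I (\<lambda>t. N t / s t)"
    using s_pos by (intro continuous_intros s_cont continuous_on_subset[OF N_cont]) force+
  obtain W where W: "\<And>x. x \<in> ?I \<Longrightarrow> (W has_real_derivative N x / s x) (at x)"
    by (rule Ival_antiderivative[OF ab c0]) blast
  \<comment> \<open>\<open>V\<close> is pinned to \<open>v\<close> at the right end
    \<open>q\<close>. Its slope \<open>N / s\<close> is at most \<open>m / s\<close>, so going left
    from \<open>q\<close> it lies above \<open>v\<close>.\<close>
  define V where "V t = v q - W q + W t" for t
  have V_deriv: "(V has_real_derivative N x / s x) (at x)" if "x \<in> ?I" for x
    unfolding V_def using W[OF that] by (auto intro!: derivative_eq_intros)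
  define V2 where "V2 t = (N' t * s t - N t * s' t) / (s t * s t)" for t
  have V_deriv2: "((\<lambda>t. N t / s t) has_real_derivative V2 x) (at x)" if "x \<in> ?I" for x
    unfolding V2_def using s_pos[OF that] by (intro DERIV_divide N(1) s_deriv[OF that]) simp
  have "continuous_on ?I V2"
    unfolding V2_def using s_pos
    by (intro continuous_intros s_cont s'_cont continuous_on_subset[OF N_cont] continuous_on_subset[OF N(2)]) force+
  note V_C2 = C2_onI_deriv2[OF open_Ival V_deriv V_deriv2 this]
  have W_int: "((\<lambda>t. N t / s t) has_integral (W q - W t)) {t..q}" if "p \<le> t" "t \<le> q" for t
    using that W pqI
    by (intro fundamental_theorem_of_calculus)
      (auto simp: has_real_derivative_iff_has_vector_derivative[symmetric] intro: has_field_derivative_at_within)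
  have v_int': "((\<lambda>t. m t / s t) has_integral (v q - v t)) {t..q}" if "p \<le> t" "t \<le> q" for t
    using v_int[OF pqI[OF that] pq(2) that(2)] by (simp add: s_def)
  have V_ge: "v t \<le> V t" if "p \<le> t" "t \<le> q" for t
  proof -
    have "W q - W t \<le> v q - v t"
    proof (rule has_integral_le[OF W_int[OF that] v_int'[OF that]])
      fix x assume "x \<in> {t..q}"
      then have "p \<le> x" "x \<le> q" using that by auto
      then show "N x / s x \<le> m x / s x"
        using N(5)[of x] M_eq[of x] s_pos[OF pqI] by (simp add: divide_right_mono less_imp_le)
    qed
    then show ?thesis by (simp add: V_def)
  qed
  have V_x0: "V x0 - v x0 \<le> 2 * h * C * (1 - M (q + 1))"
  proof -
    have i: "((\<lambda>t. m t / s t - N t / s t) has_integral (v q - v x0) - (W q - W x0)) {x0..q}"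
      using v_int' W_int pq by (intro has_integral_diff) auto
    have anti': "antimono (\<lambda>t. M (t + 2 * h))" using M_anti by (auto simp: antimono_def)
    have j: "((\<lambda>t. C * (M t - M (t + 2 * h))) has_integral C * integral {x0..q} (\<lambda>t. M t - M (t + 2 * h))) {x0..q}"
      by (intro has_integral_mult_right integrable_integral integrable_diff
          antimono_integrable_on M_anti anti')
    have "(v q - v x0) - (W q - W x0) \<le> C * integral {x0..q} (\<lambda>t. M t - M (t + 2 * h))"
    proof (rule has_integral_le[OF i j])
      fix t assume "t \<in> {x0..q}"
      then have t: "p \<le> t" "t \<le> q" using pq by auto
      have "m t / s t - N t / s t = (M t - N t) * (1 / s t)"
        using M_eq[OF t] by (simp add: diff_divide_distrib)
      also have "\<dots> \<le> (M t - M (t + 2 * h)) * C"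
        using N(4,5)[of t] C(2)[of t] t s_pos[OF pqI[OF t]] by (intro mult_mono) auto
      finally show "m t / s t - N t / s t \<le> C * (M t - M (t + 2 * h))" by (simp add: mult.commute)
    qed
    also have "\<dots> \<le> C * (2 * h * (M x0 - M (q + 2 * h)))"
      using antimono_shift_integral[OF M_anti, of "2 * h" x0 q] h pq C by (intro mult_left_mono) auto
    also have "\<dots> \<le> C * (2 * h * (1 - M (q + 1)))"
    proof -
      have "M (q + 1) \<le> M (q + 2 * h)" using M_anti h by (auto simp: antimono_def)
      then show ?thesis using M_nonpos[of x0] C h by (intro mult_left_mono) auto
    qed
    finally show ?thesis by (simp add: V_def algebra_simps)
  qed
  obtain \<theta> where \<theta>: "C2_on UNIV \<theta>" "\<And>x. 0 \<le> \<theta> x" "\<And>x. \<alpha> - d \<le> x \<Longrightarrow> x \<le> \<beta> + d \<Longrightarrow> \<theta> x = 1"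
    "\<And>x. x \<notin> {p..q} \<Longrightarrow> \<theta> x = 0"
  proof -
    have "\<alpha> - d \<le> \<beta> + d" using d x0 by simp
    moreover have "\<alpha> - d - d = p" "\<beta> + d + d = q" using d by auto
    ultimately show ?thesis using C2_cutoff[OF d(1), of "\<alpha> - d" "\<beta> + d"] that by metis
  qed
  define f where "f x = \<theta> x * (\<psi> x * V x)" for x
  have "C2_on ?I \<theta>" using \<theta>(1) by (auto simp: C2_on_def intro: continuous_on_subset)
  then have "C2_on ?I f"
    unfolding f_def using V_C2(1) psi_C2 by (intro C2_on_mult) auto
  moreover have "C2_on (- {p..q}) f"
    by (rule C2_on_transform[OF _ C2_on_const[of _ 0]]) (auto simp: f_def \<theta>(4) open_Compl)
  moreover have "?I \<union> - {p..q} = UNIV" using pqI by auto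
  ultimately have f_C2: "C2_on UNIV f"
    using C2_on_Un[OF open_Ival, of "- {p..q}"] by (metis closed_atLeastAtMost open_Compl)
  have C2c: "C2c ?I f"
    using f_C2 unfolding C2_on_def C2c_def
    by (auto intro!: exI[of _ "{p..q}"] simp: f_def \<theta>(4) pqI)
  have f_nonneg: "0 \<le> f x" for x
  proof (cases "x \<in> {p..q}")
    case True
    then show ?thesis
      using V_ge[of x] v_nonneg[OF pqI, of x] psi_pos[OF pqI, of x] \<theta>(2)[of x] by (simp add: f_def)
  next
    case False then show ?thesis by (simp add: f_def \<theta>(4))
  qed
  have f_eq: "f x = \<psi> x * V x" if "x \<in> {\<alpha> - d<..<\<beta> + d}" for x
    using that by (simp add: f_def \<theta>(3))
  have super: "gen \<mu> \<sigma> f x - r * f x \<le> 0" if "\<alpha> \<le> x" "x \<le> \<beta>" for x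
  proof -
    have xS: "x \<in> {\<alpha> - d<..<\<beta> + d}" using that d by auto
    have xI: "x \<in> ?I" using that pq by (intro pqI) auto
    have g1: "gen \<mu> \<sigma> f x = gen \<mu> \<sigma> (\<lambda>x. \<psi> x * V x) x"
      by (rule gen_cong_open[OF _ xS]) (auto simp: f_eq)
    let ?f1 = "\<lambda>x. deriv \<psi> x * V x + N x / s x * \<psi> x"
    let ?f2 = "\<lambda>x. (deriv (deriv \<psi>) x * V x + N x / s x * deriv \<psi> x) + (V2 x * \<psi> x + deriv \<psi> x * (N x / s x))"
    have f1: "((\<lambda>x. \<psi> x * V x) has_real_derivative ?f1 x) (at x)" if "x \<in> ?I" for x
      by (rule DERIV_mult[OF psi_D(1)[OF that] V_deriv[OF that]])
    have f2: "(?f1 has_real_derivative ?f2 x) (at x)" if "x \<in> ?I" for x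
      by (rule DERIV_add[OF DERIV_mult[OF psi_D(2)[OF that] V_deriv[OF that]]
            DERIV_mult[OF V_deriv2[OF that] psi_D(1)[OF that]]])
    have e1: "deriv (\<lambda>x. \<psi> x * V x) y = ?f1 y" if "y \<in> ?I" for y using f1[OF that] DERIV_imp_deriv by blast
    have "(deriv (\<lambda>x. \<psi> x * V x) has_real_derivative ?f2 x) (at x)"
      using has_field_derivative_transform_within_open[OF f2[OF xI] open_Ival xI] e1 by metis
    then have e2: "deriv (deriv (\<lambda>x. \<psi> x * V x)) x = ?f2 x" using DERIV_imp_deriv by blast
    have sp: "s x > 0" "\<sigma> x > 0" "\<psi> x > 0" using s_pos sigma_pos psi_pos xI by auto
    \<comment> \<open>\<open>w\<close> is the derivative of \<open>V\<close>. The zero-order part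
      vanishes by the equation for \<open>\<psi>\<close>, and the terms in \<open>w\<close> cancel
      against the logarithmic derivative of \<open>s\<close>; only the term with \<open>N'\<close>
      survives.\<close>
    define w where "w = N x / s x"
    have V2w: "V2 x = N' x / s x - w * (s' x / s x)"
      using sp by (simp add: V2_def w_def field_simps)
    have s'w: "s' x / s x = 2 * \<mu> x / (\<sigma> x)^2 + 2 * deriv \<psi> x / \<psi> x"
      unfolding s'_def s_def using sp rho_pos[OF xI] by (simp add: field_simps power2_eq_square)
    have "gen \<mu> \<sigma> (\<lambda>x. \<psi> x * V x) x - r * (\<psi> x * V x) =
        V x * (gen \<mu> \<sigma> \<psi> x - r * \<psi> x) + (\<sigma> x)^2 / 2 * (2 * deriv \<psi> x * w + \<psi> x * V2 x) + \<mu> x * \<psi> x * w"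
      unfolding gen_def e2 e1[OF xI] w_def[symmetric] by (simp add: algebra_simps)
    also have "\<dots> = (\<sigma> x)^2 * \<psi> x / (2 * s x) * N' x"
      unfolding V2w s'w psi_ode[OF xI] using sp by (simp add: field_simps power2_eq_square)
    also have "\<dots> \<le> 0" using sp N(3)[of x] by (intro mult_nonneg_nonpos) auto
    finally show ?thesis using g1 f_eq[OF xS] by simp
  qed
  have ge: "\<psi> x * v x \<le> f x" if "\<alpha> \<le> x" "x \<le> \<beta>" for x
  proof -
    have "p \<le> x" "x \<le> q" using that pq by auto
    then show ?thesis
      using V_ge[of x] psi_pos[OF pqI, of x] f_eq[of x] that d by (simp add: mult_left_mono)
  qed
  have "f x0 \<le> \<psi> x0 * v x0 + e"
  proof -
    have "f x0 = \<psi> x0 * V x0" using f_eq x0 d by auto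
    also have "\<dots> \<le> \<psi> x0 * (v x0 + 2 * h * C * (1 - M (q + 1)))"
      using V_x0 psi_pos[OF x0I] by (intro mult_left_mono) auto
    also have "\<dots> = \<psi> x0 * v x0 + 2 * h * E" by (simp add: E_def algebra_simps)
    also have "\<dots> \<le> \<psi> x0 * v x0 + e" using h by simp
    finally show ?thesis .
  qed
  then show ?thesis using that[OF C2c f_nonneg super ge] by simp
qed

end

section \<open>The payoff above the threshold\<close>

lemma at_within_Ici: "at (x::real) within {x..} = at_right x"
  unfolding at_within_def by (intro arg_cong2[of _ _ _ _ inf] arg_cong[of _ _ principal]) auto

lemma at_within_Iic: "at (x::real) within {..x} = at_left x"
  unfolding at_within_def by (intro arg_cong2[of _ _ _ _ inf] arg_cong[of _ _ principal]) auto

lemma rderiv_eqI: "(g has_real_derivative d) (at x within {x..}) \<Longrightarrow> rderiv g x = d"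
  unfolding rderiv_def by (rule the_equality) (auto intro: has_field_derivative_unique simp: at_within_Ici)

lemma lderiv_eqI: "(g has_real_derivative d) (at x within {..x}) \<Longrightarrow> lderiv g x = d"
  unfolding lderiv_def by (rule the_equality) (auto intro: has_field_derivative_unique simp: at_within_Iic)

lemma right_deriv_nonpos_at_max:
  assumes "(f has_real_derivative d) (at_right x)" "\<forall>\<^sub>F y in at_right x. f y \<le> f x"
  shows "d \<le> 0"
proof -
  have "((\<lambda>y. (f y - f x) / (y - x)) \<longlongrightarrow> d) (at_right x)"
    using assms(1) by (simp add: has_field_derivative_iff)
  moreover have "\<forall>\<^sub>F y in at_right x. (f y - f x) / (y - x) \<le> 0"
    using assms(2) eventually_at_right_less[of x]
    by eventually_elim (auto intro: divide_nonpos_pos)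
  ultimately show ?thesis
    by (rule tendsto_upperbound) simp
qed

lemma at_upper_eventually:
  assumes "x \<in> Ival a b"
  shows "\<forall>\<^sub>F y in at_upper b. x < y \<and> y \<in> Ival a b"
proof (cases b)
  case (real B)
  then have "x < B" "a < ereal x" using assms by (auto simp: Ival_def)
  then have "\<forall>\<^sub>F y in at_left B. x < y \<and> y < B"
    using eventually_at_left[of x B] by auto
  then show ?thesis
    using real \<open>a < ereal x\<close>
    by (auto simp: at_upper_def Ival_def elim!: eventually_mono intro: less_trans)
next
  case PInf
  have "\<forall>\<^sub>F y in at_top. x < y" by (rule eventually_gt_at_top)
  then have "\<forall>\<^sub>F y in at_top. x < y \<and> y \<in> Ival a b"
  proof eventually_elim
    case (elim y)
    then have "a < ereal y" using assms by (auto simp: Ival_def intro: less_trans[of a "ereal x"])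
    then show ?case using elim PInf by (auto simp: Ival_def)
  qed
  then show ?thesis using PInf by (simp add: at_upper_def)
next
  case MInf
  then show ?thesis using assms by (auto simp: Ival_def)
qed

lemma at_upper_ne_bot: "b \<noteq> -\<infinity> \<Longrightarrow> at_upper b \<noteq> bot"
  by (cases b) (auto simp: at_upper_def)

locale threshold_data = increasing_solution +
  fixes g :: "real \<Rightarrow> real" and ystar :: real and Pset :: "real set"
  assumes g_cont: "continuous_on (Ival a b) g"
    and Pset_fin: "finite Pset"
    and g_C2: "\<And>x. x \<in> Ival a b \<Longrightarrow> x \<notin> Pset \<Longrightarrow> g differentiable at x \<and> deriv g differentiable at x"
    and g_onesided: "\<And>p. p \<in> Pset \<Longrightarrow> p \<in> Ival a b \<Longrightarrow> onesided_C2_at g p"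
    and ystar_in: "ystar \<in> Ival a b"
    and ystar_argmax: "\<And>x. x \<in> Ival a b \<Longrightarrow> g x / \<psi> x \<le> g ystar / \<psi> ystar"
    and gen_neg: "\<And>x. x \<in> Ival a b \<Longrightarrow> ystar \<le> x \<Longrightarrow> x \<notin> Pset \<Longrightarrow> gen \<mu> \<sigma> g x - r * g x \<le> 0"
    and kinks: "\<And>x. x \<in> Ival a b \<Longrightarrow> x \<in> Pset \<Longrightarrow> ystar \<le> x \<Longrightarrow> rderiv g x \<le> lderiv g x"
    and lim_b: "((\<lambda>x. g x / \<psi> x) \<longlongrightarrow> 0) (at_upper b)"
begin

lemma g_D:
  assumes "x \<in> Ival a b" "x \<notin> Pset"
  shows "(g has_real_derivative deriv g x) (at x)"
    and "(deriv g has_real_derivative deriv (deriv g) x) (at x)"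
    and "rderiv g x = deriv g x" "lderiv g x = deriv g x"
proof -
  show 1: "(g has_real_derivative deriv g x) (at x)"
    and "(deriv g has_real_derivative deriv (deriv g) x) (at x)"
    using g_C2[OF assms] by (auto simp: DERIV_deriv_iff_real_differentiable)
  show "rderiv g x = deriv g x" "lderiv g x = deriv g x"
    using has_field_derivative_at_within[OF 1] by (auto intro: rderiv_eqI lderiv_eqI)
qed

text \<open>At a kink the derivative patched with the one-sided value has itself a one-sided
  derivative, so it is continuous from that side; this is convergence of
  \<open>deriv g\<close>.\<close>

lemma g_onesided_limit:
  assumes x: "x \<in> Ival a b" and S: "S \<in> {{x..}, {..x}}"
  obtains d where "(g has_real_derivative d) (at x within S)" "(deriv g \<longlongrightarrow> d) (at x within S)"
proof (cases "x \<in> Pset")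
  case True
  then obtain d1 d2 where d: "(g has_real_derivative d1) (at x within S)"
    "((\<lambda>y. if y = x then d1 else deriv g y) has_real_derivative d2) (at x within S)"
    using g_onesided x S unfolding onesided_C2_at_def by blast
  have "((\<lambda>y. if y = x then d1 else deriv g y) \<longlongrightarrow> d1) (at x within S)"
    using DERIV_continuous[OF d(2)] by (simp add: continuous_within)
  then have "(deriv g \<longlongrightarrow> d1) (at x within S)"
    by (rule Lim_transform_eventually) (auto simp: eventually_at_filter)
  then show ?thesis using d(1) that by blast
next
  case False
  have "isCont (deriv g) x" using g_D(2)[OF x False] DERIV_isCont by blast
  then have "(deriv g \<longlongrightarrow> deriv g x) (at x within S)"
    by (simp add: continuous_at_imp_continuous_at_within continuous_within[symmetric])
  then show ?thesis using has_field_derivative_at_within[OF g_D(1)[OF x False]] that by blast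
qed

lemma g_right:
  assumes "x \<in> Ival a b"
  shows "(g has_real_derivative rderiv g x) (at_right x)" "(deriv g \<longlongrightarrow> rderiv g x) (at_right x)"
  using g_onesided_limit[OF assms, of "{x..}"] rderiv_eqI by (auto simp: at_within_Ici)

lemma g_left: "x \<in> Ival a b \<Longrightarrow> (deriv g \<longlongrightarrow> lderiv g x) (at_left x)"
  using g_onesided_limit[of x "{..x}"] lderiv_eqI by (auto simp: at_within_Iic)

lemma lderiv_ge_rderiv:
  assumes "x \<in> Ival a b" "ystar \<le> x"
  shows "rderiv g x \<le> lderiv g x"
  using assms kinks g_D by (cases "x \<in> Pset") auto

section \<open>The quotient of the candidate value and \<open>\<psi>\<close>, and its weighted
  derivative\<close>

definition vfun :: "real \<Rightarrow> real" where
  "vfun x = Vy \<psi> g ystar x / \<psi> x"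

text \<open>This is \<rho> \<psi>^2 times the derivative of \<open>vfun\<close> by the quotient
  rule; at kinks and at \<open>ystar\<close> the right derivative of \<open>g\<close> is used, which
  makes the value a right limit.\<close>

definition mfun :: "(real \<Rightarrow> real) \<Rightarrow> real \<Rightarrow> real" where
  "mfun \<rho> x = (if x < ystar then 0 else \<rho> x * (rderiv g x * \<psi> x - g x * deriv \<psi> x))"

lemma vfun_eq:
  assumes "x \<in> Ival a b"
  shows "vfun x = (if ystar \<le> x then g x / \<psi> x else g ystar / \<psi> ystar)"
  using psi_pos[OF assms] by (simp add: vfun_def Vy_def)

lemma psi_vfun: "x \<in> Ival a b \<Longrightarrow> \<psi> x * vfun x = Vy \<psi> g ystar x"
  using psi_pos[of x] by (simp add: vfun_def)

lemma g_le_Vy: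
  assumes "x \<in> Ival a b"
  shows "g x \<le> Vy \<psi> g ystar x"
  using ystar_argmax[OF assms] psi_pos[OF assms] by (auto simp: Vy_def field_simps)

lemma isCont_g_psi:
  assumes "x \<in> Ival a b"
  shows "isCont g x" "isCont \<psi> x" "isCont (deriv \<psi>) x"
  using g_cont assms psi_D(3,4) continuous_on_eq_continuous_at[OF open_Ival] by blast+

context
  fixes \<rho> :: "real \<Rightarrow> real"
  assumes rho_pos: "\<And>x. x \<in> Ival a b \<Longrightarrow> 0 < \<rho> x"
    and rho_deriv: "\<And>x. x \<in> Ival a b \<Longrightarrow> (\<rho> has_real_derivative \<rho> x * (2 * \<mu> x / (\<sigma> x)^2)) (at x)"
begin

text \<open>The weighted Wronskian of \<open>g\<close> and \<open>\<psi>\<close> with the ordinary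
  derivative; it can be differentiated off \<open>Pset\<close>, where it agrees with
  \<open>mfun\<close> from \<open>ystar\<close> on.\<close>

definition kfun :: "real \<Rightarrow> real" where
  "kfun x = \<rho> x * (deriv g x * \<psi> x - g x * deriv \<psi> x)"

lemma mfun_eq_kfun: "x \<in> Ival a b \<Longrightarrow> x \<notin> Pset \<Longrightarrow> ystar \<le> x \<Longrightarrow> mfun \<rho> x = kfun x"
  by (simp add: mfun_def kfun_def g_D)

text \<open>Lagrange's identity: the derivative of \<open>\<rho>\<close> completes the second-order
  terms to generators, and the equation for \<open>\<psi>\<close> replaces its generator by r
  \<psi>.\<close>

lemma kfun_deriv:
  assumes x: "x \<in> Ival a b" "x \<notin> Pset"
  shows "(kfun has_real_derivative 2 * \<rho> x * \<psi> x / (\<sigma> x)^2 * (gen \<mu> \<sigma> g x - r * g x)) (at x)"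
proof -
  have s: "\<sigma> x > 0" using sigma_pos x by auto
  have g2: "(\<sigma> x)^2 / 2 * deriv (deriv \<psi>) x = r * \<psi> x - \<mu> x * deriv \<psi> x"
    using psi_ode[OF x(1)] by (simp add: gen_def)
  have "(kfun has_real_derivative
      \<rho> x * (2 * \<mu> x / (\<sigma> x)^2) * (deriv g x * \<psi> x - g x * deriv \<psi> x) +
      (deriv (deriv g) x * \<psi> x + deriv \<psi> x * deriv g x - (deriv g x * deriv \<psi> x + deriv (deriv \<psi>) x * g x)) * \<rho> x) (at x)"
    unfolding kfun_def
    by (intro DERIV_mult DERIV_diff rho_deriv g_D psi_D x)
  moreover have "\<rho> x * (2 * \<mu> x / (\<sigma> x)^2) * (deriv g x * \<psi> x - g x * deriv \<psi> x) +
      (deriv (deriv g) x * \<psi> x + deriv \<psi> x * deriv g x - (deriv g x * deriv \<psi> x + deriv (deriv \<psi>) x * g x)) * \<rho> x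
     = 2 * \<rho> x / (\<sigma> x)^2 * (\<psi> x * gen \<mu> \<sigma> g x - g x * (\<mu> x * deriv \<psi> x + (\<sigma> x)^2 / 2 * deriv (deriv \<psi>) x))"
    using s by (simp add: gen_def field_simps)
  moreover have "\<dots> = 2 * \<rho> x * \<psi> x / (\<sigma> x)^2 * (gen \<mu> \<sigma> g x - r * g x)"
    unfolding g2 by (simp add: algebra_simps diff_divide_distrib)
  ultimately show ?thesis by (simp only:)
qed

lemma kfun_antimono:
  assumes "x \<le> y" "ystar \<le> x" and sub: "\<And>z. x \<le> z \<Longrightarrow> z \<le> y \<Longrightarrow> z \<in> Ival a b \<and> z \<notin> Pset"
  shows "kfun y \<le> kfun x"
proof (rule DERIV_nonpos_imp_nonincreasing[OF \<open>x \<le> y\<close>])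
  fix z assume z: "x \<le> z" "z \<le> y"
  then have zI: "z \<in> Ival a b" "z \<notin> Pset" using sub by auto
  have "2 * \<rho> z * \<psi> z / (\<sigma> z)^2 * (gen \<mu> \<sigma> g z - r * g z) \<le> 0"
    using gen_neg[OF zI(1) _ zI(2)] z assms rho_pos[OF zI(1)] psi_pos[OF zI(1)]
    by (intro mult_nonneg_nonpos) auto
  then show "\<exists>l. (kfun has_real_derivative l) (at z) \<and> l \<le> 0"
    using kfun_deriv[OF zI] by blast
qed

lemma kfun_right:
  assumes "x \<in> Ival a b"
  shows "(kfun \<longlongrightarrow> \<rho> x * (rderiv g x * \<psi> x - g x * deriv \<psi> x)) (at_right x)"
    and "(kfun \<longlongrightarrow> \<rho> x * (lderiv g x * \<psi> x - g x * deriv \<psi> x)) (at_left x)"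
proof -
  have c: "(f \<longlongrightarrow> f x) (at x within S)" if "f \<in> {\<rho>, \<psi>, g, deriv \<psi>}" for f S
    using that isCont_g_psi[OF assms] DERIV_isCont[OF rho_deriv[OF assms]]
    by (auto simp: continuous_at_imp_continuous_at_within continuous_within[symmetric])
  show "(kfun \<longlongrightarrow> \<rho> x * (rderiv g x * \<psi> x - g x * deriv \<psi> x)) (at_right x)"
    and "(kfun \<longlongrightarrow> \<rho> x * (lderiv g x * \<psi> x - g x * deriv \<psi> x)) (at_left x)"
    unfolding kfun_def using assms by (intro tendsto_intros c g_right(2) g_left; simp)+
qed

lemma Pset_gap:
  assumes "x \<in> Ival a b"
  obtains d where "d > 0" "\<And>y. y \<noteq> x \<Longrightarrow> \<bar>y - x\<bar> < d \<Longrightarrow> y \<in> Ival a b \<and> y \<notin> Pset"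
proof -
  have "open (Ival a b - (Pset - {x}))"
    using Pset_fin by (intro open_Diff open_Ival finite_imp_closed) auto
  moreover have "x \<in> Ival a b - (Pset - {x})" using assms by auto
  ultimately obtain d where "d > 0" "ball x d \<subseteq> Ival a b - (Pset - {x})"
    using open_contains_ball by metis
  then show ?thesis by (intro that[of d]) (auto simp: subset_eq dist_real_def)
qed

text \<open>\<open>mfun \<rho> x\<close> is the limit of \<open>kfun\<close> from the right, and
  \<open>kfun\<close> is nonincreasing on the kink-free gap next to \<open>x\<close>.\<close>

lemma mfun_local_right:
  assumes "x \<in> Ival a b" "ystar \<le> x"
  shows "\<exists>d>0. \<forall>y. x \<le> y \<and> y < x + d \<longrightarrow> mfun \<rho> y \<le> mfun \<rho> x"
proof -
  obtain d where d: "d > 0" "\<And>y. y \<noteq> x \<Longrightarrow> \<bar>y - x\<bar> < d \<Longrightarrow> y \<in> Ival a b \<and> y \<notin> Pset"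
    using Pset_gap[OF assms(1)] by metis
  have "mfun \<rho> y \<le> mfun \<rho> x" if y: "x < y" "y < x + d" for y
  proof -
    have "kfun y \<le> \<rho> x * (rderiv g x * \<psi> x - g x * deriv \<psi> x)"
    proof (rule tendsto_lowerbound[OF kfun_right(1)[OF assms(1)]])
      have "\<forall>\<^sub>F z in at_right x. z \<in> {x<..<y}"
        using eventually_at_right_real[OF y(1)] .
      then show "\<forall>\<^sub>F z in at_right x. kfun y \<le> kfun z"
      proof eventually_elim
        case (elim z)
        show ?case
          by (rule kfun_antimono) (use elim assms y in \<open>auto intro!: d(2)\<close>)
      qed
    qed simp
    moreover have "mfun \<rho> y = kfun y"
      using d(2)[of y] y assms by (intro mfun_eq_kfun) auto
    ultimately show ?thesis using assms by (simp add: mfun_def)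
  qed
  then show ?thesis using d(1) by (metis order.order_iff_strict order.refl)
qed

text \<open>Here the kink condition enters: passing from the left derivative to the right derivative
  at \<open>x\<close> can only lower the value, and the left limit of \<open>kfun\<close> is below
  the values further left.\<close>

lemma mfun_local_left:
  assumes "x \<in> Ival a b"
  shows "\<exists>d>0. \<forall>y. x - d < y \<and> y \<le> x \<and> ystar \<le> y \<longrightarrow> mfun \<rho> x \<le> mfun \<rho> y"
proof -
  obtain d where d: "d > 0" "\<And>y. y \<noteq> x \<Longrightarrow> \<bar>y - x\<bar> < d \<Longrightarrow> y \<in> Ival a b \<and> y \<notin> Pset"
    using Pset_gap[OF assms(1)] by metis
  have "mfun \<rho> x \<le> mfun \<rho> y" if y: "x - d < y" "y < x" "ystar \<le> y" for y
  proof -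
    have "\<rho> x * (rderiv g x * \<psi> x - g x * deriv \<psi> x) \<le> \<rho> x * (lderiv g x * \<psi> x - g x * deriv \<psi> x)"
      using lderiv_ge_rderiv[OF assms] y rho_pos[OF assms] psi_pos[OF assms]
      by (intro mult_left_mono diff_right_mono mult_right_mono) auto
    also have "\<dots> \<le> kfun y"
    proof (rule tendsto_upperbound[OF kfun_right(2)[OF assms(1)]])
      have "\<forall>\<^sub>F z in at_left x. z \<in> {y<..<x}"
        using eventually_at_left_real[OF y(2)] .
      then show "\<forall>\<^sub>F z in at_left x. kfun z \<le> kfun y"
      proof eventually_elim
        case (elim z)
        show ?case
          by (rule kfun_antimono) (use elim y in \<open>auto intro!: d(2)\<close>)
      qed
    qed simp
    also have "kfun y = mfun \<rho> y"
      using d(2)[of y] y by (intro mfun_eq_kfun[symmetric]) auto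
    finally show ?thesis using y by (simp add: mfun_def)
  qed
  then show ?thesis using d(1) by (metis order.order_iff_strict order.refl)
qed

text \<open>Local monotonicity on both sides of every point is patched together by Bolzano
  bisection, so the kinks are never enumerated in order.\<close>

lemma mfun_anti_right:
  assumes "u \<in> Ival a b" "w \<in> Ival a b" "ystar \<le> u" "u \<le> w"
  shows "mfun \<rho> w \<le> mfun \<rho> u"
proof -
  have "u \<le> u \<and> w \<le> w \<longrightarrow> mfun \<rho> w \<le> mfun \<rho> u"
  proof (rule Bolzano[where P = "\<lambda>y z. u \<le> y \<and> z \<le> w \<longrightarrow> mfun \<rho> z \<le> mfun \<rho> y", OF \<open>u \<le> w\<close>])
    fix x y z
    assume "u \<le> x \<and> y \<le> w \<longrightarrow> mfun \<rho> y \<le> mfun \<rho> x" "u \<le> y \<and> z \<le> w \<longrightarrow> mfun \<rho> z \<le> mfun \<rho> y"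
      "x \<le> y" "y \<le> z"
    then show "u \<le> x \<and> z \<le> w \<longrightarrow> mfun \<rho> z \<le> mfun \<rho> x"
      by (meson order_trans)
  next
    fix x assume "u \<le> x" "x \<le> w"
    then have x: "x \<in> Ival a b" "ystar \<le> x" using Ival_between[OF assms(1,2)] assms(3) by auto
    obtain d1 where d1: "d1 > 0" "\<And>y. x \<le> y \<Longrightarrow> y < x + d1 \<Longrightarrow> mfun \<rho> y \<le> mfun \<rho> x"
      using mfun_local_right[OF x] by blast
    obtain d2 where d2: "d2 > 0" "\<And>y. x - d2 < y \<Longrightarrow> y \<le> x \<Longrightarrow> ystar \<le> y \<Longrightarrow> mfun \<rho> x \<le> mfun \<rho> y"
      using mfun_local_left[OF x(1)] by blast
    show "\<exists>d>0. \<forall>y z. y \<le> x \<and> x \<le> z \<and> z - y < d \<longrightarrow> (u \<le> y \<and> z \<le> w \<longrightarrow> mfun \<rho> z \<le> mfun \<rho> y)"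
    proof (intro exI[of _ "min d1 d2"] conjI allI impI)
      show "0 < min d1 d2" using d1 d2 by simp
      fix y z assume h: "y \<le> x \<and> x \<le> z \<and> z - y < min d1 d2" "u \<le> y \<and> z \<le> w"
      have "mfun \<rho> z \<le> mfun \<rho> x" by (rule d1(2)) (use h in auto)
      also have "\<dots> \<le> mfun \<rho> y" by (rule d2(2)) (use h assms in auto)
      finally show "mfun \<rho> z \<le> mfun \<rho> y" .
    qed
  qed
  then show ?thesis by simp
qed

text \<open>Up to a positive factor this is the right derivative of g / \<psi> at its
  maximiser.\<close>

lemma mfun_ystar_nonpos: "mfun \<rho> ystar \<le> 0"
proof -
  note y = ystar_in
  have p: "\<psi> ystar > 0" "\<rho> ystar > 0" using psi_pos rho_pos y by auto
  have "((\<lambda>x. g x / \<psi> x) has_real_derivative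
      (rderiv g ystar * \<psi> ystar - g ystar * deriv \<psi> ystar) / (\<psi> ystar * \<psi> ystar)) (at_right ystar)"
    using p by (intro DERIV_divide g_right y has_field_derivative_at_within[OF psi_D(1)]) auto
  moreover have "\<forall>\<^sub>F x in at_right ystar. g x / \<psi> x \<le> g ystar / \<psi> ystar"
  proof -
    have "\<forall>\<^sub>F x in at ystar. x \<in> Ival a b" using y by (intro eventually_at_in_open') auto
    then have "\<forall>\<^sub>F x in at_right ystar. x \<in> Ival a b"
      using at_le filter_leD subset_UNIV by blast
    then show ?thesis by eventually_elim (rule ystar_argmax)
  qed
  ultimately have "(rderiv g ystar * \<psi> ystar - g ystar * deriv \<psi> ystar) / (\<psi> ystar * \<psi> ystar) \<le> 0"
    by (rule right_deriv_nonpos_at_max)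
  then show ?thesis using p by (simp add: mfun_def mult_le_0_iff divide_le_0_iff)
qed

lemma mfun_nonpos: "x \<in> Ival a b \<Longrightarrow> mfun \<rho> x \<le> 0"
  using mfun_ystar_nonpos mfun_anti_right[OF ystar_in, of x]
  by (cases "x < ystar") (auto simp: mfun_def)

lemma mfun_anti:
  assumes "x \<in> Ival a b" "y \<in> Ival a b" "x \<le> y"
  shows "mfun \<rho> y \<le> mfun \<rho> x"
  using assms mfun_anti_right[of x y] mfun_nonpos[of y] by (cases "x < ystar") (auto simp: mfun_def)

lemma vfun_cont: "continuous_on (Ival a b) vfun"
proof -
  \<comment> \<open>Both branches of \<open>vfun\<close> are g / \<psi> evaluated at
    \<open>max ystar x\<close>, which makes continuity across \<open>ystar\<close>
    automatic.\<close>
  have "continuous_on (Ival a b) (\<lambda>x. g (max ystar x) / \<psi> (max ystar x))"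
  proof -
    have sub: "(\<lambda>x. max ystar x) ` Ival a b \<subseteq> Ival a b" using ystar_in by (auto simp: max_def)
    have c: "continuous_on (Ival a b) (\<lambda>x. max ystar x)" by (intro continuous_intros)
    have "\<psi> (max ystar x) \<noteq> 0" if "x \<in> Ival a b" for x
      using psi_pos[of "max ystar x"] that ystar_in by (auto simp: max_def split: if_splits)
    then show ?thesis
      using continuous_on_compose2[OF g_cont c sub] continuous_on_compose2[OF psi_cont(1) c sub]
      by (intro continuous_on_divide) auto
  qed
  then show ?thesis
    by (rule continuous_on_eq) (auto simp: vfun_eq max_def)
qed

lemma vfun_deriv:
  assumes x: "x \<in> Ival a b" "x \<notin> insert ystar Pset"
  shows "(vfun has_real_derivative mfun \<rho> x / (\<rho> x * (\<psi> x)^2)) (at x)"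
proof (cases "x < ystar")
  case True
  have "((\<lambda>x. g ystar / \<psi> ystar) has_real_derivative 0) (at x)" by simp
  then have "(vfun has_real_derivative 0) (at x)"
    by (rule has_field_derivative_transform_within_open[where S = "Ival a b \<inter> {..<ystar}"])
      (use x True in \<open>auto simp: vfun_eq\<close>)
  then show ?thesis using True by (simp add: mfun_def)
next
  case False
  then have "ystar < x" "ystar \<le> x" using x by auto
  have p: "\<psi> x > 0" "\<rho> x > 0" using psi_pos rho_pos x by auto
  have xP: "x \<notin> Pset" using x by simp
  have "((\<lambda>x. g x / \<psi> x) has_real_derivative (deriv g x * \<psi> x - g x * deriv \<psi> x) / (\<psi> x * \<psi> x)) (at x)"
    using p x(1) xP by (intro DERIV_divide g_D psi_D) auto
  then have "(vfun has_real_derivative (deriv g x * \<psi> x - g x * deriv \<psi> x) / (\<psi> x * \<psi> x)) (at x)"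
    by (rule has_field_derivative_transform_within_open[where S = "Ival a b \<inter> {ystar<..}"])
      (use x \<open>ystar < x\<close> in \<open>auto simp: vfun_eq\<close>)
  moreover have "mfun \<rho> x / (\<rho> x * (\<psi> x)^2) = (deriv g x * \<psi> x - g x * deriv \<psi> x) / (\<psi> x * \<psi> x)"
    using p x(1) xP \<open>ystar \<le> x\<close> by (simp add: mfun_eq_kfun kfun_def power2_eq_square)
  ultimately show ?thesis by simp
qed

text \<open>The fundamental theorem with finitely many exceptional points. \<open>ystar\<close> is
  one of them, as smooth fit may fail when \<open>ystar\<close> is itself a kink.\<close>

lemma vfun_int:
  assumes "x \<in> Ival a b" "y \<in> Ival a b" "x \<le> y"
  shows "((\<lambda>t. mfun \<rho> t / (\<rho> t * (\<psi> t)^2)) has_integral (vfun y - vfun x)) {x..y}"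
proof (rule fundamental_theorem_of_calculus_interior_strong[of "insert ystar Pset"])
  show "(vfun has_vector_derivative mfun \<rho> t / (\<rho> t * (\<psi> t)^2)) (at t)" if "t \<in> {x<..<y} - insert ystar Pset" for t
    using that Ival_between[OF assms(1,2)] vfun_deriv[of t]
    by (auto simp: has_real_derivative_iff_has_vector_derivative)
  show "continuous_on {x..y} vfun"
    using vfun_cont Icc_subset_Ival[OF assms(1,2)] continuous_on_subset by blast
qed (use Pset_fin assms in auto)

lemma vfun_antimono:
  assumes "x \<in> Ival a b" "y \<in> Ival a b" "x \<le> y"
  shows "vfun y \<le> vfun x"
proof -
  have "vfun y - vfun x \<le> 0"
  proof (rule has_integral_le[OF vfun_int[OF assms] has_integral_0])
    fix t assume "t \<in> {x..y}"
    then have t: "t \<in> Ival a b" using Ival_between[OF assms(1,2)] by auto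
    show "mfun \<rho> t / (\<rho> t * (\<psi> t)^2) \<le> 0"
      using mfun_nonpos[OF t] rho_pos[OF t] psi_pos[OF t] by (simp add: divide_nonpos_pos)
  qed
  then show ?thesis by simp
qed

end

lemma vfun_tendsto: "(vfun \<longlongrightarrow> 0) (at_upper b)"
proof (rule Lim_transform_eventually[OF lim_b])
  show "\<forall>\<^sub>F x in at_upper b. g x / \<psi> x = vfun x"
    using at_upper_eventually[OF ystar_in] by eventually_elim (auto simp: vfun_eq)
qed

lemma vfun_nonneg:
  assumes "x \<in> Ival a b"
  shows "0 \<le> vfun x"
proof -
  obtain \<rho> where \<rho>: "\<And>x. x \<in> Ival a b \<Longrightarrow> 0 < \<rho> x"
    "\<And>x. x \<in> Ival a b \<Longrightarrow> (\<rho> has_real_derivative \<rho> x * (2 * \<mu> x / (\<sigma> x)^2)) (at x)"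
    using scale_density_exists by blast
  have "\<forall>\<^sub>F y in at_upper b. vfun y \<le> vfun x"
    using at_upper_eventually[OF assms]
    by eventually_elim (auto intro!: vfun_antimono[OF \<rho>] assms)
  moreover have "at_upper b \<noteq> bot" using ab by (intro at_upper_ne_bot) auto
  ultimately show ?thesis using tendsto_upperbound[OF vfun_tendsto] by blast
qed

lemma Vy_nonneg: "x \<in> Ival a b \<Longrightarrow> 0 \<le> Vy \<psi> g ystar x"
  using vfun_nonneg psi_vfun psi_pos by (metis mult_nonneg_nonneg order_less_imp_le)

lemma Vy_approx:
  assumes "\<alpha> \<in> Ival a b" "\<beta> \<in> Ival a b" "\<alpha> \<le> x0" "x0 \<le> \<beta>" "0 < e"
  obtains f where "C2c (Ival a b) f" "\<And>x. 0 \<le> f x"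
    "\<And>x. \<alpha> \<le> x \<Longrightarrow> x \<le> \<beta> \<Longrightarrow> gen \<mu> \<sigma> f x - r * f x \<le> 0"
    "\<And>x. \<alpha> \<le> x \<Longrightarrow> x \<le> \<beta> \<Longrightarrow> Vy \<psi> g ystar x \<le> f x"
    "f x0 \<le> Vy \<psi> g ystar x0 + e"
proof -
  obtain \<rho> where \<rho>: "\<And>x. x \<in> Ival a b \<Longrightarrow> 0 < \<rho> x"
    "\<And>x. x \<in> Ival a b \<Longrightarrow> (\<rho> has_real_derivative \<rho> x * (2 * \<mu> x / (\<sigma> x)^2)) (at x)"
    using scale_density_exists by blast
  obtain f where f: "C2c (Ival a b) f" "\<And>x. 0 \<le> f x"
    "\<And>x. \<alpha> \<le> x \<Longrightarrow> x \<le> \<beta> \<Longrightarrow> gen \<mu> \<sigma> f x - r * f x \<le> 0"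
    "\<And>x. \<alpha> \<le> x \<Longrightarrow> x \<le> \<beta> \<Longrightarrow> \<psi> x * vfun x \<le> f x"
    "f x0 \<le> \<psi> x0 * vfun x0 + e"
    by (rule supersolution_approx[OF \<rho> mfun_anti[OF \<rho>] mfun_nonpos[OF \<rho>] vfun_nonneg
          vfun_int[OF \<rho>] assms]) blast+
  moreover have "x \<in> Ival a b" if "\<alpha> \<le> x" "x \<le> \<beta>" for x using Ival_between assms that by blast
  ultimately show ?thesis using that[of f] psi_vfun assms(3,4) by auto
qed

end

section \<open>The martingale problem\<close>

lemma C2cD:
  assumes "C2c I f"
  shows "C2_on UNIV f" "continuous_on UNIV f"
proof -
  show "C2_on UNIV f" using assms by (auto simp: C2c_def C2_on_def)
  then show "continuous_on UNIV f" by (rule C2_on_continuous)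
qed

lemma C2c_gen_cont:
  assumes "C2c I f" "continuous_on I \<mu>" "continuous_on I \<sigma>"
  shows "continuous_on I (gen \<mu> \<sigma> f)"
  unfolding gen_def using assms C2_on_continuous[OF C2cD(1)[OF assms(1)]]
  by (intro continuous_intros continuous_on_subset[OF C2_on_continuous(2)] continuous_on_subset[OF C2_on_continuous(3)])
    (auto intro: C2cD)

text \<open>The function vanishes on the open complement of its support, and so does its generator.
  The bound therefore holds up to the boundary, even if \<open>\<mu>\<close> and
  \<open>\<sigma>\<close> blow up there.\<close>

lemma C2c_bounded:
  assumes f: "C2c I f" and "continuous_on I \<mu>" "continuous_on I \<sigma>"
  obtains C where "0 \<le> C" "\<And>x. \<bar>f x\<bar> \<le> C" "\<And>x. x \<in> I \<Longrightarrow> \<bar>gen \<mu> \<sigma> f x\<bar> \<le> C"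
proof -
  obtain K where K: "compact K" "K \<subseteq> I" "\<And>x. x \<notin> K \<Longrightarrow> f x = 0" using f by (auto simp: C2c_def)
  have "bounded (f ` K)" "bounded (gen \<mu> \<sigma> f ` K)"
    using K C2cD(2)[OF f] C2c_gen_cont[OF assms]
    by (auto intro!: compact_imp_bounded compact_continuous_image intro: continuous_on_subset)
  then obtain C1 C2 where C: "\<And>x. x \<in> K \<Longrightarrow> \<bar>f x\<bar> \<le> C1" "\<And>x. x \<in> K \<Longrightarrow> \<bar>gen \<mu> \<sigma> f x\<bar> \<le> C2"
    unfolding bounded_iff by auto
  have z: "gen \<mu> \<sigma> f x = 0" if "x \<notin> K" for x
  proof -
    have "gen \<mu> \<sigma> f x = gen \<mu> \<sigma> (\<lambda>_. 0) x"
      by (rule gen_cong_open[of "- K"]) (use K that compact_imp_closed in auto)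
    also have "\<dots> = 0" by (simp add: gen_def)
    finally show ?thesis .
  qed
  show ?thesis
  proof (rule that[of "\<bar>C1\<bar> + \<bar>C2\<bar>"])
    show "\<bar>f x\<bar> \<le> \<bar>C1\<bar> + \<bar>C2\<bar>" for x using C(1)[of x] K(3)[of x] by (cases "x \<in> K") auto
    show "\<bar>gen \<mu> \<sigma> f x\<bar> \<le> \<bar>C1\<bar> + \<bar>C2\<bar>" for x using C(2)[of x] z[of x] by (cases "x \<in> K") auto
  qed simp
qed

locale diffusion =
  fixes a b :: ereal and \<mu> \<sigma> :: "real \<Rightarrow> real" and \<Omega> :: "'w measure" and P F :: "real \<Rightarrow> 'w measure"
    and X :: "real \<Rightarrow> 'w \<Rightarrow> real" and \<zeta> :: "'w \<Rightarrow> ennreal"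
  assumes diff: "diffusion_model a b \<mu> \<sigma> \<Omega> P F X \<zeta>"
begin

lemma
  shows ab: "a < b"
    and cont_mu: "continuous_on (Ival a b) \<mu>"
    and cont_sigma: "continuous_on (Ival a b) \<sigma>"
    and zeta_st: "is_stopping_time F \<zeta>"
  using diff unfolding diffusion_model_def by - (elim conjE, assumption)+

lemma sigma_pos: "x \<in> Ival a b \<Longrightarrow> 0 < \<sigma> x"
proof -
  have "\<forall>x\<in>Ival a b. 0 < \<sigma> x"
    using diff unfolding diffusion_model_def by (elim conjE)
  then show "x \<in> Ival a b \<Longrightarrow> 0 < \<sigma> x" by blast
qed

lemma
  shows space_F: "space (F t) = space \<Omega>"
    and sets_F: "sets (F t) \<subseteq> sets \<Omega>"
proof -
  have "\<forall>t. space (F t) = space \<Omega> \<and> sets (F t) \<subseteq> sets \<Omega>"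
    using diff unfolding diffusion_model_def by (elim conjE)
  then show "space (F t) = space \<Omega>" "sets (F t) \<subseteq> sets \<Omega>" by blast+
qed

lemma F_mono: "0 \<le> s \<Longrightarrow> s \<le> t \<Longrightarrow> sets (F s) \<subseteq> sets (F t)"
proof -
  have "\<forall>s t. 0 \<le> s \<longrightarrow> s \<le> t \<longrightarrow> sets (F s) \<subseteq> sets (F t)"
    using diff unfolding diffusion_model_def by (elim conjE)
  then show "0 \<le> s \<Longrightarrow> s \<le> t \<Longrightarrow> sets (F s) \<subseteq> sets (F t)" by blast
qed

lemma X_meas: "0 \<le> t \<Longrightarrow> X t \<in> borel_measurable (F t)"
proof -
  have "\<forall>t\<ge>0. X t \<in> borel_measurable (F t)"
    using diff unfolding diffusion_model_def by (elim conjE)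
  then show "0 \<le> t \<Longrightarrow> X t \<in> borel_measurable (F t)" by blast
qed

lemma
  assumes "\<omega> \<in> space \<Omega>"
  shows zeta_pos: "0 < \<zeta> \<omega>"
    and X_in: "0 \<le> t \<Longrightarrow> ennreal t < \<zeta> \<omega> \<Longrightarrow> X t \<omega> \<in> Ival a b"
    and X_cont: "continuous_on {t. 0 \<le> t \<and> ennreal t < \<zeta> \<omega>} (\<lambda>t. X t \<omega>)"
proof -
  have "\<forall>\<omega>\<in>space \<Omega>. 0 < \<zeta> \<omega> \<and>
        (\<forall>t. 0 \<le> t \<and> ennreal t < \<zeta> \<omega> \<longrightarrow> X t \<omega> \<in> Ival a b) \<and>
        continuous_on {t. 0 \<le> t \<and> ennreal t < \<zeta> \<omega>} (\<lambda>t. X t \<omega>)"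
    using diff unfolding diffusion_model_def by (elim conjE)
  from bspec[OF this assms] show "0 < \<zeta> \<omega>"
    and "0 \<le> t \<Longrightarrow> ennreal t < \<zeta> \<omega> \<Longrightarrow> X t \<omega> \<in> Ival a b"
    and "continuous_on {t. 0 \<le> t \<and> ennreal t < \<zeta> \<omega>} (\<lambda>t. X t \<omega>)" by blast+
qed

lemma before_zeta: "s \<le> u \<Longrightarrow> ennreal u < \<zeta> \<omega> \<Longrightarrow> ennreal s < \<zeta> \<omega>"
  by (rule le_less_trans[OF ennreal_leI])

lemma path_cont:
  "\<omega> \<in> space \<Omega> \<Longrightarrow> ennreal u < \<zeta> \<omega> \<Longrightarrow> continuous_on {0..u} (\<lambda>s. X s \<omega>)"
  by (rule continuous_on_subset[OF X_cont]) (auto intro: before_zeta)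

lemma
  assumes x: "x \<in> Ival a b"
  shows prob_P: "prob_space (P x)"
    and sets_P: "sets (P x) = sets \<Omega>"
    and X_0: "AE \<omega> in P x. X 0 \<omega> = x"
    and mp_integrable: "C2c (Ival a b) f \<Longrightarrow> 0 \<le> t \<Longrightarrow> integrable (P x) (mp_proc \<mu> \<sigma> f X \<zeta> t)"
    and mp_meas: "C2c (Ival a b) f \<Longrightarrow> 0 \<le> t \<Longrightarrow> mp_proc \<mu> \<sigma> f X \<zeta> t \<in> borel_measurable (F t)"
    and mp_mart: "C2c (Ival a b) f \<Longrightarrow> 0 \<le> s \<Longrightarrow> s \<le> t \<Longrightarrow> A \<in> sets (F s) \<Longrightarrow>
      (LINT \<omega>:A|P x. mp_proc \<mu> \<sigma> f X \<zeta> t \<omega>) = (LINT \<omega>:A|P x. mp_proc \<mu> \<sigma> f X \<zeta> s \<omega>)"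
proof -
  have "\<forall>x\<in>Ival a b. prob_space (P x) \<and> sets (P x) = sets \<Omega> \<and>
        (AE \<omega> in P x. X 0 \<omega> = x) \<and>
        (\<forall>f. C2c (Ival a b) f \<longrightarrow> (\<forall>s t. 0 \<le> s \<longrightarrow> s \<le> t \<longrightarrow>
            integrable (P x) (mp_proc \<mu> \<sigma> f X \<zeta> t) \<and>
            mp_proc \<mu> \<sigma> f X \<zeta> t \<in> borel_measurable (F t) \<and>
            (\<forall>A\<in>sets (F s). (LINT \<omega>:A|P x. mp_proc \<mu> \<sigma> f X \<zeta> t \<omega>)
                             = (LINT \<omega>:A|P x. mp_proc \<mu> \<sigma> f X \<zeta> s \<omega>))))"
    using diff unfolding diffusion_model_def by (elim conjE)
  note D = bspec[OF this x]
  from D show "prob_space (P x)" "sets (P x) = sets \<Omega>" "AE \<omega> in P x. X 0 \<omega> = x"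
    by - (elim conjE, assumption)+
  show "integrable (P x) (mp_proc \<mu> \<sigma> f X \<zeta> t)" if "C2c (Ival a b) f" "0 \<le> t"
    using D that by blast
  show "mp_proc \<mu> \<sigma> f X \<zeta> t \<in> borel_measurable (F t)" if "C2c (Ival a b) f" "0 \<le> t"
    using D that by blast
  show "(LINT \<omega>:A|P x. mp_proc \<mu> \<sigma> f X \<zeta> t \<omega>) = (LINT \<omega>:A|P x. mp_proc \<mu> \<sigma> f X \<zeta> s \<omega>)"
    if "C2c (Ival a b) f" "0 \<le> s" "s \<le> t" "A \<in> sets (F s)"
    using D that by blast
qed

abbreviation (input) mp :: "(real \<Rightarrow> real) \<Rightarrow> real \<Rightarrow> 'w \<Rightarrow> real" where
  "mp f \<equiv> mp_proc \<mu> \<sigma> f X \<zeta>"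

abbreviation (input) hit :: "real \<Rightarrow> 'w \<Rightarrow> ennreal" where
  "hit \<equiv> hit_time X \<zeta>"

abbreviation (input) rmax :: "('w \<Rightarrow> real) \<Rightarrow> 'w \<Rightarrow> ereal" where
  "rmax \<equiv> running_max X \<zeta>"

lemma space_P: "x \<in> Ival a b \<Longrightarrow> space (P x) = space \<Omega>"
  by (rule sets_eq_imp_space_eq) (rule sets_P)

lemma meas_F_P:
  assumes "x \<in> Ival a b" "h \<in> measurable (F t) N"
  shows "h \<in> measurable (P x) N"
proof -
  have "space (F t) = space (P x)" "sets (F t) \<subseteq> sets (P x)"
    using assms space_F space_P sets_F sets_P by auto
  then show ?thesis using assms(2) unfolding measurable_def by auto
qed

lemma meas_F_mono:
  assumes "0 \<le> s" "s \<le> t" "h \<in> measurable (F s) N"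
  shows "h \<in> measurable (F t) N"
  using assms(3) F_mono[OF assms(1,2)] unfolding measurable_def by (auto simp: space_F)

lemma stopping_time_pred:
  assumes "is_stopping_time F \<tau>" "0 \<le> t"
  shows "Measurable.pred (F t) (\<lambda>\<omega>. \<tau> \<omega> \<le> ennreal t)" "Measurable.pred (F t) (\<lambda>\<omega>. ennreal t < \<tau> \<omega>)"
proof -
  show 1: "Measurable.pred (F t) (\<lambda>\<omega>. \<tau> \<omega> \<le> ennreal t)"
    using assms by (auto simp: is_stopping_time_def pred_def)
  then show "Measurable.pred (F t) (\<lambda>\<omega>. ennreal t < \<tau> \<omega>)"
    by (simp add: not_le[symmetric])
qed

section \<open>The two parts of the martingale-problem process\<close>

definition uproc :: "(real \<Rightarrow> real) \<Rightarrow> real \<Rightarrow> 'w \<Rightarrow> real" where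
  "uproc f t \<omega> = (if ennreal t < \<zeta> \<omega> then f (X t \<omega>) else 0)"

lemma uproc_meas:
  assumes "continuous_on UNIV f" "0 \<le> t"
  shows "uproc f t \<in> borel_measurable (F t)"
proof -
  have [measurable]: "f \<in> borel_measurable borel" using assms(1) by (rule borel_measurable_continuous_onI)
  note [measurable] = X_meas[OF assms(2)] stopping_time_pred(2)[OF zeta_st assms(2)]
  show ?thesis unfolding uproc_def by measurable
qed

definition jproc :: "(real \<Rightarrow> real) \<Rightarrow> 'w \<Rightarrow> real \<Rightarrow> real" where
  "jproc f \<omega> s = (if ennreal s < \<zeta> \<omega> then gen \<mu> \<sigma> f (X s \<omega>) else 0)"

lemma mp_proc_eq: "mp f t \<omega> = uproc f t \<omega> - (LINT s:{0..t}|lborel. jproc f \<omega> s)"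
  by (simp add: mp_proc_def uproc_def jproc_def)

lemma jproc_bound:
  assumes "\<And>x. x \<in> Ival a b \<Longrightarrow> \<bar>gen \<mu> \<sigma> f x\<bar> \<le> C" "0 \<le> C" "\<omega> \<in> space \<Omega>" "0 \<le> s"
  shows "\<bar>jproc f \<omega> s\<bar> \<le> C"
  using assms X_in[of \<omega> s] by (auto simp: jproc_def)

text \<open>The path is continuous only before the lifetime; the integrand is a continuous function
  on the Borel set of those times, extended by 0, and it is bounded.\<close>

lemma jproc_integrable:
  assumes f: "C2c (Ival a b) f" and \<omega>: "\<omega> \<in> space \<Omega>" and S: "S \<in> sets borel" "S \<subseteq> {0..t}"
  shows "set_integrable lborel S (jproc f \<omega>)"
proof -
  obtain C where C: "0 \<le> C" "\<And>x. x \<in> Ival a b \<Longrightarrow> \<bar>gen \<mu> \<sigma> f x\<bar> \<le> C"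
    using C2c_bounded[OF f cont_mu cont_sigma] by metis
  let ?A = "{t. 0 \<le> t \<and> ennreal t < \<zeta> \<omega>}"
  have A: "?A \<in> sets borel" by measurable
  have "continuous_on ?A (\<lambda>s. gen \<mu> \<sigma> f (X s \<omega>))"
    by (rule continuous_on_compose2[OF C2c_gen_cont[OF f cont_mu cont_sigma] X_cont[OF \<omega>]])
      (auto intro: X_in \<omega>)
  then have m: "(\<lambda>s. indicator ?A s *\<^sub>R gen \<mu> \<sigma> f (X s \<omega>)) \<in> borel_measurable borel"
    by (rule borel_measurable_continuous_on_indicator[OF A])
  have meas: "(\<lambda>s. indicator S s *\<^sub>R jproc f \<omega> s) \<in> borel_measurable borel"
  proof -
    have "(\<lambda>s. indicator S s *\<^sub>R (indicator ?A s *\<^sub>R gen \<mu> \<sigma> f (X s \<omega>))) \<in> borel_measurable borel"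
      using m S(1) by measurable
    also have "(\<lambda>s. indicator S s *\<^sub>R (indicator ?A s *\<^sub>R gen \<mu> \<sigma> f (X s \<omega>))) = (\<lambda>s. indicator S s *\<^sub>R jproc f \<omega> s)"
      using S(2) by (auto simp: fun_eq_iff jproc_def indicator_def)
    finally show ?thesis .
  qed
  show ?thesis
    unfolding set_integrable_def
  proof (rule Bochner_Integration.integrable_bound)
    show "integrable lborel (\<lambda>s. indicator {0..t} s *\<^sub>R C)"
      by (auto intro!: integrable_real_indicator simp: emeasure_lborel_Icc_eq)
    show "(\<lambda>s. indicator S s *\<^sub>R jproc f \<omega> s) \<in> borel_measurable lborel" using meas by simp
    show "AE s in lborel. norm (indicator S s *\<^sub>R jproc f \<omega> s) \<le> norm (indicator {0..t} s *\<^sub>R C)"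
    proof (rule AE_I2)
      fix s
      show "norm (indicator S s *\<^sub>R jproc f \<omega> s) \<le> norm (indicator {0..t} s *\<^sub>R C)"
        using S(2) jproc_bound[OF C(2) C(1) \<omega>, of s] C(1)
        by (cases "s \<in> S") (auto simp: indicator_def subset_eq)
    qed
  qed
qed

lemma mp_diff:
  assumes f: "C2c (Ival a b) f" and \<omega>: "\<omega> \<in> space \<Omega>" and st: "0 \<le> s" "s \<le> t"
  shows "mp f t \<omega> - mp f s \<omega> =
    uproc f t \<omega> - uproc f s \<omega> - (LINT v:{s<..t}|lborel. jproc f \<omega> v)"
proof -
  have "{0..t} = {0..s} \<union> {s<..t}" using st by auto
  then have "(LINT v:{0..t}|lborel. jproc f \<omega> v) =
      (LINT v:{0..s}|lborel. jproc f \<omega> v) + (LINT v:{s<..t}|lborel. jproc f \<omega> v)"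
    using st by (simp, intro set_integral_Un jproc_integrable[OF f \<omega>, of _ t]) auto
  then show ?thesis by (simp add: mp_proc_eq)
qed

end

section \<open>Optional stopping on a grid\<close>

text \<open>Cells are open on the left, so every positive time lies in exactly one of them. The cell
  ending at \<open>h\<close> has index 0, hence the subtraction of 1 from the ceiling.\<close>

lemma grid_index_iff:
  fixes s h :: real
  assumes "0 < h" "0 < s"
  shows "real k * h < s \<and> s \<le> real (Suc k) * h \<longleftrightarrow> k = nat \<lceil>s / h\<rceil> - 1"
proof -
  have "0 < \<lceil>s / h\<rceil>" using assms by simp
  then have "k = nat \<lceil>s / h\<rceil> - 1 \<longleftrightarrow> \<lceil>s / h\<rceil> = int k + 1" by linarith
  also have "\<dots> \<longleftrightarrow> real k < s / h \<and> s / h \<le> real k + 1"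
    by (simp add: ceiling_eq_iff)
  also have "\<dots> \<longleftrightarrow> real k * h < s \<and> s \<le> real (Suc k) * h"
    using assms by (simp add: field_simps)
  finally show ?thesis by simp
qed

context diffusion
begin

context
  fixes f :: "real \<Rightarrow> real" and \<alpha> \<beta> r x0 :: real and \<tau> :: "'w \<Rightarrow> ennreal"
  assumes f: "C2c (Ival a b) f" and f_nonneg: "\<And>x. 0 \<le> f x"
    and super: "\<And>x. \<alpha> \<le> x \<Longrightarrow> x \<le> \<beta> \<Longrightarrow> gen \<mu> \<sigma> f x - r * f x \<le> 0"
    and r_pos: "0 < r" and st: "is_stopping_time F \<tau>" and x0: "x0 \<in> Ival a b"
begin

abbreviation (input) mesh :: "nat \<Rightarrow> real" where
  "mesh n \<equiv> 1 / real (Suc n)"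

abbreviation (input) dpay :: "real \<Rightarrow> nat \<Rightarrow> 'w \<Rightarrow> real" where
  "dpay h k \<omega> \<equiv> exp (- r * (real k * h)) * uproc f (real k * h) \<omega>"

text \<open>Only grid positions are tested, so that the event is known at time k h; what happens
  between grid points is left to the error term \<open>Psum\<close>.\<close>

definition inK :: "real \<Rightarrow> nat \<Rightarrow> 'w \<Rightarrow> bool" where
  "inK h k \<omega> \<longleftrightarrow> (\<forall>j\<in>{..k}. ennreal (real j * h) < \<zeta> \<omega> \<and> X (real j * h) \<omega> \<in> {\<alpha>..\<beta>})"

definition alive :: "real \<Rightarrow> nat \<Rightarrow> 'w \<Rightarrow> bool" where
  "alive h k \<omega> \<longleftrightarrow> inK h k \<omega> \<and> ennreal (real k * h) < \<tau> \<omega>"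

text \<open>\<open>\<tau>\<close> rounded up to the grid. The localisation covers the index
  \<open>k\<close> itself, so a path seen outside the compact interval by then contributes
  nothing.\<close>

definition stopat :: "real \<Rightarrow> nat \<Rightarrow> 'w \<Rightarrow> bool" where
  "stopat h k \<omega> \<longleftrightarrow> inK h k \<omega> \<and> \<tau> \<omega> \<le> ennreal (real k * h) \<and> (\<forall>j\<in>{..<k}. ennreal (real j * h) < \<tau> \<omega>)"

definition Rsum :: "real \<Rightarrow> nat \<Rightarrow> 'w \<Rightarrow> real" where
  "Rsum h M \<omega> = (\<Sum>k\<le>M. of_bool (stopat h k \<omega>) * (dpay h k \<omega>))"

text \<open>The drift of one step, with the discounting charged at the right end of the cell. For
  small \<open>h\<close> its density in time approaches exp(-r s) (gen f - r f) at the current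
  position, which is nonpositive inside [\<alpha>, \<beta>].\<close>

definition Gterm :: "real \<Rightarrow> nat \<Rightarrow> 'w \<Rightarrow> real" where
  "Gterm h k \<omega> = exp (- r * (real k * h)) * (LINT v:{real k * h<..real (Suc k) * h}|lborel. jproc f \<omega> v)
     - r * h * dpay h (Suc k) \<omega>"

definition Psum :: "real \<Rightarrow> nat \<Rightarrow> 'w \<Rightarrow> real" where
  "Psum h M \<omega> = (\<Sum>k<M. of_bool (alive h k \<omega>) * Gterm h k \<omega>)"

lemma uproc_nonneg: "0 \<le> uproc f t \<omega>"
  using f_nonneg by (simp add: uproc_def)

lemma Rsum_nonneg: "0 \<le> Rsum h M \<omega>"
  unfolding Rsum_def by (intro sum_nonneg) (simp add: uproc_nonneg)

text \<open>A telescoping induction: stopping at \<open>Suc M\<close> and being alive at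
  \<open>Suc M\<close> exclude each other and both require being alive at \<open>M\<close>. Paths
  that do neither lose their nonnegative value, whence the inequality.\<close>

lemma Rsum_le:
  assumes "0 < h"
  shows "Rsum h M \<omega> + of_bool (alive h M \<omega>) * (dpay h M \<omega>)
    \<le> uproc f 0 \<omega> + (\<Sum>k<M. of_bool (alive h k \<omega>) * (dpay h (Suc k) \<omega>
        - dpay h k \<omega>))"
proof (induction M)
  case 0
  have "\<not> (stopat h 0 \<omega> \<and> alive h 0 \<omega>)" by (auto simp: stopat_def alive_def)
  then show ?case using uproc_nonneg[of 0 \<omega>] by (auto simp: Rsum_def of_bool_def)
next
  case (Suc M)
  let ?w = "dpay h (Suc M) \<omega>"
  have w: "0 \<le> ?w" using uproc_nonneg by simp
  have ex: "\<not> (stopat h (Suc M) \<omega> \<and> alive h (Suc M) \<omega>)" by (auto simp: stopat_def alive_def)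
  have le: "ennreal (real M * h) \<le> ennreal (real (Suc M) * h)"
    using assms by (intro ennreal_leI) (simp add: algebra_simps)
  have "stopat h (Suc M) \<omega> \<or> alive h (Suc M) \<omega> \<Longrightarrow> alive h M \<omega>"
    using le by (auto simp: stopat_def alive_def inK_def intro: le_less_trans)
  then have "of_bool (stopat h (Suc M) \<omega>) * ?w + of_bool (alive h (Suc M) \<omega>) * ?w \<le> of_bool (alive h M \<omega>) * ?w"
    using ex w by (cases "stopat h (Suc M) \<omega>"; cases "alive h (Suc M) \<omega>"; cases "alive h M \<omega>") simp_all
  then show ?case using Suc.IH by (simp add: Rsum_def right_diff_distrib)
qed

text \<open>Trading the time integral for an increment of \<open>mp f\<close> provides measurability
  in \<omega> and produces the martingale increment of the next estimate.\<close>

lemma Gterm_eq_mp: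
  assumes "0 < h" "\<omega> \<in> space \<Omega>"
  shows "Gterm h k \<omega> = exp (- r * (real k * h)) * (uproc f (real (Suc k) * h) \<omega> - uproc f (real k * h) \<omega>
     - (mp f (real (Suc k) * h) \<omega> - mp f (real k * h) \<omega>))
     - r * h * dpay h (Suc k) \<omega>"
proof -
  have "real k * h \<le> real (Suc k) * h" using assms by (simp add: algebra_simps)
  from mp_diff[OF f assms(2) _ this]
  have "(LINT v:{real k * h<..real (Suc k) * h}|lborel. jproc f \<omega> v) = uproc f (real (Suc k) * h) \<omega> - uproc f (real k * h) \<omega>
     - (mp f (real (Suc k) * h) \<omega> - mp f (real k * h) \<omega>)"
    using assms(1) by simp
  then show ?thesis by (simp only: Gterm_def)
qed

text \<open>The inequality exp(r h) \<ge> 1 + r h compares the discount factors at the two ends of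
  the cell; it is the reason for evaluating the discount term of \<open>Gterm\<close> at the right
  end.\<close>

lemma step_le:
  assumes "0 < h" "\<omega> \<in> space \<Omega>"
  shows "dpay h (Suc k) \<omega> - dpay h k \<omega>
    \<le> exp (- r * (real k * h)) * (mp f (real (Suc k) * h) \<omega> - mp f (real k * h) \<omega>) + Gterm h k \<omega>"
proof -
  have "exp (- r * (real k * h)) = exp (- r * (real (Suc k) * h)) * exp (r * h)"
    by (simp add: exp_add[symmetric] algebra_simps)
  also have "\<dots> \<ge> exp (- r * (real (Suc k) * h)) * (1 + r * h)"
    by (intro mult_left_mono exp_ge_add_one_self) simp
  finally have "exp (- r * (real (Suc k) * h)) * (1 + r * h) * uproc f (real (Suc k) * h) \<omega>
      \<le> exp (- r * (real k * h)) * uproc f (real (Suc k) * h) \<omega>"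
    by (intro mult_right_mono uproc_nonneg)
  then show ?thesis unfolding Gterm_eq_mp[OF assms] by (simp add: algebra_simps)
qed

lemma f_cont: "continuous_on UNIV f"
  by (rule C2cD(2)[OF f])

lemma inK_meas:
  assumes "0 < h"
  shows "Measurable.pred (F (real k * h)) (inK h k)"
proof -
  have "Measurable.pred (F (real k * h)) (\<lambda>\<omega>. ennreal (real j * h) < \<zeta> \<omega> \<and> X (real j * h) \<omega> \<in> {\<alpha>..\<beta>})"
    if "j \<in> {..k}" for j
  proof -
    have j: "0 \<le> real j * h" "real j * h \<le> real k * h" using assms that by (auto simp: mult_right_mono)
    note [measurable] = meas_F_mono[OF j X_meas[OF j(1)]] meas_F_mono[OF j stopping_time_pred(2)[OF zeta_st j(1)]]
    show ?thesis by measurable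
  qed
  then show ?thesis unfolding inK_def by (intro pred_intros_finite) auto
qed

lemma alive_meas:
  assumes "0 < h"
  shows "Measurable.pred (F (real k * h)) (alive h k)"
proof -
  have k: "0 \<le> real k * h" using assms by simp
  note [measurable] = inK_meas[OF assms, of k] stopping_time_pred(2)[OF st k]
  show ?thesis unfolding alive_def by measurable
qed

lemma stopat_meas:
  assumes "0 < h"
  shows "Measurable.pred (F (real k * h)) (stopat h k)"
proof -
  have k: "0 \<le> real k * h" using assms by simp
  have "Measurable.pred (F (real k * h)) (\<lambda>\<omega>. ennreal (real j * h) < \<tau> \<omega>)" if "j \<in> {..<k}" for j
  proof -
    have j: "0 \<le> real j * h" "real j * h \<le> real k * h" using assms that by (auto simp: mult_right_mono)
    show ?thesis by (rule meas_F_mono[OF j stopping_time_pred(2)[OF st j(1)]])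
  qed
  then have [measurable]: "Measurable.pred (F (real k * h)) (\<lambda>\<omega>. \<forall>j\<in>{..<k}. ennreal (real j * h) < \<tau> \<omega>)"
    by (intro pred_intros_finite) auto
  note [measurable] = inK_meas[OF assms, of k] stopping_time_pred(1)[OF st k]
  show ?thesis unfolding stopat_def by measurable
qed

lemma uproc_meas_P: "0 \<le> t \<Longrightarrow> uproc f t \<in> borel_measurable (P x0)"
  by (rule meas_F_P[OF x0 uproc_meas[OF f_cont]])

lemma Rsum_meas:
  assumes "0 < h"
  shows "Rsum h M \<in> borel_measurable (P x0)"
proof -
  have [measurable]: "Measurable.pred (P x0) (stopat h k)" "uproc f (real k * h) \<in> borel_measurable (P x0)" for k
    using meas_F_P[OF x0 stopat_meas[OF assms]] uproc_meas_P assms by auto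
  show ?thesis unfolding Rsum_def by measurable
qed

lemma Gterm_meas:
  assumes "0 < h"
  shows "Gterm h k \<in> borel_measurable (P x0)"
proof -
  have k: "0 \<le> real k * h" "0 \<le> real (Suc k) * h" using assms by auto
  note [measurable] = uproc_meas_P[OF k(1)] uproc_meas_P[OF k(2)]
    meas_F_P[OF x0 mp_meas[OF x0 f k(1)]] meas_F_P[OF x0 mp_meas[OF x0 f k(2)]]
  have "(\<lambda>\<omega>. exp (- r * (real k * h)) * (uproc f (real (Suc k) * h) \<omega> - uproc f (real k * h) \<omega>
     - (mp f (real (Suc k) * h) \<omega> - mp f (real k * h) \<omega>))
     - r * h * dpay h (Suc k) \<omega>) \<in> borel_measurable (P x0)"
    by measurable
  then show ?thesis
    by (rule measurable_cong[THEN iffD1, rotated]) (simp add: space_P[OF x0] Gterm_eq_mp[OF assms])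
qed

lemma Psum_meas:
  assumes "0 < h"
  shows "Psum h M \<in> borel_measurable (P x0)"
proof -
  have [measurable]: "Measurable.pred (P x0) (alive h k)" "Gterm h k \<in> borel_measurable (P x0)" for k
    using meas_F_P[OF x0 alive_meas[OF assms]] Gterm_meas[OF assms] by auto
  show ?thesis unfolding Psum_def by measurable
qed

text \<open>Being alive at step \<open>k\<close> is decided at the start of the step, so the
  martingale identity applies on that event.\<close>

lemma mp_increment_zero:
  assumes "0 < h"
  shows "integrable (P x0) (\<lambda>\<omega>. of_bool (alive h k \<omega>) * (exp (- r * (real k * h)) *
      (mp f (real (Suc k) * h) \<omega> - mp f (real k * h) \<omega>)))" (is "integrable _ ?g")
    and "(\<integral>\<omega>. of_bool (alive h k \<omega>) * (exp (- r * (real k * h)) *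
      (mp f (real (Suc k) * h) \<omega> - mp f (real k * h) \<omega>)) \<partial>P x0) = 0"
proof -
  have k: "0 \<le> real k * h" "0 \<le> real (Suc k) * h" "real k * h \<le> real (Suc k) * h"
    using assms by (auto simp: algebra_simps)
  define A where "A = {\<omega> \<in> space \<Omega>. alive h k \<omega>}"
  have A: "A \<in> sets (F (real k * h))"
    using alive_meas[OF assms, of k] by (simp add: A_def pred_def space_F)
  then have A': "A \<in> sets (P x0)" using sets_F sets_P[OF x0] by blast
  have i: "set_integrable (P x0) A (mp f t)" if "0 \<le> t" for t
    unfolding set_integrable_def using A' mp_integrable[OF x0 f that]
    by (rule integrable_mult_indicator)
  have eq: "?g \<omega> = exp (- r * (real k * h)) * (indicator A \<omega> *\<^sub>R mp f (real (Suc k) * h) \<omega> - indicator A \<omega> *\<^sub>R mp f (real k * h) \<omega>)"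
    if "\<omega> \<in> space (P x0)" for \<omega>
    using that by (simp add: A_def space_P[OF x0] indicator_def of_bool_def)
  have int: "integrable (P x0) (\<lambda>\<omega>. exp (- r * (real k * h)) * (indicator A \<omega> *\<^sub>R mp f (real (Suc k) * h) \<omega> - indicator A \<omega> *\<^sub>R mp f (real k * h) \<omega>))"
    using i k by (simp add: set_integrable_def)
  show "integrable (P x0) ?g"
    by (rule Bochner_Integration.integrable_cong[THEN iffD2, OF refl eq int])
  have "(\<integral>\<omega>. ?g \<omega> \<partial>P x0) = (\<integral>\<omega>. exp (- r * (real k * h)) * (indicator A \<omega> *\<^sub>R mp f (real (Suc k) * h) \<omega> - indicator A \<omega> *\<^sub>R mp f (real k * h) \<omega>) \<partial>P x0)"
    by (rule Bochner_Integration.integral_cong[OF refl eq])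
  also have "\<dots> = exp (- r * (real k * h)) * ((LINT \<omega>:A|P x0. mp f (real (Suc k) * h) \<omega>) - (LINT \<omega>:A|P x0. mp f (real k * h) \<omega>))"
    using i k by (simp add: set_integrable_def set_lebesgue_integral_def)
  also have "\<dots> = 0" using mp_mart[OF x0 f k(1,3) A] by simp
  finally show "(\<integral>\<omega>. ?g \<omega> \<partial>P x0) = 0" .
qed

section \<open>The grid error as an integral over time\<close>

definition Phi :: "real \<Rightarrow> nat \<Rightarrow> 'w \<Rightarrow> real \<Rightarrow> real" where
  "Phi h M \<omega> s = (\<Sum>k<M. indicator {real k * h<..real (Suc k) * h} s * (of_bool (alive h k \<omega>) *
     (exp (- r * (real k * h)) * jproc f \<omega> s - r * dpay h (Suc k) \<omega>)))"

text \<open>A cell has length \<open>h\<close>, so the discount term is the integral of a constant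
  over it. The error becomes one integrand whose limit can be taken for each time
  separately.\<close>

lemma Psum_eq_Phi:
  assumes "0 < h" "\<omega> \<in> space \<Omega>"
  shows "integrable lborel (Phi h M \<omega>)" "Psum h M \<omega> = (\<integral>s. Phi h M \<omega> s \<partial>lborel)"
proof -
  let ?S = "\<lambda>k. {real k * h<..real (Suc k) * h}"
  let ?c = "\<lambda>k. r * dpay h (Suc k) \<omega>"
  let ?t = "\<lambda>k s. indicator (?S k) s * (of_bool (alive h k \<omega>) * (exp (- r * (real k * h)) * jproc f \<omega> s - ?c k))"
  have len: "real (Suc k) * h - real k * h = h" "real k * h \<le> real (Suc k) * h" for k
    using assms(1) by (simp_all add: algebra_simps)
  have ij: "integrable lborel (\<lambda>s. indicator (?S k) s *\<^sub>R jproc f \<omega> s)" for k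
  proof -
    have "?S k \<subseteq> {0..real (Suc k) * h}" using assms(1) order_trans[of 0 "real k * h"] by (auto simp: less_imp_le)
    then show ?thesis using jproc_integrable[OF f assms(2), of "?S k" "real (Suc k) * h"]
      by (simp add: set_integrable_def)
  qed
  have ic: "integrable lborel (indicator (?S k) :: real \<Rightarrow> real)" for k
    using len by (auto intro!: integrable_real_indicator)
  have t_eq: "?t k = (\<lambda>s. of_bool (alive h k \<omega>) * (exp (- r * (real k * h)) * (indicator (?S k) s *\<^sub>R jproc f \<omega> s) - ?c k * indicator (?S k) s))" for k
    by (auto simp: fun_eq_iff indicator_def)
  have it: "integrable lborel (?t k)" for k
    unfolding t_eq by (intro integrable_mult_right Bochner_Integration.integrable_diff ij ic)
  have et: "(\<integral>s. ?t k s \<partial>lborel) = of_bool (alive h k \<omega>) * Gterm h k \<omega>" for k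
  proof -
    have "(\<integral>s. ?t k s \<partial>lborel) = of_bool (alive h k \<omega>) * (exp (- r * (real k * h)) * (\<integral>s. indicator (?S k) s *\<^sub>R jproc f \<omega> s \<partial>lborel)
        - ?c k * (\<integral>s. indicator (?S k) s \<partial>lborel))"
      unfolding t_eq integral_mult_right_zero
      by (subst Bochner_Integration.integral_diff)
        (simp_all only: integral_mult_right_zero integrable_mult_right ij ic)
    also have "(\<integral>s. indicator (?S k) s \<partial>lborel) = h"
      using measure_lborel_Ioc[OF len(2)[of k]] unfolding len(1) by simp
    finally show ?thesis by (simp add: Gterm_def set_lebesgue_integral_def mult_ac)
  qed
  show "integrable lborel (Phi h M \<omega>)"
    unfolding Phi_def by (intro Bochner_Integration.integrable_sum it)
  show "Psum h M \<omega> = (\<integral>s. Phi h M \<omega> s \<partial>lborel)"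
    unfolding Phi_def Psum_def
    by (subst Bochner_Integration.integral_sum) (simp_all only: it et)
qed

lemma Phi_eq:
  assumes h: "0 < h"
  shows "Phi h M \<omega> s = (let k = nat \<lceil>s / h\<rceil> - 1 in if 0 < s \<and> k < M \<and> alive h k \<omega> then
     exp (- r * (real k * h)) * jproc f \<omega> s - r * dpay h (Suc k) \<omega> else 0)"
proof (cases "0 < s")
  case True
  have "indicator {real k * h<..real (Suc k) * h} s = (of_bool (k = nat \<lceil>s / h\<rceil> - 1) :: real)" for k
    using grid_index_iff[OF h True, of k] by (simp add: indicator_def)
  then show ?thesis
    unfolding Phi_def Let_def using True by (simp add: of_bool_def if_distrib[of "\<lambda>x. x * _"] cong: if_cong)
next
  case False
  have "indicator {real k * h<..real (Suc k) * h} s = (0::real)" for k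
  proof -
    have "0 \<le> real k * h" using h by simp
    then show ?thesis using False by (simp add: indicator_def)
  qed
  then show ?thesis unfolding Phi_def Let_def using False by simp
qed

text \<open>The majorant depends on the grid only through the horizon M h, which the later choice M
  = N (n + 1) with mesh 1 / (n + 1) keeps equal to N.\<close>

lemma Phi_bound:
  assumes C: "0 \<le> C" "\<And>x. \<bar>f x\<bar> \<le> C" "\<And>x. x \<in> Ival a b \<Longrightarrow> \<bar>gen \<mu> \<sigma> f x\<bar> \<le> C"
    and h: "0 < h" "\<omega> \<in> space \<Omega>"
  shows "\<bar>Phi h M \<omega> s\<bar> \<le> indicator {0..real M * h} s * ((1 + r) * C)"
proof -
  define k where "k = nat \<lceil>s / h\<rceil> - 1"
  let ?v = "exp (- r * (real k * h)) * jproc f \<omega> s - r * dpay h (Suc k) \<omega>"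
  have eq: "Phi h M \<omega> s = (if 0 < s \<and> k < M \<and> alive h k \<omega> then ?v else 0)"
    by (simp only: Phi_eq[OF h(1)] Let_def k_def)
  show ?thesis
  proof (cases "0 < s \<and> k < M \<and> alive h k \<omega>")
    case True
    have "s \<le> real (Suc k) * h" using grid_index_iff[OF h(1), of s k] True k_def by simp
    also have "\<dots> \<le> real M * h" using True h by (intro mult_right_mono) auto
    finally have s: "s \<in> {0..real M * h}" using True by simp
    have e: "exp (- r * (real k * h)) \<le> 1" "exp (- r * (real (Suc k) * h)) \<le> 1" using r_pos h by auto
    have "\<bar>exp (- r * (real k * h)) * jproc f \<omega> s\<bar> \<le> 1 * C"
      unfolding abs_mult using e jproc_bound[OF C(3) C(1) h(2), of s] True by (intro mult_mono) auto
    moreover have "\<bar>dpay h (Suc k) \<omega>\<bar> \<le> 1 * C"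
      unfolding abs_mult using e C by (intro mult_mono) (auto simp: uproc_def)
    then have "r * \<bar>dpay h (Suc k) \<omega>\<bar> \<le> r * (1 * C)"
      using r_pos by (intro mult_left_mono) auto
    then have "\<bar>r * dpay h (Suc k) \<omega>\<bar> \<le> r * C"
      using r_pos by (simp add: abs_mult mult.assoc)
    ultimately have "\<bar>?v\<bar> \<le> (1 + r) * C"
      by (intro order_trans[OF abs_triangle_ineq4]) (simp add: algebra_simps)
    then show ?thesis unfolding eq using True s by simp
  next
    case False
    then show ?thesis unfolding eq if_not_P[OF False] using C r_pos by simp
  qed
qed

lemma Psum_bound:
  assumes C: "0 \<le> C" "\<And>x. \<bar>f x\<bar> \<le> C" "\<And>x. x \<in> Ival a b \<Longrightarrow> \<bar>gen \<mu> \<sigma> f x\<bar> \<le> C"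
    and h: "0 < h" "\<omega> \<in> space \<Omega>"
  shows "\<bar>Psum h M \<omega>\<bar> \<le> real M * h * ((1 + r) * C)"
proof -
  let ?b = "\<lambda>s. indicator {0..real M * h} s * ((1 + r) * C)"
  have "norm (\<integral>s. Phi h M \<omega> s \<partial>lborel) \<le> (\<integral>s. ?b s \<partial>lborel)"
  proof (rule Bochner_Integration.integral_norm_bound_integral[OF Psum_eq_Phi(1)[OF h]])
    show "integrable lborel ?b"
      by (auto intro!: integrable_real_indicator integrable_mult_left simp: emeasure_lborel_Icc_eq)
    show "norm (Phi h M \<omega> s) \<le> ?b s" for s using Phi_bound[OF C h] by simp
  qed
  then show ?thesis using h(1) by (simp add: Psum_eq_Phi(2)[OF h])
qed

text \<open>Martingale increments integrate to 0 and the path starts at \<open>x0\<close> almost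
  surely. Of the error only the positive part is retained, since it is this part that tends to
  0.\<close>

lemma expectation_Rsum:
  assumes h: "0 < h"
  shows "(\<integral>\<^sup>+\<omega>. ennreal (Rsum h M \<omega>) \<partial>P x0) \<le> ennreal (f x0 + (\<integral>\<omega>. max 0 (Psum h M \<omega>) \<partial>P x0))"
proof -
  interpret prob_space "P x0" by (rule prob_P[OF x0])
  obtain C where C: "0 \<le> C" "\<And>x. \<bar>f x\<bar> \<le> C" "\<And>x. x \<in> Ival a b \<Longrightarrow> \<bar>gen \<mu> \<sigma> f x\<bar> \<le> C"
    using C2c_bounded[OF f cont_mu cont_sigma] by metis
  let ?D = "\<lambda>\<omega>. \<Sum>k<M. of_bool (alive h k \<omega>) * (exp (- r * (real k * h)) *
      (mp f (real (Suc k) * h) \<omega> - mp f (real k * h) \<omega>))"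
  let ?B = "\<lambda>\<omega>. uproc f 0 \<omega> + ?D \<omega> + max 0 (Psum h M \<omega>)"
  have le: "Rsum h M \<omega> \<le> ?B \<omega>" if "\<omega> \<in> space \<Omega>" for \<omega>
  proof -
    have "Rsum h M \<omega> \<le> Rsum h M \<omega> + of_bool (alive h M \<omega>) * (dpay h M \<omega>)"
      using uproc_nonneg by simp
    also note Rsum_le[OF h, of M \<omega>]
    also have "(\<Sum>k<M. of_bool (alive h k \<omega>) * (dpay h (Suc k) \<omega>
        - dpay h k \<omega>)) \<le>
       (\<Sum>k<M. of_bool (alive h k \<omega>) * (exp (- r * (real k * h)) * (mp f (real (Suc k) * h) \<omega> - mp f (real k * h) \<omega>) + Gterm h k \<omega>))"
      using step_le[OF h that] by (intro sum_mono mult_left_mono) auto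
    also have "\<dots> = ?D \<omega> + Psum h M \<omega>" by (simp only: Psum_def distrib_left sum.distrib)
    finally show ?thesis by simp
  qed
  have iD: "integrable (P x0) ?D" by (intro Bochner_Integration.integrable_sum mp_increment_zero(1) h)
  have zD: "(\<integral>\<omega>. ?D \<omega> \<partial>P x0) = 0"
    by (subst Bochner_Integration.integral_sum) (simp_all only: mp_increment_zero[OF h] sum.neutral_const)
  have iP: "integrable (P x0) (\<lambda>\<omega>. max 0 (Psum h M \<omega>))"
  proof (rule integrable_const_bound[of _ "real M * h * ((1 + r) * C)"])
    show "AE \<omega> in P x0. norm (max 0 (Psum h M \<omega>)) \<le> real M * h * ((1 + r) * C)"
    proof (rule AE_I2)
      fix \<omega> assume "\<omega> \<in> space (P x0)"
      then have "\<bar>Psum h M \<omega>\<bar> \<le> real M * h * ((1 + r) * C)" using Psum_bound[OF C h] space_P[OF x0] by simp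
      then show "norm (max 0 (Psum h M \<omega>)) \<le> real M * h * ((1 + r) * C)" by auto
    qed
  qed (use Psum_meas[OF h] in measurable)
  have AE0: "AE \<omega> in P x0. uproc f 0 \<omega> = f x0"
  proof -
    have "AE \<omega> in P x0. \<omega> \<in> space \<Omega>" using space_P[OF x0] by (intro AE_I2) simp
    with X_0[OF x0] show ?thesis by eventually_elim (simp add: uproc_def zeta_pos)
  qed
  have iU: "integrable (P x0) (uproc f 0)"
    by (rule integrable_const_bound[of _ C]) (use C uproc_meas_P[of 0] in \<open>auto simp: uproc_def\<close>)
  have eU: "(\<integral>\<omega>. uproc f 0 \<omega> \<partial>P x0) = f x0"
  proof -
    have "(\<integral>\<omega>. uproc f 0 \<omega> \<partial>P x0) = (\<integral>\<omega>. f x0 \<partial>P x0)"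
      using AE0 uproc_meas_P[of 0] by (intro integral_cong_AE) auto
    then show ?thesis by (simp add: prob_space)
  qed
  have "(\<integral>\<^sup>+\<omega>. ennreal (Rsum h M \<omega>) \<partial>P x0) \<le> (\<integral>\<^sup>+\<omega>. ennreal (?B \<omega>) \<partial>P x0)"
    using le space_P[OF x0] by (intro nn_integral_mono ennreal_leI) simp
  also have "\<dots> = ennreal (\<integral>\<omega>. ?B \<omega> \<partial>P x0)"
  proof (rule nn_integral_eq_integral)
    show "integrable (P x0) ?B" using iU iD iP by simp
    show "AE \<omega> in P x0. 0 \<le> ?B \<omega>"
    proof (rule AE_I2)
      fix \<omega> assume "\<omega> \<in> space (P x0)"
      then show "0 \<le> ?B \<omega>" using le[of \<omega>] Rsum_nonneg[of h M \<omega>] space_P[OF x0] by simp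
    qed
  qed
  also have "(\<integral>\<omega>. ?B \<omega> \<partial>P x0) = f x0 + (\<integral>\<omega>. max 0 (Psum h M \<omega>) \<partial>P x0)"
    using iU iD iP eU zD by (simp add: Bochner_Integration.integral_add)
  finally show ?thesis .
qed

lemma X_tendsto:
  assumes "\<omega> \<in> space \<Omega>" "0 \<le> s" "ennreal s < \<zeta> \<omega>" "c \<longlonglongrightarrow> s" "\<And>n. 0 \<le> c n"
  shows "(\<lambda>n. X (c n) \<omega>) \<longlonglongrightarrow> X s \<omega>" "\<forall>\<^sub>F n in sequentially. ennreal (c n) < \<zeta> \<omega>"
proof -
  show ev: "\<forall>\<^sub>F n in sequentially. ennreal (c n) < \<zeta> \<omega>"
    using order_tendstoD(2)[OF tendsto_ennrealI[OF assms(4)] assms(3)] .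
  show "(\<lambda>n. X (c n) \<omega>) \<longlonglongrightarrow> X s \<omega>"
    by (rule continuous_on_tendsto_compose[OF X_cont[OF assms(1)] assms(4)])
      (use assms ev in \<open>auto elim: eventually_mono\<close>)
qed

text \<open>Three cases for a fixed time s between the grid points p < s \<le> q. After the lifetime
  both terms vanish, as q is also too late. If X s lies outside [\<alpha>, \<beta>], the complement
  is open, so X p is eventually outside too and the path is not alive. Otherwise the candidate
  integrand converges to a nonpositive limit by \<open>super\<close>, whether or not the path is
  alive.\<close>

lemma max0_Phi_tendsto:
  assumes \<omega>: "\<omega> \<in> space \<Omega>"
  shows "(\<lambda>n. max 0 (Phi (mesh n) (M n) \<omega> s)) \<longlonglongrightarrow> 0"
proof (cases "0 < s")
  case False
  then show ?thesis by (simp add: Phi_eq Let_def)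
next
  case s: True
  define k where "k n = nat \<lceil>s / (mesh n)\<rceil> - 1" for n
  define p where "p n = real (k n) * (mesh n)" for n
  define q where "q n = real (Suc (k n)) * (mesh n)" for n
  have "p n < s \<and> s \<le> q n" for n
    unfolding p_def q_def using grid_index_iff[of "mesh n" s "k n"] s k_def by simp
  moreover have "q n = p n + mesh n" for n by (simp add: p_def q_def add_divide_distrib)
  ultimately have pq: "p n < s" "s \<le> q n" "q n = p n + mesh n" "0 \<le> p n" "0 \<le> q n" for n
    by (auto simp: p_def)
  have h0: "(\<lambda>n. mesh n) \<longlonglongrightarrow> 0" by (rule LIMSEQ_inverse_real_of_nat[unfolded inverse_eq_divide])
  have p_lim: "p \<longlonglongrightarrow> s"
  proof (rule tendsto_sandwich)
    show "\<forall>\<^sub>F n in sequentially. s - mesh n \<le> p n" using pq by (intro always_eventually allI) (smt (verit))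
    show "\<forall>\<^sub>F n in sequentially. p n \<le> s" using pq by (intro always_eventually allI) (smt (verit))
    show "(\<lambda>n. s - mesh n) \<longlonglongrightarrow> s" using tendsto_diff[OF tendsto_const[of s] h0] by simp
  qed simp
  have q_lim: "q \<longlonglongrightarrow> s" using tendsto_add[OF p_lim h0] by (simp add: pq(3)[abs_def])
  let ?v = "\<lambda>n. exp (- r * p n) * jproc f \<omega> s - r * exp (- r * q n) * uproc f (q n) \<omega>"
  have eq: "Phi (mesh n) (M n) \<omega> s = (if k n < M n \<and> alive (mesh n) (k n) \<omega> then ?v n else 0)" for n
    using s Phi_eq[of "mesh n" "M n" \<omega> s] by (simp add: Let_def k_def p_def q_def)
  show ?thesis
  proof (cases "ennreal s < \<zeta> \<omega>")
    case False
    then have "ennreal (q n) \<ge> \<zeta> \<omega>" for n using ennreal_leI[OF pq(2)[of n]] by (meson leI order_trans)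
    then have "\<not> ennreal (q n) < \<zeta> \<omega>" for n by (simp add: not_less)
    then have "?v n = 0" for n using False by (simp add: jproc_def uproc_def)
    then have "Phi (mesh n) (M n) \<omega> s = 0" for n by (simp only: eq if_cancel)
    then show ?thesis by (simp only: max.idem tendsto_const)
  next
    case True
    note Xp = X_tendsto[OF \<omega> less_imp_le[OF s] True p_lim pq(4)]
    note Xq = X_tendsto[OF \<omega> less_imp_le[OF s] True q_lim pq(5)]
    show ?thesis
    proof (cases "X s \<omega> \<in> {\<alpha>..\<beta>}")
      case False
      have "\<forall>\<^sub>F n in sequentially. X (p n) \<omega> \<in> - {\<alpha>..\<beta>}"
        using False by (intro topological_tendstoD[OF Xp(1)]) (auto simp: open_Compl)
      then have "\<forall>\<^sub>F n in sequentially. max 0 (Phi (mesh n) (M n) \<omega> s) = 0"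
      proof eventually_elim
        case (elim n)
        then have "\<not> alive (mesh n) (k n) \<omega>"
          by (auto simp: alive_def inK_def p_def)
        then show ?case unfolding eq by simp
      qed
      then show ?thesis by (rule tendsto_eventually)
    next
      case inK: True
      have fX: "(\<lambda>n. f (X (q n) \<omega>)) \<longlonglongrightarrow> f (X s \<omega>)"
        using f_cont by (intro continuous_on_tendsto_compose[OF f_cont Xq(1)]) auto
      have u: "(\<lambda>n. uproc f (q n) \<omega>) \<longlonglongrightarrow> f (X s \<omega>)"
        by (rule Lim_transform_eventually[OF fX])
          (use Xq(2) in \<open>auto simp: uproc_def elim: eventually_mono\<close>)
      have "?v \<longlonglongrightarrow> exp (- r * s) * jproc f \<omega> s - r * exp (- r * s) * f (X s \<omega>)"
        by (intro tendsto_intros u p_lim q_lim)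
      then have "(\<lambda>n. max 0 (?v n)) \<longlonglongrightarrow> max 0 (exp (- r * s) * jproc f \<omega> s - r * exp (- r * s) * f (X s \<omega>))"
        by (rule tendsto_max[OF tendsto_const])
      moreover have "exp (- r * s) * jproc f \<omega> s - r * exp (- r * s) * f (X s \<omega>) \<le> 0"
      proof -
        have "exp (- r * s) * (gen \<mu> \<sigma> f (X s \<omega>) - r * f (X s \<omega>)) \<le> 0"
          using super[of "X s \<omega>"] inK by (intro mult_nonneg_nonpos) auto
        then show ?thesis using True by (simp add: jproc_def algebra_simps)
      qed
      ultimately have lim: "(\<lambda>n. max 0 (?v n)) \<longlonglongrightarrow> 0" by (simp add: max_absorb1)
      have "max 0 (Phi (mesh n) (M n) \<omega> s) \<le> max 0 (?v n)" for n unfolding eq by auto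
      then show ?thesis
        by (intro tendsto_sandwich[OF _ _ tendsto_const lim] always_eventually allI) auto
    qed
  qed
qed

lemma max0_Psum_tendsto:
  assumes \<omega>: "\<omega> \<in> space \<Omega>"
  shows "(\<lambda>n. max 0 (Psum (mesh n) (N * Suc n) \<omega>)) \<longlonglongrightarrow> 0"
proof -
  obtain C where C: "0 \<le> C" "\<And>x. \<bar>f x\<bar> \<le> C" "\<And>x. x \<in> Ival a b \<Longrightarrow> \<bar>gen \<mu> \<sigma> f x\<bar> \<le> C"
    using C2c_bounded[OF f cont_mu cont_sigma] by metis
  let ?F = "\<lambda>n s. max 0 (Phi (mesh n) (N * Suc n) \<omega> s)"
  have h: "0 < mesh n" for n by simp
  have Nh: "real (N * Suc n) * (mesh n) = real N" for n by (simp only: of_nat_mult) simp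
  have iF: "integrable lborel (?F n)" for n using Psum_eq_Phi(1)[OF h \<omega>] by simp
  have "(\<lambda>n. \<integral>s. ?F n s \<partial>lborel) \<longlonglongrightarrow> (\<integral>s. 0 \<partial>(lborel :: real measure))"
  proof (rule integral_dominated_convergence)
    show "integrable lborel (\<lambda>s. indicator {0..real N} s * ((1 + r) * C))"
      by (auto intro!: integrable_real_indicator integrable_mult_left)
    show "AE s in lborel. (\<lambda>n. ?F n s) \<longlonglongrightarrow> 0" using max0_Phi_tendsto[OF \<omega>] by (intro AE_I2)
    show "AE s in lborel. norm (?F n s) \<le> indicator {0..real N} s * ((1 + r) * C)" for n
    proof (rule AE_I2)
      fix s
      show "norm (?F n s) \<le> indicator {0..real N} s * ((1 + r) * C)"
        using Phi_bound[OF C h \<omega>, where M = "N * Suc n" and s = s and n1 = n] unfolding Nh by auto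
    qed
  qed (use iF in auto)
  then have lim: "(\<lambda>n. \<integral>s. ?F n s \<partial>lborel) \<longlonglongrightarrow> 0" by simp
  have "Psum (mesh n) (N * Suc n) \<omega> \<le> (\<integral>s. ?F n s \<partial>lborel)" for n
    unfolding Psum_eq_Phi(2)[OF h \<omega>] by (intro integral_mono Psum_eq_Phi(1)[OF h \<omega>] iF) simp
  moreover have "0 \<le> (\<integral>s. ?F n s \<partial>lborel)" for n by (rule Bochner_Integration.integral_nonneg) simp
  ultimately show ?thesis
    by (intro tendsto_sandwich[OF _ _ tendsto_const lim] always_eventually allI) auto
qed

lemma expectation_Psum_tendsto:
  "(\<lambda>n. \<integral>\<omega>. max 0 (Psum (mesh n) (N * Suc n) \<omega>) \<partial>P x0) \<longlonglongrightarrow> 0"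
proof -
  interpret prob_space "P x0" by (rule prob_P[OF x0])
  obtain C where C: "0 \<le> C" "\<And>x. \<bar>f x\<bar> \<le> C" "\<And>x. x \<in> Ival a b \<Longrightarrow> \<bar>gen \<mu> \<sigma> f x\<bar> \<le> C"
    using C2c_bounded[OF f cont_mu cont_sigma] by metis
  let ?P = "\<lambda>n \<omega>. Psum (mesh n) (N * Suc n) \<omega>"
  have h: "0 < mesh n" for n by simp
  have Nh: "real (N * Suc n) * (mesh n) = real N" for n by (simp only: of_nat_mult) simp
  have "(\<lambda>n. \<integral>\<omega>. max 0 (?P n \<omega>) \<partial>P x0) \<longlonglongrightarrow> (\<integral>\<omega>. 0 \<partial>P x0)"
  proof (rule integral_dominated_convergence)
    show "integrable (P x0) (\<lambda>\<omega>. real N * ((1 + r) * C))" by simp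
    show "AE \<omega> in P x0. (\<lambda>n. max 0 (?P n \<omega>)) \<longlonglongrightarrow> 0"
      using max0_Psum_tendsto space_P[OF x0] by (intro AE_I2) simp
    show "AE \<omega> in P x0. norm (max 0 (?P n \<omega>)) \<le> real N * ((1 + r) * C)" for n
    proof (rule AE_I2)
      fix \<omega> assume "\<omega> \<in> space (P x0)"
      then have "\<bar>?P n \<omega>\<bar> \<le> real N * ((1 + r) * C)"
        using Psum_bound[OF C h, of \<omega> n "N * Suc n"] space_P[OF x0] unfolding Nh by simp
      then show "norm (max 0 (?P n \<omega>)) \<le> real N * ((1 + r) * C)" by auto
    qed
    show "(\<lambda>\<omega>. max 0 (?P n \<omega>)) \<in> borel_measurable (P x0)" for n
      by (intro borel_measurable_max borel_measurable_const Psum_meas h)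
  qed simp
  then show ?thesis by simp
qed

text \<open>\<open>\<tau>\<close> is rounded up to a grid time at most one mesh later. Strict
  inclusion in (\<alpha>, \<beta>) up to \<open>t\<close> extends by continuity slightly beyond
  \<open>t\<close>, so eventually all the grid points involved pass the localisation test and
  exactly one summand is left.\<close>

lemma Rsum_tendsto:
  assumes \<omega>: "\<omega> \<in> space \<Omega>" and t: "\<tau> \<omega> = ennreal t" "0 \<le> t" "t < real N" "ennreal t < \<zeta> \<omega>"
    and inside: "\<And>s. 0 \<le> s \<Longrightarrow> s \<le> t \<Longrightarrow> \<alpha> < X s \<omega> \<and> X s \<omega> < \<beta>"
  shows "(\<lambda>n. Rsum (mesh n) (N * Suc n) \<omega>) \<longlonglongrightarrow> exp (- r * t) * f (X t \<omega>)"
proof -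
  define k where "k n = nat \<lceil>t * real (Suc n)\<rceil>" for n
  define q where "q n = real (k n) * (mesh n)" for n
  have kn: "t * real (Suc n) \<le> real (k n)" "real (k n) < t * real (Suc n) + 1" for n
  proof -
    have "0 \<le> \<lceil>t * real (Suc n)\<rceil>" using t by (simp add: order_less_le_trans[of "-1" 0])
    then have "real (k n) = of_int \<lceil>t * real (Suc n)\<rceil>" by (simp add: k_def)
    then show "t * real (Suc n) \<le> real (k n)" "real (k n) < t * real (Suc n) + 1" by linarith+
  qed
  have q: "t \<le> q n" "q n \<le> t + mesh n" "0 \<le> q n" for n
  proof -
    have "t * real (Suc n) / real (Suc n) \<le> real (k n) / real (Suc n)"
      using kn(1) by (intro divide_right_mono) auto
    then show "t \<le> q n" by (simp add: q_def del: of_nat_Suc)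
    have "real (k n) / real (Suc n) \<le> (t * real (Suc n) + 1) / real (Suc n)"
      using kn(2)[of n] by (intro divide_right_mono) auto
    then show "q n \<le> t + mesh n" by (simp add: q_def add_divide_distrib del: of_nat_Suc)
  qed (simp add: q_def)
  have h0: "(\<lambda>n. mesh n) \<longlonglongrightarrow> 0" by (rule LIMSEQ_inverse_real_of_nat[unfolded inverse_eq_divide])
  have q_lim: "q \<longlonglongrightarrow> t"
  proof (rule tendsto_sandwich[OF _ _ tendsto_const])
    show "(\<lambda>n. t + mesh n) \<longlonglongrightarrow> t" using tendsto_add[OF tendsto_const[of t] h0] by simp
  qed (use q in auto)
  note Xq = X_tendsto[OF \<omega> t(2,4) q_lim q(3)]
  have kM: "k n \<le> N * Suc n" for n
  proof -
    have "t * real (Suc n) \<le> real N * real (Suc n)" using t by (intro mult_right_mono) auto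
    then have "t * real (Suc n) \<le> real (N * Suc n)" by (simp only: of_nat_mult)
    then show ?thesis unfolding k_def by (simp only: ceiling_le_iff nat_le_iff of_int_of_nat_eq)
  qed
  have stop_k: "stopat (mesh n) j \<omega> \<longleftrightarrow> j = k n \<and> inK (mesh n) (k n) \<omega>" for n j
  proof -
    have i1: "\<tau> \<omega> \<le> ennreal (real i * (mesh n)) \<longleftrightarrow> k n \<le> i" for i
    proof -
      have "\<tau> \<omega> \<le> ennreal (real i * (mesh n)) \<longleftrightarrow> t \<le> real i * (mesh n)"
        using t by (simp add: ennreal_le_iff)
      also have "\<dots> \<longleftrightarrow> t * real (Suc n) \<le> real i" by (simp add: field_simps)
      also have "\<dots> \<longleftrightarrow> k n \<le> i" unfolding k_def by (simp add: ceiling_le_iff nat_le_iff)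
      finally show ?thesis .
    qed
    have "stopat (mesh n) j \<omega> \<longleftrightarrow> inK (mesh n) j \<omega> \<and> k n \<le> j \<and> (\<forall>i\<in>{..<j}. \<not> k n \<le> i)"
      unfolding stopat_def not_le[symmetric] i1 by simp
    also have "\<dots> \<longleftrightarrow> j = k n \<and> inK (mesh n) (k n) \<omega>"
      by (auto dest: le_neq_implies_less)
    finally show ?thesis .
  qed
  have R_eq: "Rsum (mesh n) (N * Suc n) \<omega> = of_bool (inK (mesh n) (k n) \<omega>) * (exp (- r * q n) * uproc f (q n) \<omega>)" for n
  proof -
    have "Rsum (mesh n) (N * Suc n) \<omega> = (\<Sum>j\<le>N * Suc n. if j = k n then of_bool (inK (mesh n) (k n) \<omega>) * (exp (- r * q n) * uproc f (q n) \<omega>) else 0)"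
      unfolding Rsum_def stop_k by (intro sum.cong refl) (auto simp: q_def)
    also have "\<dots> = of_bool (inK (mesh n) (k n) \<omega>) * (exp (- r * q n) * uproc f (q n) \<omega>)"
      using kM[of n] by (subst sum.delta) auto
    finally show ?thesis .
  qed
  have "\<forall>\<^sub>F n in sequentially. inK (mesh n) (k n) \<omega>"
  proof -
    have X0: "\<forall>\<^sub>F s in at t within {v. 0 \<le> v \<and> ennreal v < \<zeta> \<omega>}. X s \<omega> \<in> {\<alpha><..<\<beta>}"
      using X_cont[OF \<omega>] inside[of t] t
      by (intro topological_tendstoD[of "\<lambda>s. X s \<omega>" "X t \<omega>"]) (auto simp: continuous_on_def)
    then obtain d where d: "d > 0" "\<And>s. 0 \<le> s \<Longrightarrow> ennreal s < \<zeta> \<omega> \<Longrightarrow> s \<noteq> t \<Longrightarrow> dist s t < d \<Longrightarrow> X s \<omega> \<in> {\<alpha><..<\<beta>}"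
      unfolding eventually_at by auto
    have "\<forall>\<^sub>F n in sequentially. q n < t + d" using order_tendstoD(2)[OF q_lim, of "t + d"] d by simp
    with Xq(2) show ?thesis
    proof eventually_elim
      case (elim n)
      show ?case unfolding inK_def
      proof
        fix j assume "j \<in> {..k n}"
        then have j: "real j * (mesh n) \<le> q n" unfolding q_def by (intro mult_right_mono) auto
        define s where "s = real j * (mesh n)"
        have s: "0 \<le> s" "s \<le> q n" using j by (auto simp: s_def)
        have sz: "ennreal s < \<zeta> \<omega>" using before_zeta[OF s(2)] elim by simp
        have "X s \<omega> \<in> {\<alpha><..<\<beta>}"
        proof (cases "s \<le> t")
          case True then show ?thesis using inside s by auto
        next
          case False then show ?thesis using s sz elim by (intro d(2)) (auto simp: dist_real_def)
        qed
        then show "ennreal (real j * (mesh n)) < \<zeta> \<omega> \<and> X (real j * (mesh n)) \<omega> \<in> {\<alpha>..\<beta>}"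
          using sz unfolding s_def by auto
      qed
    qed
  qed
  with Xq(2) have ev: "\<forall>\<^sub>F n in sequentially. exp (- r * q n) * f (X (q n) \<omega>) = Rsum (mesh n) (N * Suc n) \<omega>"
    unfolding R_eq by eventually_elim (simp add: uproc_def)
  have "(\<lambda>n. exp (- r * q n) * f (X (q n) \<omega>)) \<longlonglongrightarrow> exp (- r * t) * f (X t \<omega>)"
    using f_cont by (intro tendsto_intros q_lim continuous_on_tendsto_compose[OF f_cont Xq(1)]) auto
  then show ?thesis using ev by (rule Lim_transform_eventually)
qed

text \<open>The majorant is the lower limit of the measurable grid sums. It is measurable by
  construction and open to Fatou's lemma, and it dominates the stopped value on well-localised
  paths, so the stopped value itself is never integrated here.\<close>

lemma optional_stopping_bound:
  obtains \<rho> where "\<rho> \<in> borel_measurable (P x0)" "(\<integral>\<^sup>+\<omega>. \<rho> \<omega> \<partial>P x0) \<le> ennreal (f x0)"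
    "\<And>\<omega> t. \<omega> \<in> space \<Omega> \<Longrightarrow> \<tau> \<omega> = ennreal t \<Longrightarrow> 0 \<le> t \<Longrightarrow> t < real N \<Longrightarrow> ennreal t < \<zeta> \<omega> \<Longrightarrow>
      (\<And>s. 0 \<le> s \<Longrightarrow> s \<le> t \<Longrightarrow> \<alpha> < X s \<omega> \<and> X s \<omega> < \<beta>) \<Longrightarrow> ennreal (exp (- r * t) * f (X t \<omega>)) \<le> \<rho> \<omega>"
proof -
  let ?R = "\<lambda>n \<omega>. ennreal (Rsum (mesh n) (N * Suc n) \<omega>)"
  define \<rho> where "\<rho> \<omega> = liminf (\<lambda>n. ?R n \<omega>)" for \<omega>
  have [measurable]: "Rsum (mesh n) (N * Suc n) \<in> borel_measurable (P x0)" for n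
    by (rule Rsum_meas) simp
  show ?thesis
  proof (rule that[of \<rho>])
    show "\<rho> \<in> borel_measurable (P x0)" unfolding \<rho>_def by measurable
    have "(\<integral>\<^sup>+\<omega>. \<rho> \<omega> \<partial>P x0) \<le> liminf (\<lambda>n. \<integral>\<^sup>+\<omega>. ?R n \<omega> \<partial>P x0)"
      unfolding \<rho>_def by (rule nn_integral_liminf) measurable
    also have "\<dots> \<le> liminf (\<lambda>n. ennreal (f x0 + (\<integral>\<omega>. max 0 (Psum (mesh n) (N * Suc n) \<omega>) \<partial>P x0)))"
      by (intro Liminf_mono always_eventually allI expectation_Rsum) simp
    also have "\<dots> = ennreal (f x0)"
    proof (rule lim_imp_Liminf)
      have "(\<lambda>n. f x0 + (\<integral>\<omega>. max 0 (Psum (mesh n) (N * Suc n) \<omega>) \<partial>P x0)) \<longlonglongrightarrow> f x0 + 0"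
        by (intro tendsto_add tendsto_const expectation_Psum_tendsto)
      then show "(\<lambda>n. ennreal (f x0 + (\<integral>\<omega>. max 0 (Psum (mesh n) (N * Suc n) \<omega>) \<partial>P x0))) \<longlonglongrightarrow> ennreal (f x0)"
        by (intro tendsto_ennrealI) simp
    qed simp
    finally show "(\<integral>\<^sup>+\<omega>. \<rho> \<omega> \<partial>P x0) \<le> ennreal (f x0)" .
    show "ennreal (exp (- r * t) * f (X t \<omega>)) \<le> \<rho> \<omega>"
      if "\<omega> \<in> space \<Omega>" "\<tau> \<omega> = ennreal t" "0 \<le> t" "t < real N" "ennreal t < \<zeta> \<omega>"
        "\<And>s. 0 \<le> s \<Longrightarrow> s \<le> t \<Longrightarrow> \<alpha> < X s \<omega> \<and> X s \<omega> < \<beta>" for \<omega> t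
    proof -
      have "(\<lambda>n. ?R n \<omega>) \<longlonglongrightarrow> ennreal (exp (- r * t) * f (X t \<omega>))"
        by (intro tendsto_ennrealI Rsum_tendsto that)
      then have "\<rho> \<omega> = ennreal (exp (- r * t) * f (X t \<omega>))"
        unfolding \<rho>_def by (intro lim_imp_Liminf) auto
      then show ?thesis by simp
    qed
  qed
qed

end

end

section \<open>The value function\<close>

lemma pred_Bex_countable:
  assumes "countable I" "\<And>i. i \<in> I \<Longrightarrow> Measurable.pred M (P i)"
  shows "Measurable.pred M (\<lambda>x. \<exists>i\<in>I. P i x)"
  using assms unfolding pred_def by (intro sets.sets_Collect_countable_Ex') auto

context diffusion
begin

text \<open>Let the compact interval, the horizon and the error 1 / (j + 1) improve together. A path
  stopped before its lifetime has compact range up to that time, so it is eventually covered by the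
  \<open>j\<close>-th majorant.\<close>

lemma excessive_bound:
  fixes w :: "real \<Rightarrow> real"
  assumes x0: "x0 \<in> Ival a b" and r: "0 < r" and st: "is_stopping_time F \<tau>"
    and approx: "\<And>\<alpha> \<beta> e. \<alpha> \<in> Ival a b \<Longrightarrow> \<beta> \<in> Ival a b \<Longrightarrow> \<alpha> \<le> x0 \<Longrightarrow> x0 \<le> \<beta> \<Longrightarrow> 0 < e \<Longrightarrow>
      \<exists>f. C2c (Ival a b) f \<and> (\<forall>x. 0 \<le> f x) \<and> (\<forall>x. \<alpha> \<le> x \<and> x \<le> \<beta> \<longrightarrow> gen \<mu> \<sigma> f x - r * f x \<le> 0) \<and>
        (\<forall>x. \<alpha> \<le> x \<and> x \<le> \<beta> \<longrightarrow> w x \<le> f x) \<and> f x0 \<le> w x0 + e"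
  shows "(\<integral>\<^sup>+\<omega>. ennreal (disc_payoff r w X \<zeta> \<tau> \<omega>) \<partial>P x0) \<le> ennreal (w x0)"
proof -
  obtain u l where ul: "\<And>i. l i < u i" "\<And>i. a < ereal (l i)" "\<And>i. ereal (u i) < b"
    "(\<lambda>i. ereal (l i)) \<longlonglongrightarrow> a" "(\<lambda>i. ereal (u i)) \<longlonglongrightarrow> b"
    by (rule einterval_Icc_approximation[OF ab]) (rule that; assumption)
  \<comment> \<open>Enlarged so as to contain the starting point from the first index on, as
    \<open>approx\<close> requires.\<close>
  define \<alpha> where "\<alpha> j = min (l j) x0" for j
  define \<beta> where "\<beta> j = max (u j) x0" for j
  have "l j \<in> Ival a b" "u j \<in> Ival a b" for j
    using ul(1-3)[of j] unfolding Ival_def by (auto intro: less_trans[of a "ereal (l j)"] less_trans[of "ereal (l j)" "ereal (u j)"])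
  then have \<alpha>\<beta>: "\<alpha> j \<in> Ival a b" "\<beta> j \<in> Ival a b" "\<alpha> j \<le> x0" "x0 \<le> \<beta> j" for j
    using x0 by (auto simp: \<alpha>_def \<beta>_def min_def max_def)
  have "\<exists>\<rho>. \<rho> \<in> borel_measurable (P x0) \<and> (\<integral>\<^sup>+\<omega>. \<rho> \<omega> \<partial>P x0) \<le> ennreal (w x0 + 1 / real (Suc j)) \<and>
     (\<forall>\<omega> t. \<omega> \<in> space \<Omega> \<and> \<tau> \<omega> = ennreal t \<and> 0 \<le> t \<and> t < real j \<and> ennreal t < \<zeta> \<omega> \<and>
      (\<forall>s. 0 \<le> s \<and> s \<le> t \<longrightarrow> \<alpha> j < X s \<omega> \<and> X s \<omega> < \<beta> j) \<longrightarrow> ennreal (exp (- r * t) * w (X t \<omega>)) \<le> \<rho> \<omega>)" for j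
  proof -
    obtain f where f: "C2c (Ival a b) f" "\<And>x. 0 \<le> f x" "\<And>x. \<alpha> j \<le> x \<Longrightarrow> x \<le> \<beta> j \<Longrightarrow> gen \<mu> \<sigma> f x - r * f x \<le> 0"
      "\<And>x. \<alpha> j \<le> x \<Longrightarrow> x \<le> \<beta> j \<Longrightarrow> w x \<le> f x" "f x0 \<le> w x0 + 1 / real (Suc j)"
      using approx[of "\<alpha> j" "\<beta> j" "1 / real (Suc j)"] \<alpha>\<beta>[of j] by auto
    obtain \<rho> where \<rho>: "\<rho> \<in> borel_measurable (P x0)" "(\<integral>\<^sup>+\<omega>. \<rho> \<omega> \<partial>P x0) \<le> ennreal (f x0)"
      "\<And>\<omega> t. \<omega> \<in> space \<Omega> \<Longrightarrow> \<tau> \<omega> = ennreal t \<Longrightarrow> 0 \<le> t \<Longrightarrow> t < real j \<Longrightarrow> ennreal t < \<zeta> \<omega> \<Longrightarrow>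
        (\<And>s. 0 \<le> s \<Longrightarrow> s \<le> t \<Longrightarrow> \<alpha> j < X s \<omega> \<and> X s \<omega> < \<beta> j) \<Longrightarrow> ennreal (exp (- r * t) * f (X t \<omega>)) \<le> \<rho> \<omega>"
      by (rule optional_stopping_bound[OF f(1-3) r st x0]) blast+
    show ?thesis
    proof (intro exI[of _ \<rho>] conjI allI impI)
      show "\<rho> \<in> borel_measurable (P x0)" by fact
      show "(\<integral>\<^sup>+\<omega>. \<rho> \<omega> \<partial>P x0) \<le> ennreal (w x0 + 1 / real (Suc j))"
        using \<rho>(2) f(5) by (meson ennreal_leI order_trans)
      fix \<omega> t
      assume h: "\<omega> \<in> space \<Omega> \<and> \<tau> \<omega> = ennreal t \<and> 0 \<le> t \<and> t < real j \<and> ennreal t < \<zeta> \<omega> \<and>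
        (\<forall>s. 0 \<le> s \<and> s \<le> t \<longrightarrow> \<alpha> j < X s \<omega> \<and> X s \<omega> < \<beta> j)"
      have "\<alpha> j \<le> X t \<omega>" "X t \<omega> \<le> \<beta> j" using h by (auto intro: less_imp_le)
      then have "ennreal (exp (- r * t) * w (X t \<omega>)) \<le> ennreal (exp (- r * t) * f (X t \<omega>))"
        by (intro ennreal_leI mult_left_mono f(4)) auto
      also have "\<dots> \<le> \<rho> \<omega>" using h by (intro \<rho>(3)) auto
      finally show "ennreal (exp (- r * t) * w (X t \<omega>)) \<le> \<rho> \<omega>" .
    qed
  qed
  then obtain \<rho> where \<rho>: "\<And>j. \<rho> j \<in> borel_measurable (P x0)"
    "\<And>j. (\<integral>\<^sup>+\<omega>. \<rho> j \<omega> \<partial>P x0) \<le> ennreal (w x0 + 1 / real (Suc j))"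
    "\<And>j \<omega> t. \<omega> \<in> space \<Omega> \<Longrightarrow> \<tau> \<omega> = ennreal t \<Longrightarrow> 0 \<le> t \<Longrightarrow> t < real j \<Longrightarrow> ennreal t < \<zeta> \<omega> \<Longrightarrow>
      (\<forall>s. 0 \<le> s \<and> s \<le> t \<longrightarrow> \<alpha> j < X s \<omega> \<and> X s \<omega> < \<beta> j) \<Longrightarrow> ennreal (exp (- r * t) * w (X t \<omega>)) \<le> \<rho> j \<omega>"
    by metis
  have le: "ennreal (disc_payoff r w X \<zeta> \<tau> \<omega>) \<le> liminf (\<lambda>j. \<rho> j \<omega>)" if \<omega>: "\<omega> \<in> space \<Omega>" for \<omega>
  proof (cases "\<tau> \<omega> < \<zeta> \<omega>")
    case True
    define t where "t = enn2real (\<tau> \<omega>)"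
    have t: "\<tau> \<omega> = ennreal t" "0 \<le> t" "ennreal t < \<zeta> \<omega>"
      using True by (auto simp: t_def less_top[symmetric] ennreal_enn2real_if dest: less_le_trans[OF _ top_greatest])
    note c = path_cont[OF \<omega> t(3)]
    obtain s1 where s1: "s1 \<in> {0..t}" "\<And>s. s \<in> {0..t} \<Longrightarrow> X s1 \<omega> \<le> X s \<omega>"
      using continuous_attains_inf[OF _ _ c] t(2) by auto
    obtain s2 where s2: "s2 \<in> {0..t}" "\<And>s. s \<in> {0..t} \<Longrightarrow> X s \<omega> \<le> X s2 \<omega>"
      using continuous_attains_sup[OF _ _ c] t(2) by auto
    have "X s1 \<omega> \<in> Ival a b" "X s2 \<omega> \<in> Ival a b"
      using s1(1) s2(1) t(3) by (auto intro!: X_in[OF \<omega>] intro: before_zeta)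
    then have "a < ereal (X s1 \<omega>)" "ereal (X s2 \<omega>) < b" by (auto simp: Ival_def)
    then have "\<forall>\<^sub>F j in sequentially. ereal (l j) < ereal (X s1 \<omega>)" "\<forall>\<^sub>F j in sequentially. ereal (X s2 \<omega>) < ereal (u j)"
      using order_tendstoD ul(4,5) by blast+
    moreover have "\<forall>\<^sub>F j in sequentially. t < real j"
      using filterlim_real_sequentially by (auto simp: filterlim_at_top_dense)
    ultimately have "\<forall>\<^sub>F j in sequentially. ennreal (exp (- r * t) * w (X t \<omega>)) \<le> \<rho> j \<omega>"
    proof eventually_elim
      case (elim j)
      have "\<forall>s. 0 \<le> s \<and> s \<le> t \<longrightarrow> \<alpha> j < X s \<omega> \<and> X s \<omega> < \<beta> j"
      proof (intro allI impI)
        fix s assume "0 \<le> s \<and> s \<le> t"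
        then have "X s1 \<omega> \<le> X s \<omega>" "X s \<omega> \<le> X s2 \<omega>" using s1(2) s2(2) by auto
        then show "\<alpha> j < X s \<omega> \<and> X s \<omega> < \<beta> j" using elim by (auto simp: \<alpha>_def \<beta>_def)
      qed
      then show ?case using \<omega> t elim by (intro \<rho>(3)) auto
    qed
    then have "ennreal (exp (- r * t) * w (X t \<omega>)) \<le> liminf (\<lambda>j. \<rho> j \<omega>)"
      by (rule Liminf_bounded)
    then show ?thesis using True by (simp add: disc_payoff_def t_def)
  qed (simp add: disc_payoff_def)
  have "(\<integral>\<^sup>+\<omega>. ennreal (disc_payoff r w X \<zeta> \<tau> \<omega>) \<partial>P x0) \<le> (\<integral>\<^sup>+\<omega>. liminf (\<lambda>j. \<rho> j \<omega>) \<partial>P x0)"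
    using le space_P[OF x0] by (intro nn_integral_mono) simp
  also have "\<dots> \<le> liminf (\<lambda>j. \<integral>\<^sup>+\<omega>. \<rho> j \<omega> \<partial>P x0)"
    by (rule nn_integral_liminf) (rule \<rho>(1))
  also have "\<dots> \<le> liminf (\<lambda>j. ennreal (w x0 + 1 / real (Suc j)))"
    by (intro Liminf_mono always_eventually allI \<rho>(2))
  also have "\<dots> = ennreal (w x0)"
  proof (rule lim_imp_Liminf)
    have "(\<lambda>j. w x0 + 1 / real (Suc j)) \<longlonglongrightarrow> w x0 + 0"
      by (intro tendsto_add tendsto_const LIMSEQ_inverse_real_of_nat[unfolded inverse_eq_divide])
    then show "(\<lambda>j. ennreal (w x0 + 1 / real (Suc j))) \<longlonglongrightarrow> ennreal (w x0)"
      by (intro tendsto_ennrealI) simp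
  qed simp
  finally show ?thesis .
qed

section \<open>Hitting times\<close>

lemma hit_time_cases:
  assumes \<omega>: "\<omega> \<in> space \<Omega>"
  obtains "hit y \<omega> = \<top>" "\<And>s. 0 \<le> s \<Longrightarrow> ennreal s < \<zeta> \<omega> \<Longrightarrow> X s \<omega> \<noteq> y"
  | s0 where "hit y \<omega> = ennreal s0" "0 \<le> s0" "ennreal s0 < \<zeta> \<omega>" "X s0 \<omega> = y"
proof -
  let ?S = "{s. 0 \<le> s \<and> ennreal s < \<zeta> \<omega> \<and> X s \<omega> = y}"
  have eq: "hit y \<omega> = Inf (ennreal ` ?S)"
    unfolding hit_time_def by (rule arg_cong[of _ _ Inf]) auto
  show ?thesis
  proof (cases "?S = {}")
    case True
    have "hit y \<omega> = \<top>" unfolding eq True by (simp add: top_ennreal_def)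
    then show ?thesis using True by (intro that(1)) auto
  next
    case False
    then obtain s1 where s1: "0 \<le> s1" "ennreal s1 < \<zeta> \<omega>" "X s1 \<omega> = y" by auto
    \<comment> \<open>Up to one known hit \<open>s1\<close> before the lifetime the path is
      continuous, so the level set is compact and the infimum is attained.\<close>
    have "closed ({0..s1} \<inter> (\<lambda>s. X s \<omega>) -` {y})"
      by (intro continuous_closed_preimage path_cont[OF \<omega> s1(2)]) auto
    then have "compact ({0..s1} \<inter> (\<lambda>s. X s \<omega>) -` {y})"
      by (metis Int_lower1 bounded_closed_interval bounded_subset compact_eq_bounded_closed)
    moreover have "{0..s1} \<inter> (\<lambda>s. X s \<omega>) -` {y} \<noteq> {}" using s1 by auto
    ultimately obtain s0 where s0: "s0 \<in> {0..s1} \<inter> (\<lambda>s. X s \<omega>) -` {y}"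
      "\<And>s. s \<in> {0..s1} \<inter> (\<lambda>s. X s \<omega>) -` {y} \<Longrightarrow> s0 \<le> s"
      using compact_attains_inf by metis
    have s0S: "s0 \<in> ?S" using s0(1) before_zeta[OF _ s1(2), of s0] by auto
    have min: "s0 \<le> s" if "s \<in> ?S" for s
      using that s0 by (cases "s \<le> s1") auto
    have "hit y \<omega> = ennreal s0"
      unfolding eq
    proof (rule antisym)
      show "Inf (ennreal ` ?S) \<le> ennreal s0" using s0S by (intro Inf_lower) blast
      show "ennreal s0 \<le> Inf (ennreal ` ?S)" using min by (intro Inf_greatest) (auto intro: ennreal_leI)
    qed
    then show ?thesis using s0S by (intro that(2)) auto
  qed
qed

lemma hit_time_le:
  assumes "0 \<le> s" "ennreal s < \<zeta> \<omega>" "X s \<omega> = y"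
  shows "hit y \<omega> \<le> ennreal s"
  unfolding hit_time_def using assms by (intro Inf_lower) auto

text \<open>A countable description, for measurability. On [0, u] with \<open>u\<close> before the
  lifetime the path is continuous and meets \<open>y\<close> exactly if rational times bring it
  arbitrarily close. Rational \<open>u\<close> suffice unless the hit occurs at \<open>t\<close>
  itself, so \<open>t\<close> is added.\<close>

lemma hit_time_le_iff:
  assumes \<omega>: "\<omega> \<in> space \<Omega>" and t: "0 \<le> t"
  shows "hit y \<omega> \<le> ennreal t \<longleftrightarrow>
    (\<exists>u\<in>insert t ({0..t} \<inter> \<rat>). ennreal u < \<zeta> \<omega> \<and> (\<forall>n. \<exists>q\<in>\<rat>. 0 \<le> q \<and> q \<le> u \<and> \<bar>X q \<omega> - y\<bar> < 1 / real (Suc n)))"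
    (is "?L \<longleftrightarrow> ?R")
proof
  assume ?L
  then obtain s where s: "0 \<le> s" "s \<le> t" "ennreal s < \<zeta> \<omega>" "X s \<omega> = y"
    using hit_time_cases[OF \<omega>, of y] t by (metis ennreal_le_iff ennreal_neq_top top.extremum_unique)
  have "\<exists>u\<in>insert t ({0..t} \<inter> \<rat>). ennreal u < \<zeta> \<omega> \<and> s \<le> u"
  proof (cases "s = t")
    case True then show ?thesis using s by auto
  next
    case False
    then have "ennreal s < min (\<zeta> \<omega>) (ennreal t)" using s by (simp add: ennreal_less_iff)
    then obtain v :: rat where v: "ennreal s < ennreal (real_of_rat v)" "ennreal (real_of_rat v) < min (\<zeta> \<omega>) (ennreal t)"
      using ennreal_rat_dense by blast
    have "s < real_of_rat v" using v(1) s(1) by (simp add: ennreal_less_iff)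
    moreover have "real_of_rat v < t"
      using v(2) ennreal_less_iff[OF less_imp_le[OF le_less_trans[OF s(1) calculation]], of t] by simp
    moreover have "0 \<le> real_of_rat v" using calculation(1) s(1) by linarith
    ultimately show ?thesis using v(2) by (intro bexI[of _ "real_of_rat v"]) auto
  qed
  then obtain u where u: "u \<in> insert t ({0..t} \<inter> \<rat>)" "ennreal u < \<zeta> \<omega>" "s \<le> u" by blast
  have "\<exists>q\<in>\<rat>. 0 \<le> q \<and> q \<le> u \<and> \<bar>X q \<omega> - y\<bar> < 1 / real (Suc n)" for n
  proof (cases "u = 0")
    case True
    then show ?thesis using s u by (intro bexI[of _ 0]) auto
  next
    case False
    then have u0: "0 < u" using u s by auto
    note path_cont[OF \<omega> u(2)]
    moreover have "s \<in> {0..u}" "0 < 1 / real (Suc n)" using s u by auto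
    ultimately obtain d where d: "d > 0" "\<And>q. q \<in> {0..u} \<Longrightarrow> dist q s < d \<Longrightarrow> dist (X q \<omega>) (X s \<omega>) < 1 / real (Suc n)"
      unfolding continuous_on_iff by metis
    have "max 0 (s - d) < min u (s + d)" using s u u0 d by auto
    then obtain q where q: "q \<in> \<rat>" "max 0 (s - d) < q" "q < min u (s + d)" using Rats_dense_in_real by blast
    have "dist (X q \<omega>) (X s \<omega>) < 1 / real (Suc n)" using q by (intro d(2)) (auto simp: dist_real_def)
    then show ?thesis using q s(4) by (intro bexI[of _ q]) (auto simp: dist_real_def)
  qed
  then show ?R using u by blast
next
  assume ?R
  then obtain u where u: "0 \<le> u" "u \<le> t" "ennreal u < \<zeta> \<omega>"
    and q: "\<And>n. \<exists>q\<in>\<rat>. 0 \<le> q \<and> q \<le> u \<and> \<bar>X q \<omega> - y\<bar> < 1 / real (Suc n)"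
    using t by auto
  have "continuous_on {0..u} (\<lambda>s. \<bar>X s \<omega> - y\<bar>)"
    by (intro continuous_intros path_cont[OF \<omega> u(3)])
  then obtain s where s: "s \<in> {0..u}" "\<And>q. q \<in> {0..u} \<Longrightarrow> \<bar>X s \<omega> - y\<bar> \<le> \<bar>X q \<omega> - y\<bar>"
    using continuous_attains_inf[of "{0..u}" "\<lambda>s. \<bar>X s \<omega> - y\<bar>"] u(1) by auto
  have "\<bar>X s \<omega> - y\<bar> \<le> 1 / real (Suc n)" for n
    using q[of n] s(2) by (meson atLeastAtMost_iff less_imp_le order_trans)
  then have "\<bar>X s \<omega> - y\<bar> \<le> 0"
    by (intro LIMSEQ_le_const[OF LIMSEQ_inverse_real_of_nat]) (auto simp: inverse_eq_divide)
  then have "X s \<omega> = y" by simp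
  then have "hit y \<omega> \<le> ennreal s"
    using s(1) u(3) by (intro hit_time_le) (auto intro: before_zeta)
  also have "\<dots> \<le> ennreal t" using s(1) u(2) by (intro ennreal_leI) auto
  finally show ?L .
qed

text \<open>\<open>G\<close> is general because two sigma-algebras are needed: \<open>F t\<close>
  for the stopping-time property, and the one generated by the lifetime and the path for the
  independence from \<open>T\<close>.\<close>

lemma hit_time_pred:
  assumes sp: "space G = space \<Omega>" and t: "0 \<le> t"
    and XG: "\<And>s. 0 \<le> s \<Longrightarrow> s \<le> t \<Longrightarrow> X s \<in> borel_measurable G"
    and zG: "\<And>s. 0 \<le> s \<Longrightarrow> s \<le> t \<Longrightarrow> Measurable.pred G (\<lambda>\<omega>. ennreal s < \<zeta> \<omega>)"
  shows "Measurable.pred G (\<lambda>\<omega>. hit y \<omega> \<le> ennreal t)"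
proof -
  have cR: "countable (\<rat> :: real set)" by (rule countable_rat)
  have "Measurable.pred G (\<lambda>\<omega>. \<exists>u\<in>insert t ({0..t} \<inter> \<rat>). ennreal u < \<zeta> \<omega> \<and>
      (\<forall>n. \<exists>q\<in>\<rat>. 0 \<le> q \<and> q \<le> u \<and> \<bar>X q \<omega> - y\<bar> < 1 / real (Suc n)))"
  proof (rule pred_Bex_countable)
    show "countable (insert t ({0..t} \<inter> \<rat>))" using cR by simp
    fix u assume "u \<in> insert t ({0..t} \<inter> \<rat>)"
    then have u: "0 \<le> u" "u \<le> t" using t by auto
    note [measurable] = zG[OF u]
    have "Measurable.pred G (\<lambda>\<omega>. 0 \<le> q \<and> q \<le> u \<and> \<bar>X q \<omega> - y\<bar> < 1 / real (Suc n))" for q n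
    proof (cases "0 \<le> q \<and> q \<le> u")
      case True
      then have [measurable]: "X q \<in> borel_measurable G" using u by (intro XG) auto
      show ?thesis by measurable
    next
      case False
      then have "(\<lambda>\<omega>. 0 \<le> q \<and> q \<le> u \<and> \<bar>X q \<omega> - y\<bar> < 1 / real (Suc n)) = (\<lambda>_. False)" by auto
      then show ?thesis by simp
    qed
    then have [measurable]: "Measurable.pred G (\<lambda>\<omega>. \<exists>q\<in>\<rat>. 0 \<le> q \<and> q \<le> u \<and> \<bar>X q \<omega> - y\<bar> < 1 / real (Suc n))" for n
      by (intro pred_Bex_countable cR)
    show "Measurable.pred G (\<lambda>\<omega>. ennreal u < \<zeta> \<omega> \<and> (\<forall>n. \<exists>q\<in>\<rat>. 0 \<le> q \<and> q \<le> u \<and> \<bar>X q \<omega> - y\<bar> < 1 / real (Suc n)))"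
      by measurable
  qed
  then show ?thesis
    by (rule measurable_cong[THEN iffD2, rotated]) (simp add: sp hit_time_le_iff[OF _ t])
qed

lemma hit_time_stopping_time: "is_stopping_time F (hit y)"
  unfolding is_stopping_time_def
proof (intro allI impI)
  fix t :: real assume t: "0 \<le> t"
  have "Measurable.pred (F t) (\<lambda>\<omega>. hit y \<omega> \<le> ennreal t)"
    by (rule hit_time_pred[OF space_F t])
      (use meas_F_mono X_meas stopping_time_pred(2)[OF zeta_st] in blast)+
  then show "{\<omega> \<in> space (F t). hit y \<omega> \<le> ennreal t} \<in> sets (F t)" by (simp add: pred_def)
qed

lemma hit_time_measurable:
  assumes sp: "space G = space \<Omega>"
    and XG: "\<And>s. 0 \<le> s \<Longrightarrow> X s \<in> borel_measurable G"
    and zG: "\<And>s. 0 \<le> s \<Longrightarrow> Measurable.pred G (\<lambda>\<omega>. ennreal s < \<zeta> \<omega>)"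
  shows "hit y \<in> borel_measurable G"
proof (rule borel_measurableI_le)
  fix c :: ennreal
  show "{\<omega> \<in> space G. hit y \<omega> \<le> c} \<in> sets G"
  proof (cases c)
    case (real t)
    then show ?thesis using hit_time_pred[OF sp _ XG zG, of t y] by (simp add: pred_def)
  qed simp
qed

lemma disc_payoff_hit_time:
  assumes "\<omega> \<in> space \<Omega>"
  shows "disc_payoff r g X \<zeta> (hit y) \<omega> = g y * disc_time r (hit y \<omega>)"
  by (rule hit_time_cases[OF assms, of y]) (auto simp: disc_payoff_def disc_time_def)

lemma integral_disc_payoff_hit_time:
  assumes "x \<in> Ival a b"
  shows "(\<integral>\<omega>. disc_payoff r g X \<zeta> (hit y) \<omega> \<partial>P x) = g y * (\<integral>\<omega>. disc_time r (hit y \<omega>) \<partial>P x)"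
proof -
  have "(\<integral>\<omega>. disc_payoff r g X \<zeta> (hit y) \<omega> \<partial>P x) = (\<integral>\<omega>. g y * disc_time r (hit y \<omega>) \<partial>P x)"
    using disc_payoff_hit_time space_P[OF assms] by (intro Bochner_Integration.integral_cong) auto
  then show ?thesis by simp
qed

lemma integral_disc_payoff_0:
  assumes x: "x \<in> Ival a b" and g: "continuous_on (Ival a b) g"
  shows "(\<integral>\<omega>. disc_payoff r g X \<zeta> (\<lambda>_. 0) \<omega> \<partial>P x) = g x"
proof -
  interpret prob_space "P x" by (rule prob_P[OF x])
  have eq: "disc_payoff r g X \<zeta> (\<lambda>_. 0) \<omega> = indicator (Ival a b) (X 0 \<omega>) *\<^sub>R g (X 0 \<omega>)" if "\<omega> \<in> space \<Omega>" for \<omega>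
    using zeta_pos[OF that] X_in[OF that, of 0] by (simp add: disc_payoff_def)
  have "(\<lambda>z. indicator (Ival a b) z *\<^sub>R g z) \<in> borel_measurable borel"
    by (intro borel_measurable_continuous_on_indicator g) simp
  moreover have "X 0 \<in> borel_measurable (P x)" by (rule meas_F_P[OF x X_meas]) simp
  ultimately have m: "(\<lambda>\<omega>. indicator (Ival a b) (X 0 \<omega>) *\<^sub>R g (X 0 \<omega>)) \<in> borel_measurable (P x)"
    by (rule measurable_compose_rev)
  have "(\<integral>\<omega>. disc_payoff r g X \<zeta> (\<lambda>_. 0) \<omega> \<partial>P x) = (\<integral>\<omega>. indicator (Ival a b) (X 0 \<omega>) *\<^sub>R g (X 0 \<omega>) \<partial>P x)"
    using eq space_P[OF x] by (intro Bochner_Integration.integral_cong) auto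
  also have "\<dots> = (\<integral>\<omega>. g x \<partial>P x)"
    by (intro integral_cong_AE m) (use X_0[OF x] x in \<open>auto elim!: eventually_mono\<close>)
  finally show ?thesis by (simp add: prob_space)
qed

section \<open>Verification of the candidate value\<close>

lemma value_fn_eq_Vy:
  assumes td: "threshold_data a b \<mu> \<sigma> \<psi> r g ystar Pset" and x: "x \<in> Ival a b"
    and laplace: "\<And>y. y \<in> Ival a b \<Longrightarrow> x \<le> y \<Longrightarrow> (\<integral>\<omega>. disc_time r (hit y \<omega>) \<partial>P x) = \<psi> x / \<psi> y"
  shows "value_fn P F r g X \<zeta> x = Vy \<psi> g ystar x"
proof -
  interpret S: threshold_data a b \<mu> \<sigma> \<psi> r g ystar Pset by (rule td)
  let ?w = "Vy \<psi> g ystar"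
  have upper: "(\<integral>\<omega>. disc_payoff r g X \<zeta> \<tau> \<omega> \<partial>P x) \<le> ?w x" if "is_stopping_time F \<tau>" for \<tau>
  proof (cases "integrable (P x) (disc_payoff r g X \<zeta> \<tau>)")
    case True
    have b: "(\<integral>\<^sup>+\<omega>. ennreal (disc_payoff r ?w X \<zeta> \<tau> \<omega>) \<partial>P x) \<le> ennreal (?w x)"
    proof (rule excessive_bound[where w = ?w, OF x S.r_pos that])
      fix \<alpha> \<beta> e :: real
      assume *: "\<alpha> \<in> Ival a b" "\<beta> \<in> Ival a b" "\<alpha> \<le> x" "x \<le> \<beta>" "0 < e"
      show "\<exists>f. C2c (Ival a b) f \<and> (\<forall>x. 0 \<le> f x) \<and> (\<forall>x. \<alpha> \<le> x \<and> x \<le> \<beta> \<longrightarrow> gen \<mu> \<sigma> f x - r * f x \<le> 0) \<and>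
        (\<forall>x. \<alpha> \<le> x \<and> x \<le> \<beta> \<longrightarrow> ?w x \<le> f x) \<and> f x \<le> ?w x + e"
        by (rule S.Vy_approx[OF *]) blast
    qed
    have le: "disc_payoff r g X \<zeta> \<tau> \<omega> \<le> disc_payoff r ?w X \<zeta> \<tau> \<omega>" if \<omega>: "\<omega> \<in> space \<Omega>" for \<omega>
    proof (cases "\<tau> \<omega> < \<zeta> \<omega>")
      case True
      then have "\<tau> \<omega> = ennreal (enn2real (\<tau> \<omega>))"
        by (metis ennreal_enn2real less_top_ennreal order_less_le_trans top_greatest)
      then have "X (enn2real (\<tau> \<omega>)) \<omega> \<in> Ival a b" using True by (intro X_in[OF \<omega>]) auto
      then show ?thesis using S.g_le_Vy by (simp add: disc_payoff_def)
    qed (simp add: disc_payoff_def)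
    \<comment> \<open>The positive part moves the estimate into nonnegative integrals, where the
      bound \<open>b\<close> on the majorant is available.\<close>
    have "ennreal (\<integral>\<omega>. disc_payoff r g X \<zeta> \<tau> \<omega> \<partial>P x) \<le> ennreal (\<integral>\<omega>. max 0 (disc_payoff r g X \<zeta> \<tau> \<omega>) \<partial>P x)"
      using True by (intro ennreal_leI integral_mono) auto
    also have "\<dots> = (\<integral>\<^sup>+\<omega>. ennreal (max 0 (disc_payoff r g X \<zeta> \<tau> \<omega>)) \<partial>P x)"
      using True by (intro nn_integral_eq_integral[symmetric]) auto
    also have "\<dots> \<le> (\<integral>\<^sup>+\<omega>. ennreal (disc_payoff r ?w X \<zeta> \<tau> \<omega>) \<partial>P x)"
    proof (rule nn_integral_mono)
      fix \<omega> assume "\<omega> \<in> space (P x)"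
      then have "ennreal (disc_payoff r g X \<zeta> \<tau> \<omega>) \<le> ennreal (disc_payoff r ?w X \<zeta> \<tau> \<omega>)"
        using le[of \<omega>] space_P[OF x] by (intro ennreal_leI) simp
      then show "ennreal (max 0 (disc_payoff r g X \<zeta> \<tau> \<omega>)) \<le> ennreal (disc_payoff r ?w X \<zeta> \<tau> \<omega>)"
        by (simp add: max_def)
    qed
    also note b
    finally show ?thesis using S.Vy_nonneg[OF x] by (simp add: ennreal_le_iff)
  next
    \<comment> \<open>The Bochner integral of a non-integrable payoff is 0 by convention, and 0 is
      below the nonnegative candidate.\<close>
    case False
    then show ?thesis using S.Vy_nonneg[OF x] by (simp add: not_integrable_integral_eq)
  qed
  have attained: "\<exists>\<tau>. is_stopping_time F \<tau> \<and> (\<integral>\<omega>. disc_payoff r g X \<zeta> \<tau> \<omega> \<partial>P x) = ?w x"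
  proof (cases "ystar \<le> x")
    case True
    have "is_stopping_time F (\<lambda>_. 0)" by (simp add: is_stopping_time_def)
    then show ?thesis using integral_disc_payoff_0[OF x S.g_cont] True by (auto simp: Vy_def)
  next
    case False
    then have "(\<integral>\<omega>. disc_payoff r g X \<zeta> (hit ystar) \<omega> \<partial>P x) = ?w x"
      using laplace[OF S.ystar_in] by (simp add: integral_disc_payoff_hit_time[OF x] Vy_def)
    then show ?thesis using hit_time_stopping_time by blast
  qed
  show ?thesis
    unfolding value_fn_def
  \<comment> \<open>For a supremum of reals a maximiser settles boundedness and the value at
    once.\<close>
  proof (rule cSup_eq_maximum)
    show "?w x \<in> (\<lambda>\<tau>. integral\<^sup>L (P x) (disc_payoff r g X \<zeta> \<tau>)) ` {\<tau>. is_stopping_time F \<tau>}"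
      using attained by (metis (mono_tags, lifting) image_eqI mem_Collect_eq)
  qed (use upper in auto)
qed

end

section \<open>The law of the running maximum\<close>

lemma Ival_upper_sequence:
  assumes c: "c \<in> Ival a b"
  obtains \<beta> :: "nat \<Rightarrow> real" where "incseq \<beta>" "\<And>n. \<beta> n \<in> Ival a b" "\<And>n. c < \<beta> n" "(\<lambda>n. ereal (\<beta> n)) \<longlonglongrightarrow> b"
proof -
  have cb: "ereal c < b" using c by (simp add: Ival_def)
  obtain u l where ul: "incseq u" "\<And>i. l i < u i" "\<And>i. ereal c < ereal (l i)" "\<And>i. ereal (u i) < b"
    "(\<lambda>i. ereal (u i)) \<longlonglongrightarrow> b"
    by (rule einterval_Icc_approximation[OF cb]) (rule that; assumption)
  show ?thesis
  proof (rule that[OF ul(1) _ _ ul(5)])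
    show cu: "c < u n" for n using ul(2,3)[of n] by simp
    show "u n \<in> Ival a b" for n
    proof -
      have "a < ereal (u n)" using c cu[of n] by (auto simp: Ival_def intro: less_trans[of a "ereal c"])
      then show ?thesis using ul(4) by (simp add: Ival_def)
    qed
  qed
qed

lemma tendsto_at_upper:
  assumes "b \<noteq> -\<infinity>" "\<And>n. ereal (\<beta> n) < b" "(\<lambda>n. ereal (\<beta> n)) \<longlonglongrightarrow> b"
  shows "filterlim \<beta> (at_upper b) sequentially"
proof (cases b)
  case (real B)
  then have "\<beta> \<longlonglongrightarrow> B" "\<And>n. \<beta> n < B" using assms by auto
  then show ?thesis using real
    by (auto simp: at_upper_def filterlim_at less_imp_neq intro!: always_eventually)
next
  case PInf
  then show ?thesis using assms by (simp add: at_upper_def tendsto_PInfty_eq_at_top)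
qed (use assms in auto)

lemma borel_measurable_indicator_Ival:
  fixes f :: "real \<Rightarrow> real"
  assumes "continuous_on (Ival a b) f" "S \<in> sets borel"
  shows "(\<lambda>z. indicator {z \<in> Ival a b. z \<in> S} z * f z) \<in> borel_measurable borel"
proof -
  have "(\<lambda>z. indicator (Ival a b) z *\<^sub>R f z) \<in> borel_measurable borel"
    by (intro borel_measurable_continuous_on_indicator assms) simp
  then have "(\<lambda>z. indicator S z * (indicator (Ival a b) z *\<^sub>R f z)) \<in> borel_measurable borel"
    using assms(2) by (intro borel_measurable_times[OF borel_measurable_indicator]) auto
  also have "(\<lambda>z. indicator S z * (indicator (Ival a b) z *\<^sub>R f z)) = (\<lambda>z. indicator {z \<in> Ival a b. z \<in> S} z * f z)"
    by (auto simp: fun_eq_iff indicator_def)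
  finally show ?thesis .
qed

text \<open>The fundamental theorem on [c, \<beta> n] followed by monotone convergence towards the
  right boundary, where \<open>L\<close> is the limiting value of \<open>v\<close>. Closed and open
  lower limits differ by a null set.\<close>

lemma nn_integral_FTC_Ival:
  fixes v h :: "real \<Rightarrow> real"
  assumes c: "c \<in> Ival a b" and fin: "finite S"
    and cont: "continuous_on {y \<in> Ival a b. c \<le> y} v"
    and deriv: "\<And>y. y \<in> Ival a b \<Longrightarrow> c < y \<Longrightarrow> y \<notin> S \<Longrightarrow> (v has_real_derivative - h y) (at y)"
    and nonneg: "\<And>y. y \<in> Ival a b \<Longrightarrow> c \<le> y \<Longrightarrow> 0 \<le> h y"
    and meas: "(\<lambda>y. indicator {y \<in> Ival a b. c \<le> y} y * h y) \<in> borel_measurable borel"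
    and \<beta>: "incseq \<beta>" "\<And>n. \<beta> n \<in> Ival a b" "\<And>n. c < \<beta> n" "(\<lambda>n. ereal (\<beta> n)) \<longlonglongrightarrow> b"
    and lim: "(\<lambda>n. v (\<beta> n)) \<longlonglongrightarrow> L"
  shows "(\<integral>\<^sup>+y. ennreal (indicator {y \<in> Ival a b. c < y} y * h y) \<partial>lborel) = ennreal (v c - L)"
proof -
  have sub: "{c..\<beta> n} \<subseteq> {y \<in> Ival a b. c \<le> y}" for n
    using Icc_subset_Ival[OF c \<beta>(2)[of n]] by auto
  let ?f = "\<lambda>n y. indicator {c..\<beta> n} y * h y"
  have m: "?f n \<in> borel_measurable borel" for n
  proof -
    have "(\<lambda>y. indicator {c..\<beta> n} y * (indicator {y \<in> Ival a b. c \<le> y} y * h y)) \<in> borel_measurable borel"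
      by (rule borel_measurable_times[OF _ meas]) simp
    moreover have "(\<lambda>y. indicator {c..\<beta> n} y * (indicator {y \<in> Ival a b. c \<le> y} y * h y)) = ?f n"
      using sub[of n] by (auto simp: fun_eq_iff indicator_def)
    ultimately show ?thesis by simp
  qed
  have nn: "0 \<le> ?f n y" for n y
    using sub[of n] nonneg[of y] by (cases "y \<in> {c..\<beta> n}") auto
  have I: "(\<integral>\<^sup>+y. ennreal (?f n y) \<partial>lborel) = ennreal (v c - v (\<beta> n))" for n
  proof (rule nn_integral_has_integral_lborel[OF m nn])
    have "((\<lambda>y. - h y) has_integral (v (\<beta> n) - v c)) {c..\<beta> n}"
    proof (rule fundamental_theorem_of_calculus_interior_strong[OF fin])
      show "c \<le> \<beta> n" using \<beta>(3)[of n] by simp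
      show "continuous_on {c..\<beta> n} v" using cont sub by (rule continuous_on_subset)
      fix y assume y: "y \<in> {c<..<\<beta> n} - S"
      then have "y \<in> {y \<in> Ival a b. c \<le> y}" using subsetD[OF sub[of n], of y] by auto
      then show "(v has_vector_derivative - h y) (at y)"
        using deriv[of y] y by (simp add: has_real_derivative_iff_has_vector_derivative)
    qed
    from has_integral_neg[OF this] have "(h has_integral (v c - v (\<beta> n))) {c..\<beta> n}" by simp
    then have "((\<lambda>y. if y \<in> {c..\<beta> n} then h y else 0) has_integral (v c - v (\<beta> n))) UNIV"
      by (simp only: has_integral_restrict_UNIV)
    moreover have "(\<lambda>y. if y \<in> {c..\<beta> n} then h y else 0) = ?f n" by (auto simp: fun_eq_iff)
    ultimately show "(?f n has_integral (v c - v (\<beta> n))) UNIV" by (simp only:)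
  qed
  let ?u = "\<lambda>y. ennreal (indicator {y \<in> Ival a b. c \<le> y} y * h y)"
  have "(\<lambda>n. \<integral>\<^sup>+y. ennreal (?f n y) \<partial>lborel) \<longlonglongrightarrow> (\<integral>\<^sup>+y. ?u y \<partial>lborel)"
  proof (rule nn_integral_LIMSEQ)
    show "incseq (\<lambda>n y. ennreal (?f n y))"
    proof (intro incseq_SucI le_funI ennreal_leI)
      fix n y
      have "\<beta> n \<le> \<beta> (Suc n)" using \<beta>(1) by (simp add: incseq_SucD)
      then have "y \<in> {c..\<beta> n} \<Longrightarrow> y \<in> {c..\<beta> (Suc n)}" by auto
      then show "?f n y \<le> ?f (Suc n) y"
        using nn[of "Suc n" y] by (cases "y \<in> {c..\<beta> n}") auto
    qed
    show "(\<lambda>y. ennreal (?f i y)) \<in> borel_measurable lborel" for i using m by simp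
    fix y
    have "\<forall>\<^sub>F n in sequentially. ennreal (?f n y) = ?u y"
    proof (cases "y \<in> {y \<in> Ival a b. c \<le> y}")
      case True
      then have "ereal y < b" by (simp add: Ival_def)
      then have "\<forall>\<^sub>F n in sequentially. ereal y < ereal (\<beta> n)" using \<beta>(4) order_tendstoD(1) by blast
      then show ?thesis using True by (auto elim!: eventually_mono)
    next
      case False
      then have "y \<notin> {c..\<beta> n}" for n using sub by blast
      then show ?thesis using False by simp
    qed
    then show "(\<lambda>n. ennreal (?f n y)) \<longlonglongrightarrow> ?u y" by (rule tendsto_eventually)
  qed
  moreover have "(\<lambda>n. \<integral>\<^sup>+y. ennreal (?f n y) \<partial>lborel) \<longlonglongrightarrow> ennreal (v c - L)"
    unfolding I by (intro tendsto_ennrealI tendsto_diff tendsto_const lim)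
  ultimately have "(\<integral>\<^sup>+y. ?u y \<partial>lborel) = ennreal (v c - L)" by (rule LIMSEQ_unique)
  moreover have "(\<integral>\<^sup>+y. ?u y \<partial>lborel) = (\<integral>\<^sup>+y. ennreal (indicator {y \<in> Ival a b. c < y} y * h y) \<partial>lborel)"
    using AE_lborel_singleton[of c]
    by (intro nn_integral_cong_AE) (auto simp: indicator_def elim!: eventually_mono)
  ultimately show ?thesis by simp
qed

context threshold_data
begin

text \<open>The right derivative of -g / \<psi>; equally, \<open>fhat\<close> times \<psi>' /
  \<psi>^2, the weight that occurs in the law of the running maximum.\<close>

definition hfun :: "real \<Rightarrow> real" where
  "hfun z = (g z * deriv \<psi> z - rderiv g z * \<psi> z) / (\<psi> z)^2"

lemma fhat_eq_hfun:
  assumes "z \<in> Ival a b"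
  shows "fhat g \<psi> z = hfun z * ((\<psi> z)^2 / deriv \<psi> z)"
  using psi_pos[OF assms] psi_deriv_pos[OF assms] by (simp add: fhat_def hfun_def field_simps)

lemma hfun_eq_mfun:
  assumes "0 < \<rho> z" "ystar \<le> z"
  shows "hfun z = - (mfun \<rho> z / (\<rho> z * (\<psi> z)^2))"
  using assms by (simp add: hfun_def mfun_def minus_divide_left)

lemma
  shows hfun_nonneg: "z \<in> Ival a b \<Longrightarrow> ystar \<le> z \<Longrightarrow> 0 \<le> hfun z"
    and hfun_meas: "(\<lambda>z. indicator {z \<in> Ival a b. ystar \<le> z} z * hfun z) \<in> borel_measurable borel"
    and hfun_integral: "c \<in> Ival a b \<Longrightarrow> ystar \<le> c \<Longrightarrow>
      (\<integral>\<^sup>+z. ennreal (indicator {z \<in> Ival a b. c < z} z * hfun z) \<partial>lborel) = ennreal (vfun c)"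
proof -
  obtain \<rho> where \<rho>: "\<And>x. x \<in> Ival a b \<Longrightarrow> 0 < \<rho> x"
    "\<And>x. x \<in> Ival a b \<Longrightarrow> (\<rho> has_real_derivative \<rho> x * (2 * \<mu> x / (\<sigma> x)^2)) (at x)"
    using scale_density_exists by blast
  show nn: "0 \<le> hfun z" if "z \<in> Ival a b" "ystar \<le> z" for z
    unfolding hfun_eq_mfun[of \<rho> z, OF \<rho>(1)[OF that(1)] that(2)]
    using mfun_nonpos[OF \<rho> that(1)] \<rho>(1)[OF that(1)] psi_pos[OF that(1)] by (simp add: divide_nonpos_pos)
  let ?J = "{z \<in> Ival a b. ystar \<le> z}"
  have J: "?J \<in> sets borel"
  proof -
    have "?J = Ival a b \<inter> {ystar..}" by auto
    then show ?thesis by simp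
  qed
  \<comment> \<open>\<open>rderiv\<close> is a definite description, so measurability of
    \<open>hfun\<close> is drawn from the monotonicity of \<open>mfun\<close>.\<close>
  have "mono_on (Ival a b) (\<lambda>z. - mfun \<rho> z)" using mfun_anti[OF \<rho>] by (auto simp: mono_on_def)
  then have "(\<lambda>z. - mfun \<rho> z) \<in> borel_measurable (restrict_space borel (Ival a b))"
    by (rule borel_measurable_mono_on_fnc)
  then have m1: "(\<lambda>z. indicator (Ival a b) z *\<^sub>R (- mfun \<rho> z)) \<in> borel_measurable borel"
    by (subst (asm) borel_measurable_restrict_space_iff) (auto simp: mult.commute)
  have "continuous_on (Ival a b) (\<lambda>z. 1 / (\<rho> z * (\<psi> z)^2))"
    using \<rho> psi_pos psi_cont(1) DERIV_isCont[OF \<rho>(2)]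
    by (intro continuous_intros) (auto intro: continuous_at_imp_continuous_on dest: \<rho>(1) psi_pos less_imp_neq)
  then have m2: "(\<lambda>z. indicator (Ival a b) z *\<^sub>R (1 / (\<rho> z * (\<psi> z)^2))) \<in> borel_measurable borel"
    by (intro borel_measurable_continuous_on_indicator) auto
  have "(\<lambda>z. indicator ?J z * ((indicator (Ival a b) z *\<^sub>R (- mfun \<rho> z)) * (indicator (Ival a b) z *\<^sub>R (1 / (\<rho> z * (\<psi> z)^2))))) \<in> borel_measurable borel"
    using m1 m2 J by (intro borel_measurable_times borel_measurable_indicator) auto
  also have "(\<lambda>z. indicator ?J z * ((indicator (Ival a b) z *\<^sub>R (- mfun \<rho> z)) * (indicator (Ival a b) z *\<^sub>R (1 / (\<rho> z * (\<psi> z)^2))))) =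
     (\<lambda>z. indicator ?J z * hfun z)"
  proof
    fix z
    show "indicator ?J z * ((indicator (Ival a b) z *\<^sub>R (- mfun \<rho> z)) * (indicator (Ival a b) z *\<^sub>R (1 / (\<rho> z * (\<psi> z)^2)))) = indicator ?J z * hfun z"
      using hfun_eq_mfun[of \<rho> z] \<rho>(1)[of z] by (cases "z \<in> ?J") auto
  qed
  finally show meas: "(\<lambda>z. indicator ?J z * hfun z) \<in> borel_measurable borel" .
  show "(\<integral>\<^sup>+z. ennreal (indicator {z \<in> Ival a b. c < z} z * hfun z) \<partial>lborel) = ennreal (vfun c)"
    if c: "c \<in> Ival a b" "ystar \<le> c"
  proof -
    obtain \<beta> :: "nat \<Rightarrow> real" where \<beta>: "incseq \<beta>" "\<And>n. \<beta> n \<in> Ival a b" "\<And>n. c < \<beta> n" "(\<lambda>n. ereal (\<beta> n)) \<longlonglongrightarrow> b"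
      by (rule Ival_upper_sequence[OF c(1)]) blast
    have "filterlim \<beta> (at_upper b) sequentially"
      using ab \<beta>(2,4) by (intro tendsto_at_upper) (auto simp: Ival_def)
    then have lim: "(\<lambda>n. vfun (\<beta> n)) \<longlonglongrightarrow> 0" by (rule filterlim_compose[OF vfun_tendsto])
    have "(\<integral>\<^sup>+z. ennreal (indicator {z \<in> Ival a b. c < z} z * hfun z) \<partial>lborel) = ennreal (vfun c - 0)"
    proof (rule nn_integral_FTC_Ival[OF c(1) _ _ _ _ _ \<beta> lim])
      show "finite (insert ystar Pset)" using Pset_fin by simp
      show "continuous_on {y \<in> Ival a b. c \<le> y} vfun"
        by (rule continuous_on_subset[OF vfun_cont[OF \<rho>]]) auto
      show "(vfun has_real_derivative - hfun y) (at y)" if "y \<in> Ival a b" "c < y" "y \<notin> insert ystar Pset" for y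
        using vfun_deriv[OF \<rho> that(1,3)] hfun_eq_mfun[of \<rho> y, OF \<rho>(1)[OF that(1)]] that c by simp
      show "0 \<le> hfun y" if "y \<in> Ival a b" "c \<le> y" for y using nn[of y] that c by simp
      have "(\<lambda>y. indicator {c..} y * (indicator ?J y * hfun y)) \<in> borel_measurable borel"
        by (rule borel_measurable_times[OF _ meas]) simp
      moreover have "(\<lambda>y. indicator {c..} y * (indicator ?J y * hfun y)) = (\<lambda>y. indicator {y \<in> Ival a b. c \<le> y} y * hfun y)"
        using c by (auto simp: fun_eq_iff indicator_def)
      ultimately show "(\<lambda>y. indicator {y \<in> Ival a b. c \<le> y} y * hfun y) \<in> borel_measurable borel" by simp
    qed
    then show ?thesis by simp
  qed
qed

end

context diffusion
begin

text \<open>The hitting time is a function of the lifetime and the path, hence independent of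
  \<open>T\<close>. Integrating out \<open>T\<close> first leaves the exponential tail, which is the
  discount factor at the hitting time.\<close>

lemma prob_hit_less_T:
  assumes x: "x \<in> Ival a b" and r: "0 < r"
    and T_exp: "distributed (P x) lborel T (exponential_density r)"
    and T_indep: "indep_rv (P x) borel T
          (borel \<Otimes>\<^sub>M (\<Pi>\<^sub>M t\<in>{0::real..}. borel)) (\<lambda>\<omega>. (\<zeta> \<omega>, restrict (\<lambda>t. X t \<omega>) {0..}))"
  shows "hit y \<in> borel_measurable (P x)"
    and "measure (P x) {\<omega> \<in> space (P x). hit y \<omega> < ennreal (T \<omega>)} = (\<integral>\<omega>. disc_time r (hit y \<omega>) \<partial>P x)"
proof -
  interpret prob_space "P x" by (rule prob_P[OF x])
  let ?H = "hit y"
  let ?N = "borel \<Otimes>\<^sub>M (\<Pi>\<^sub>M t\<in>{0::real..}. borel) :: (ennreal \<times> (real \<Rightarrow> real)) measure"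
  let ?Z = "\<lambda>\<omega>. (\<zeta> \<omega>, restrict (\<lambda>t. X t \<omega>) {0..})"
  have T: "T \<in> borel_measurable (P x)" and Z: "?Z \<in> measurable (P x) ?N"
    and ind: "indep_sets (case_bool {T -` S \<inter> space (P x) | S. S \<in> sets borel} {?Z -` S \<inter> space (P x) | S. S \<in> sets ?N}) UNIV"
    using T_indep unfolding indep_rv_def by auto
  have Zsp: "?Z \<in> space (P x) \<rightarrow> space ?N" using measurable_space[OF Z] by auto
  \<comment> \<open>Measurability of the hitting time with respect to this generated sigma-algebra
    is what transfers independence from the pair \<open>?Z\<close> to the hitting time.\<close>
  define G where "G = vimage_algebra (space (P x)) ?Z ?N"
  have ZG: "?Z \<in> measurable G ?N" unfolding G_def by (rule measurable_vimage_algebra1[OF Zsp])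
  have spG: "space G = space \<Omega>" by (simp add: G_def space_P[OF x])
  have XG: "X s \<in> borel_measurable G" if "0 \<le> s" for s
  proof -
    have "(\<lambda>\<omega>. snd (?Z \<omega>) s) \<in> borel_measurable G"
      using that by (intro measurable_compose[OF measurable_compose[OF ZG measurable_snd]] measurable_component_singleton) auto
    then show ?thesis using that by simp
  qed
  have zG: "Measurable.pred G (\<lambda>\<omega>. ennreal s < \<zeta> \<omega>)" for s
  proof -
    have [measurable]: "(\<lambda>\<omega>. fst (?Z \<omega>)) \<in> borel_measurable G"
      by (rule measurable_compose[OF ZG measurable_fst])
    then have [measurable]: "\<zeta> \<in> borel_measurable G" by simp
    show ?thesis by measurable
  qed
  have HG: "?H \<in> borel_measurable G" by (rule hit_time_measurable[OF spG XG zG])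
  have setsG: "sets G = {?Z -` S \<inter> space (P x) | S. S \<in> sets ?N}"
    unfolding G_def by (rule sets_vimage_algebra2[OF Zsp])
  have "sets G \<subseteq> sets (P x)" unfolding setsG using measurable_sets[OF Z] by auto
  then show H: "?H \<in> borel_measurable (P x)"
    using HG spG space_P[OF x] unfolding measurable_def by auto
  let ?T = "\<lambda>\<omega>. ennreal (T \<omega>)"
  have T': "?T \<in> borel_measurable (P x)" using T by measurable
  have "indep_sets (case_bool {?T -` S \<inter> space (P x) | S. S \<in> sets borel} {?H -` S \<inter> space (P x) | S. S \<in> sets borel}) UNIV"
  proof (rule indep_sets_mono_sets[OF ind])
    have 1: "{?T -` S \<inter> space (P x) | S. S \<in> sets borel} \<subseteq> {T -` S \<inter> space (P x) | S. S \<in> sets borel}"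
    proof safe
      fix S :: "ennreal set" assume S: "S \<in> sets borel"
      have "ennreal -` S \<in> sets borel" using measurable_sets[OF measurable_ennreal S] by simp
      moreover have "?T -` S \<inter> space (P x) = T -` (ennreal -` S) \<inter> space (P x)" by auto
      ultimately show "\<exists>S'. ?T -` S \<inter> space (P x) = T -` S' \<inter> space (P x) \<and> S' \<in> sets borel" by blast
    qed
    have 2: "{?H -` S \<inter> space (P x) | S. S \<in> sets borel} \<subseteq> {?Z -` S \<inter> space (P x) | S. S \<in> sets ?N}"
      unfolding setsG[symmetric] using measurable_sets[OF HG] spG space_P[OF x] by auto
    show "case_bool {?T -` S \<inter> space (P x) | S. S \<in> sets borel} {?H -` S \<inter> space (P x) | S. S \<in> sets borel} i
      \<subseteq> case_bool {T -` S \<inter> space (P x) | S. S \<in> sets borel} {?Z -` S \<inter> space (P x) | S. S \<in> sets ?N} i" for i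
      using 1 2 by (cases i) simp_all
  qed
  also have "case_bool {?T -` S \<inter> space (P x) | S. S \<in> sets borel} {?H -` S \<inter> space (P x) | S. S \<in> sets borel} =
     (\<lambda>i. {case_bool ?T ?H i -` S \<inter> space (P x) | S. S \<in> sets (case_bool borel borel i)})"
    by (auto simp: fun_eq_iff split: bool.split)
  finally have "indep_var borel ?T borel ?H"
    unfolding indep_var_def indep_vars_def2 using T' H by (auto split: bool.split)
  then have dist: "distr (P x) borel ?T \<Otimes>\<^sub>M distr (P x) borel ?H = distr (P x) (borel \<Otimes>\<^sub>M borel) (\<lambda>\<omega>. (?T \<omega>, ?H \<omega>))"
    unfolding indep_var_distribution_eq by blast
  interpret DT: prob_space "distr (P x) borel ?T" by (rule prob_space_distr[OF T'])
  interpret DH: prob_space "distr (P x) borel ?H" by (rule prob_space_distr[OF H])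
  interpret DTH: pair_sigma_finite "distr (P x) borel ?T" "distr (P x) borel ?H" ..
  let ?A = "{p :: ennreal \<times> ennreal. snd p < fst p}"
  have "Measurable.pred (borel \<Otimes>\<^sub>M borel) (\<lambda>p :: ennreal \<times> ennreal. snd p < fst p)" by measurable
  then have A: "?A \<in> sets (borel \<Otimes>\<^sub>M borel)" by (simp add: pred_def space_pair_measure)
  \<comment> \<open>An infinite hitting time is included: the event is empty and
    \<open>disc_time\<close> is 0 at infinity.\<close>
  have tail: "emeasure (P x) {\<omega> \<in> space (P x). c < ?T \<omega>} = ennreal (disc_time r c)" for c
  proof (cases c)
    case (real t)
    have "{\<omega> \<in> space (P x). c < ?T \<omega>} = {\<omega> \<in> space (P x). t < T \<omega>}"
      using real by (auto simp: ennreal_less_iff)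
    then show ?thesis
      using exponential_distributedD_gt[OF T_exp real(1) r] real
      by (simp add: emeasure_eq_measure disc_time_def mult.commute)
  qed (simp add: disc_time_def)
  have "emeasure (P x) {\<omega> \<in> space (P x). ?H \<omega> < ?T \<omega>} = emeasure (distr (P x) (borel \<Otimes>\<^sub>M borel) (\<lambda>\<omega>. (?T \<omega>, ?H \<omega>))) ?A"
    using T' H A by (subst emeasure_distr) (auto intro!: arg_cong2[of _ _ _ _ emeasure])
  also have "\<dots> = (\<integral>\<^sup>+h. emeasure (distr (P x) borel ?T) ((\<lambda>t. (t, h)) -` ?A) \<partial>distr (P x) borel ?H)"
    unfolding dist[symmetric] by (rule DTH.emeasure_pair_measure_alt2) (use A in simp)
  also have "\<dots> = (\<integral>\<^sup>+h. ennreal (disc_time r h) \<partial>distr (P x) borel ?H)"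
  proof (rule nn_integral_cong)
    fix h
    have "emeasure (distr (P x) borel ?T) {h<..} = emeasure (P x) {\<omega> \<in> space (P x). h < ?T \<omega>}"
      using T' by (subst emeasure_distr) (auto intro!: arg_cong2[of _ _ _ _ emeasure])
    moreover have "(\<lambda>t. (t, h)) -` ?A = {h<..}" by auto
    ultimately show "emeasure (distr (P x) borel ?T) ((\<lambda>t. (t, h)) -` ?A) = ennreal (disc_time r h)"
      using tail by simp
  qed
  also have "\<dots> = (\<integral>\<^sup>+\<omega>. ennreal (disc_time r (?H \<omega>)) \<partial>P x)"
    using H by (intro nn_integral_distr) (auto simp: disc_time_def[abs_def])
  also have "\<dots> = ennreal (\<integral>\<omega>. disc_time r (?H \<omega>) \<partial>P x)"
  proof (rule nn_integral_eq_integral)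
    show "integrable (P x) (\<lambda>\<omega>. disc_time r (?H \<omega>))"
      using H r by (intro integrable_const_bound[of _ 1]) (auto simp: disc_time_def[abs_def])
  qed (simp add: disc_time_def)
  finally have "ennreal (measure (P x) {\<omega> \<in> space (P x). ?H \<omega> < ?T \<omega>}) = ennreal (\<integral>\<omega>. disc_time r (?H \<omega>) \<partial>P x)"
    by (simp add: emeasure_eq_measure)
  moreover have "0 \<le> (\<integral>\<omega>. disc_time r (?H \<omega>) \<partial>P x)"
    by (rule Bochner_Integration.integral_nonneg) (simp add: disc_time_def)
  ultimately show "measure (P x) {\<omega> \<in> space (P x). ?H \<omega> < ?T \<omega>} = (\<integral>\<omega>. disc_time r (?H \<omega>) \<partial>P x)"
    by simp
qed

section \<open>The running maximum and its relation to hitting times\<close>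

lemma running_max_gt_iff:
  assumes \<omega>: "\<omega> \<in> space \<Omega>"
  shows "z < rmax T \<omega> \<longleftrightarrow>
    (\<exists>q\<in>\<rat> \<inter> {0..}. q \<le> T \<omega> \<and> ennreal q < \<zeta> \<omega> \<and> z < ereal (X q \<omega>))" (is "?L \<longleftrightarrow> ?R")
proof
  assume ?L
  then obtain s where s: "0 \<le> s" "s \<le> T \<omega>" "ennreal s < \<zeta> \<omega>" "z < ereal (X s \<omega>)"
    unfolding running_max_def less_Sup_iff by auto
  show ?R
  proof (cases "s = 0")
    case True then show ?thesis using s by (intro bexI[of _ 0]) auto
  next
    case False
    then have s0: "0 < s" using s by simp
    have "continuous_on {t. 0 \<le> t \<and> ennreal t < \<zeta> \<omega>} (\<lambda>t. ereal (X t \<omega>))"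
      using X_cont[OF \<omega>] by (intro continuous_on_ereal)
    then have "((\<lambda>t. ereal (X t \<omega>)) \<longlongrightarrow> ereal (X s \<omega>)) (at s within {t. 0 \<le> t \<and> ennreal t < \<zeta> \<omega>})"
      using s by (simp add: continuous_on_def)
    then have "\<forall>\<^sub>F t in at s within {t. 0 \<le> t \<and> ennreal t < \<zeta> \<omega>}. z < ereal (X t \<omega>)"
      using s(4) by (rule order_tendstoD(1))
    then obtain d where d: "d > 0" "\<And>t. 0 \<le> t \<Longrightarrow> ennreal t < \<zeta> \<omega> \<Longrightarrow> t \<noteq> s \<Longrightarrow> dist t s < d \<Longrightarrow> z < ereal (X t \<omega>)"
      unfolding eventually_at by auto
    \<comment> \<open>The rational time is taken to the left of \<open>s\<close>, so that it stays
      below both \<open>T\<close> and the lifetime.\<close>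
    have "max 0 (s - d) < s" using s0 d by simp
    then obtain q where q: "q \<in> \<rat>" "max 0 (s - d) < q" "q < s" using Rats_dense_in_real by blast
    have "ennreal q < \<zeta> \<omega>" using ennreal_leI[of q s] q s(3) by (meson le_less_trans less_imp_le)
    moreover from this have "z < ereal (X q \<omega>)" using q by (intro d(2)) (auto simp: dist_real_def)
    ultimately show ?thesis using q s by (intro bexI[of _ q]) auto
  qed
next
  assume ?R
  then show ?L unfolding running_max_def less_Sup_iff by auto
qed

lemma running_max_meas:
  assumes x: "x \<in> Ival a b" and T: "T \<in> borel_measurable (P x)"
  shows "rmax T \<in> borel_measurable (P x)"
proof (rule borel_measurableI_greater)
  fix z :: ereal
  have "Measurable.pred (P x) (\<lambda>\<omega>. \<exists>q\<in>\<rat> \<inter> {0..}. q \<le> T \<omega> \<and> ennreal q < \<zeta> \<omega> \<and> z < ereal (X q \<omega>))"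
  proof (rule pred_Bex_countable)
    show "countable (\<rat> \<inter> {0::real..})" using countable_rat by blast
    fix q :: real assume "q \<in> \<rat> \<inter> {0..}"
    then have q: "0 \<le> q" by simp
    note [measurable] = T meas_F_P[OF x X_meas[OF q]] meas_F_P[OF x stopping_time_pred(2)[OF zeta_st q]]
    show "Measurable.pred (P x) (\<lambda>\<omega>. q \<le> T \<omega> \<and> ennreal q < \<zeta> \<omega> \<and> z < ereal (X q \<omega>))" by measurable
  qed
  moreover have "{\<omega> \<in> space (P x). z < rmax T \<omega>} =
     {\<omega> \<in> space (P x). \<exists>q\<in>\<rat> \<inter> {0..}. q \<le> T \<omega> \<and> ennreal q < \<zeta> \<omega> \<and> z < ereal (X q \<omega>)}"
    using running_max_gt_iff space_P[OF x] by auto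
  ultimately show "{\<omega> \<in> space (P x). z < rmax T \<omega>} \<in> sets (P x)" by (simp add: pred_def)
qed

lemma hit_before_if_max_above:
  assumes \<omega>: "\<omega> \<in> space \<Omega>" and "X 0 \<omega> \<le> z" and "ereal z < rmax T \<omega>"
  shows "hit z \<omega> < ennreal (T \<omega>)"
proof -
  obtain s where s: "0 \<le> s" "s \<le> T \<omega>" "ennreal s < \<zeta> \<omega>" "z < X s \<omega>"
    using assms(3) unfolding running_max_def less_Sup_iff by auto
  obtain u where u: "0 \<le> u" "u \<le> s" "X u \<omega> = z"
    using IVT'[of "\<lambda>t. X t \<omega>" 0 z s] path_cont[OF \<omega> s(3)] assms(2) s by auto
  have "u < s" using u s(4) by (cases "u = s") auto
  have "hit z \<omega> \<le> ennreal u"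
    using u before_zeta[OF _ s(3)] by (intro hit_time_le)
  also have "\<dots> < ennreal s" using \<open>u < s\<close> u by (simp add: ennreal_less_iff)
  also have "\<dots> \<le> ennreal (T \<omega>)" using s by (intro ennreal_leI)
  finally show ?thesis .
qed

text \<open>Only a weak inequality: the path may touch \<open>z\<close> and turn back before time
  \<open>T\<close>.\<close>

lemma max_above_if_hit_before:
  assumes \<omega>: "\<omega> \<in> space \<Omega>" and "hit z \<omega> < ennreal (T \<omega>)"
  shows "ereal z \<le> rmax T \<omega>"
proof (rule hit_time_cases[OF \<omega>, of z])
  assume "hit z \<omega> = \<top>" then show ?thesis using assms(2) by simp
next
  fix s assume s: "hit z \<omega> = ennreal s" "0 \<le> s" "ennreal s < \<zeta> \<omega>" "X s \<omega> = z"
  then have "s < T \<omega>" using assms(2) by (simp add: ennreal_less_iff)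
  then show ?thesis unfolding running_max_def using s by (intro Sup_upper) force
qed

context
  fixes \<psi> :: "real \<Rightarrow> real" and r x :: real and T :: "'w \<Rightarrow> real"
  assumes sol: "increasing_solution a b \<mu> \<sigma> \<psi> r" and x: "x \<in> Ival a b"
    and laplace: "\<And>y. y \<in> Ival a b \<Longrightarrow> x \<le> y \<Longrightarrow> (\<integral>\<omega>. disc_time r (hit y \<omega>) \<partial>P x) = \<psi> x / \<psi> y"
    and T_exp: "distributed (P x) lborel T (exponential_density r)"
    and T_indep: "indep_rv (P x) borel T
          (borel \<Otimes>\<^sub>M (\<Pi>\<^sub>M t\<in>{0::real..}. borel)) (\<lambda>\<omega>. (\<zeta> \<omega>, restrict (\<lambda>t. X t \<omega>) {0..}))"
begin

lemma rmax_meas [measurable]: "rmax T \<in> borel_measurable (P x)"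
  by (rule running_max_meas[OF x]) (use T_indep in \<open>simp add: indep_rv_def\<close>)

text \<open>Exceeding \<open>z\<close> entails hitting \<open>z\<close> before \<open>T\<close>, by
  the intermediate value theorem. Conversely, hitting a higher level y before \<open>T\<close> gives
  a maximum above \<open>z\<close>; letting y decrease to \<open>z\<close> closes the gap by
  continuity of \<open>\<psi>\<close>.\<close>

lemma prob_running_max_gt:
  assumes z: "z \<in> Ival a b" "x \<le> z"
  shows "measure (P x) {\<omega> \<in> space (P x). ereal z < rmax T \<omega>} = \<psi> x / \<psi> z"
proof -
  interpret S: increasing_solution a b \<mu> \<sigma> \<psi> r by (rule sol)
  interpret prob_space "P x" by (rule prob_P[OF x])
  have T: "T \<in> borel_measurable (P x)" using T_indep by (simp add: indep_rv_def)
  note [measurable] = T prob_hit_less_T(1)[OF x S.r_pos T_exp T_indep]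
  have hit: "measure (P x) {\<omega> \<in> space (P x). hit y \<omega> < ennreal (T \<omega>)} = \<psi> x / \<psi> y"
    if "y \<in> Ival a b" "x \<le> y" for y
    using prob_hit_less_T(2)[OF x S.r_pos T_exp T_indep] laplace[OF that] by simp
  have "AE \<omega> in P x. \<omega> \<in> space \<Omega>" using space_P[OF x] by (intro AE_I2) simp
  with X_0[OF x] have "AE \<omega> in P x. ereal z < rmax T \<omega> \<longrightarrow> hit z \<omega> < ennreal (T \<omega>)"
    by eventually_elim (use z in \<open>auto intro: hit_before_if_max_above\<close>)
  then have "measure (P x) {\<omega> \<in> space (P x). ereal z < rmax T \<omega>} \<le> measure (P x) {\<omega> \<in> space (P x). hit z \<omega> < ennreal (T \<omega>)}"
    by (intro finite_measure_mono_AE) (auto elim!: eventually_mono)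
  then have le: "measure (P x) {\<omega> \<in> space (P x). ereal z < rmax T \<omega>} \<le> \<psi> x / \<psi> z"
    using hit[OF z] by simp
  have ge: "\<psi> x / \<psi> y \<le> measure (P x) {\<omega> \<in> space (P x). ereal z < rmax T \<omega>}"
    if y: "y \<in> Ival a b" "z < y" for y
  proof -
    have "measure (P x) {\<omega> \<in> space (P x). hit y \<omega> < ennreal (T \<omega>)} \<le> measure (P x) {\<omega> \<in> space (P x). ereal z < rmax T \<omega>}"
    proof (rule finite_measure_mono)
      show "{\<omega> \<in> space (P x). hit y \<omega> < ennreal (T \<omega>)} \<subseteq> {\<omega> \<in> space (P x). ereal z < rmax T \<omega>}"
        using max_above_if_hit_before[where z = y] y(2) space_P[OF x] by (auto intro: less_le_trans[of "ereal z" "ereal y"])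
    qed measurable
    then show ?thesis using hit[OF y(1)] y z by simp
  qed
  have "\<psi> x / \<psi> z \<le> measure (P x) {\<omega> \<in> space (P x). ereal z < rmax T \<omega>}"
  proof (rule tendsto_upperbound)
    have "isCont \<psi> z" by (rule S.psi_D(3)[OF z(1)])
    then have "(\<psi> \<longlongrightarrow> \<psi> z) (at_right z)"
      by (simp add: continuous_at_imp_continuous_at_within continuous_within[symmetric])
    then show "((\<lambda>y. \<psi> x / \<psi> y) \<longlongrightarrow> \<psi> x / \<psi> z) (at_right z)"
      using S.psi_pos[OF z(1)] by (intro tendsto_divide tendsto_const) auto
    have "\<forall>\<^sub>F y in at z. y \<in> Ival a b" using z by (intro eventually_at_in_open') auto
    then have "\<forall>\<^sub>F y in at_right z. y \<in> Ival a b"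
      using at_le filter_leD subset_UNIV by blast
    then show "\<forall>\<^sub>F y in at_right z. \<psi> x / \<psi> y \<le> measure (P x) {\<omega> \<in> space (P x). ereal z < rmax T \<omega>}"
      using eventually_at_right_less[of z] by eventually_elim (rule ge)
  qed simp
  with le show ?thesis by simp
qed

text \<open>The maximum may reach \<open>b\<close>, with probability \<psi> x times the limit
  \<open>L\<close> of 1 / \<psi> there. The law is therefore restricted to maxima strictly between
  \<open>x\<close> and \<open>b\<close>, and both sides are compared on right half-lines.\<close>

lemma running_max_law:
  shows "distr (density (P x) (indicator {\<omega> \<in> space (P x). ereal x < rmax T \<omega> \<and> rmax T \<omega> < b}))
       borel (\<lambda>\<omega>. real_of_ereal (rmax T \<omega>)) =
     density lborel (\<lambda>z. ennreal (indicator {z \<in> Ival a b. x < z} z * (\<psi> x * (deriv \<psi> z / (\<psi> z)^2))))" (is "?N1 = ?N2")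
    and "AE \<omega> in P x. ereal x < rmax T \<omega>"
proof -
  interpret S: increasing_solution a b \<mu> \<sigma> \<psi> r by (rule sol)
  interpret prob_space "P x" by (rule prob_P[OF x])
  let ?M = "rmax T"
  note gt = prob_running_max_gt
  have "prob {\<omega> \<in> space (P x). ereal x < ?M \<omega>} = 1" using gt[OF x] S.psi_pos[OF x] by simp
  then show "AE \<omega> in P x. ereal x < ?M \<omega>" by (subst (asm) prob_Collect_eq_1) measurable
  obtain \<beta> :: "nat \<Rightarrow> real" where \<beta>: "incseq \<beta>" "\<And>n. \<beta> n \<in> Ival a b" "\<And>n. x < \<beta> n" "(\<lambda>n. ereal (\<beta> n)) \<longlonglongrightarrow> b"
    by (rule Ival_upper_sequence[OF x]) blast
  have psi_le: "\<psi> y \<le> \<psi> y'" if "y \<in> Ival a b" "y' \<in> Ival a b" "y \<le> y'" for y y'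
    using S.psi_mono that by (meson strict_mono_on_leD)
  have "decseq (\<lambda>n. 1 / \<psi> (\<beta> n))"
    unfolding decseq_def using \<beta>(1,2) S.psi_pos psi_le by (auto intro!: divide_left_mono simp: incseq_def)
  moreover have "0 \<le> 1 / \<psi> (\<beta> n)" for n using S.psi_pos[OF \<beta>(2)] by (simp add: less_imp_le)
  ultimately obtain L where L: "(\<lambda>n. 1 / \<psi> (\<beta> n)) \<longlonglongrightarrow> L" using decseq_convergent by metis
  have Pb: "prob {\<omega> \<in> space (P x). b \<le> ?M \<omega>} = \<psi> x * L"
  proof -
    let ?A = "\<lambda>n. {\<omega> \<in> space (P x). ereal (\<beta> n) < ?M \<omega>}"
    have lim1: "(\<lambda>n. prob (?A n)) \<longlonglongrightarrow> prob (\<Inter>n. ?A n)"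
    proof (rule finite_Lim_measure_decseq)
      show "range ?A \<subseteq> events" by auto
      show "decseq ?A"
      proof (intro decseq_SucI subsetI)
        fix n \<omega> assume h: "\<omega> \<in> ?A (Suc n)"
        have "ereal (\<beta> n) \<le> ereal (\<beta> (Suc n))" using incseq_SucD[OF \<beta>(1)] by simp
        also have "\<dots> < ?M \<omega>" using h by simp
        finally show "\<omega> \<in> ?A n" using h by simp
      qed
    qed
    have eqI: "(\<Inter>n. ?A n) = {\<omega> \<in> space (P x). b \<le> ?M \<omega>}"
    proof (intro equalityI subsetI)
      fix \<omega> assume "\<omega> \<in> (\<Inter>n. ?A n)"
      then have "\<omega> \<in> space (P x)" "\<And>n. ereal (\<beta> n) \<le> ?M \<omega>" by (auto intro: less_imp_le)
      then show "\<omega> \<in> {\<omega> \<in> space (P x). b \<le> ?M \<omega>}" using LIMSEQ_le_const2[OF \<beta>(4)] by auto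
    next
      fix \<omega> assume "\<omega> \<in> {\<omega> \<in> space (P x). b \<le> ?M \<omega>}"
      moreover have "ereal (\<beta> n) < b" for n using \<beta>(2)[of n] by (simp add: Ival_def)
      ultimately show "\<omega> \<in> (\<Inter>n. ?A n)" by (auto intro: less_le_trans)
    qed
    have lim2: "(\<lambda>n. prob (?A n)) \<longlonglongrightarrow> \<psi> x * L"
      using tendsto_mult[OF tendsto_const[of "\<psi> x"] L] gt[OF \<beta>(2)] \<beta>(3) by (simp add: less_imp_le)
    show ?thesis using LIMSEQ_unique[OF lim1 lim2] unfolding eqI .
  qed
  have P_int: "emeasure (P x) {\<omega> \<in> space (P x). ereal c < ?M \<omega> \<and> ?M \<omega> < b} = ennreal (\<psi> x * (1 / \<psi> c - L))"
    if c: "c \<in> Ival a b" "x \<le> c" for c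
  proof -
    have cb: "ereal c < b" using c by (simp add: Ival_def)
    have "{\<omega> \<in> space (P x). ereal c < ?M \<omega> \<and> ?M \<omega> < b} = {\<omega> \<in> space (P x). ereal c < ?M \<omega>} - {\<omega> \<in> space (P x). b \<le> ?M \<omega>}"
      by auto
    then have "prob {\<omega> \<in> space (P x). ereal c < ?M \<omega> \<and> ?M \<omega> < b} =
        prob {\<omega> \<in> space (P x). ereal c < ?M \<omega>} - prob {\<omega> \<in> space (P x). b \<le> ?M \<omega>}"
      using cb by (simp only:, intro finite_measure_Diff) (auto intro: less_le_trans)
    also have "\<dots> = \<psi> x * (1 / \<psi> c - L)" using gt[OF c] Pb by (simp add: right_diff_distrib)
    finally show ?thesis by (simp only: emeasure_eq_measure)
  qed
  have "continuous_on (Ival a b) (\<lambda>z. deriv \<psi> z / (\<psi> z)^2)"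
    using S.psi_cont by (intro continuous_intros) (auto dest: S.psi_pos)
  note dens_meas = borel_measurable_indicator_Ival[OF this]
  have dens_meas': "(\<lambda>z. indicator {z \<in> Ival a b. c < z} z * (deriv \<psi> z / (\<psi> z)^2)) \<in> borel_measurable borel"
    "(\<lambda>z. indicator {z \<in> Ival a b. c \<le> z} z * (deriv \<psi> z / (\<psi> z)^2)) \<in> borel_measurable borel" for c
    using dens_meas[of "{c<..}"] dens_meas[of "{c..}"] by simp_all
  have D_int: "(\<integral>\<^sup>+z. ennreal (indicator {z \<in> Ival a b. c < z} z * (deriv \<psi> z / (\<psi> z)^2)) \<partial>lborel) = ennreal (1 / \<psi> c - L)"
    if c: "c \<in> Ival a b" "x \<le> c" for c
  proof -
    have "ereal c < b" using c by (simp add: Ival_def)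
    then obtain n0 where n0: "ereal c < ereal (\<beta> n0)"
      using order_tendstoD(1)[OF \<beta>(4), of "ereal c"] eventually_happens sequentially_bot by blast
    \<comment> \<open>Dropping initial terms puts the whole sequence beyond \<open>c\<close>, as the
      integration lemma demands, and leaves the limit \<open>L\<close> unchanged.\<close>
    define \<gamma> where "\<gamma> n = \<beta> (n + n0)" for n
    have \<gamma>: "incseq \<gamma>" "\<And>n. \<gamma> n \<in> Ival a b" "\<And>n. c < \<gamma> n" "(\<lambda>n. ereal (\<gamma> n)) \<longlonglongrightarrow> b"
      "(\<lambda>n. 1 / \<psi> (\<gamma> n)) \<longlonglongrightarrow> L"
    proof -
      show "incseq \<gamma>" using \<beta>(1) by (simp add: \<gamma>_def incseq_def)
      show "\<gamma> n \<in> Ival a b" for n using \<beta>(2) by (simp add: \<gamma>_def)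
      show "c < \<gamma> n" for n
        using n0 incseqD[OF \<beta>(1), of n0 "n + n0"] unfolding \<gamma>_def by simp
      show "(\<lambda>n. ereal (\<gamma> n)) \<longlonglongrightarrow> b" "(\<lambda>n. 1 / \<psi> (\<gamma> n)) \<longlonglongrightarrow> L"
        unfolding \<gamma>_def by (rule LIMSEQ_ignore_initial_segment[OF \<beta>(4)] LIMSEQ_ignore_initial_segment[OF L])+
    qed
    show ?thesis
    proof (rule nn_integral_FTC_Ival[where S = "{}" and v = "\<lambda>y. 1 / \<psi> y", OF c(1) _ _ _ _ _ \<gamma>])
      show "continuous_on {y \<in> Ival a b. c \<le> y} (\<lambda>y. 1 / \<psi> y)"
        using continuous_on_subset[OF S.psi_cont(1), of "{y \<in> Ival a b. c \<le> y}"]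
        by (intro continuous_on_divide continuous_on_const) (auto dest: S.psi_pos)
      show "((\<lambda>y. 1 / \<psi> y) has_real_derivative - (deriv \<psi> y / (\<psi> y)\<^sup>2)) (at y)" if y: "y \<in> Ival a b" for y
      proof -
        have "((\<lambda>y. 1 / \<psi> y) has_real_derivative (0 * \<psi> y - 1 * deriv \<psi> y) / (\<psi> y * \<psi> y)) (at y)"
          using S.psi_pos[OF y] by (intro DERIV_divide DERIV_const S.psi_D(1)[OF y]) auto
        then show ?thesis by (simp add: power2_eq_square)
      qed
      show "0 \<le> deriv \<psi> y / (\<psi> y)\<^sup>2" if "y \<in> Ival a b" for y
        using S.psi_deriv_pos[OF that] by simp
    qed (use dens_meas' in auto)
  qed
  let ?E = "{\<omega> \<in> space (P x). ereal x < ?M \<omega> \<and> ?M \<omega> < b}"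
  let ?Y = "\<lambda>\<omega>. real_of_ereal (?M \<omega>)"
  have E: "?E \<in> events" by measurable
  have MY: "?M \<omega> = ereal (?Y \<omega>)" if "\<omega> \<in> ?E" for \<omega>
    using that by (cases "?M \<omega>") auto
  have N1: "emeasure ?N1 A = emeasure (P x) (?E \<inter> {\<omega> \<in> space (P x). ?Y \<omega> \<in> A})" if "A \<in> sets borel" for A
  proof -
    have [measurable]: "A \<in> sets borel" by fact
    have "emeasure ?N1 A = emeasure (density (P x) (indicator ?E)) {\<omega> \<in> space (P x). ?Y \<omega> \<in> A}"
      by (subst emeasure_distr) (auto intro!: arg_cong2[of _ _ _ _ emeasure])
    also have "\<dots> = emeasure (P x) (?E \<inter> {\<omega> \<in> space (P x). ?Y \<omega> \<in> A})"
      by (rule emeasure_restricted[OF E]) measurable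
    finally show ?thesis .
  qed
  show "?N1 = ?N2"
  proof (rule measure_eqI_lessThan)
    fix z :: real
    show "emeasure ?N1 {z<..} < \<infinity>" by (subst N1) (auto simp: emeasure_eq_measure)
    have N2: "emeasure ?N2 {z<..} = (\<integral>\<^sup>+y. ennreal (indicator {y \<in> Ival a b. x < y} y * (\<psi> x * (deriv \<psi> y / (\<psi> y)^2))) * indicator {z<..} y \<partial>lborel)"
    proof (rule emeasure_density)
      have "(\<lambda>y. \<psi> x * (indicator {y \<in> Ival a b. x < y} y * (deriv \<psi> y / (\<psi> y)^2))) \<in> borel_measurable borel"
        by (rule borel_measurable_times[OF borel_measurable_const dens_meas'(1)])
      then show "(\<lambda>y. ennreal (indicator {y \<in> Ival a b. x < y} y * (\<psi> x * (deriv \<psi> y / (\<psi> y)^2)))) \<in> borel_measurable lborel"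
        by (simp add: mult.left_commute)
    qed simp
    show "emeasure ?N1 {z<..} = emeasure ?N2 {z<..}"
    proof (cases "ereal z < b")
      case True
      define c where "c = max x z"
      have c: "c \<in> Ival a b" "x \<le> c"
        using True x by (auto simp: c_def max_def Ival_def intro: less_le_trans[of a "ereal x"])
      have "?E \<inter> {\<omega> \<in> space (P x). ?Y \<omega> \<in> {z<..}} = {\<omega> \<in> space (P x). ereal c < ?M \<omega> \<and> ?M \<omega> < b}"
      proof (intro equalityI subsetI)
        fix \<omega> assume h: "\<omega> \<in> ?E \<inter> {\<omega> \<in> space (P x). ?Y \<omega> \<in> {z<..}}"
        then have "?M \<omega> = ereal (?Y \<omega>)" using MY by blast
        moreover have "z < ?Y \<omega>" "ereal x < ?M \<omega>" "?M \<omega> < b" using h by auto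
        moreover from calculation have "ereal c < ?M \<omega>"
          by (metis c_def ereal_less_eq(3) less_ereal.simps(1) linorder_not_less max.absorb_iff1 max_def)
        ultimately show "\<omega> \<in> {\<omega> \<in> space (P x). ereal c < ?M \<omega> \<and> ?M \<omega> < b}" using h by auto
      next
        fix \<omega> assume h: "\<omega> \<in> {\<omega> \<in> space (P x). ereal c < ?M \<omega> \<and> ?M \<omega> < b}"
        have "ereal x \<le> ereal c" using c(2) by simp
        also have "\<dots> < ?M \<omega>" using h by simp
        finally have hE: "\<omega> \<in> ?E" using h by simp
        then have "ereal c < ereal (?Y \<omega>)" using h MY by auto
        then show "\<omega> \<in> ?E \<inter> {\<omega> \<in> space (P x). ?Y \<omega> \<in> {z<..}}" using hE by (auto simp: c_def)
      qed
      then have "emeasure ?N1 {z<..} = ennreal (\<psi> x * (1 / \<psi> c - L))"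
        using N1[of "{z<..}"] P_int[OF c] by simp
      moreover have "emeasure ?N2 {z<..} = (\<integral>\<^sup>+y. ennreal (\<psi> x) * ennreal (indicator {y \<in> Ival a b. c < y} y * (deriv \<psi> y / (\<psi> y)^2)) \<partial>lborel)"
        unfolding N2
      proof (rule nn_integral_cong)
        fix y
        show "ennreal (indicator {y \<in> Ival a b. x < y} y * (\<psi> x * (deriv \<psi> y / (\<psi> y)^2))) * indicator {z<..} y =
          ennreal (\<psi> x) * ennreal (indicator {y \<in> Ival a b. c < y} y * (deriv \<psi> y / (\<psi> y)^2))"
          using S.psi_pos[OF x] ennreal_mult'[of "\<psi> x" "deriv \<psi> y / (\<psi> y)^2"]
          by (auto simp: c_def indicator_def)
      qed
      moreover have "\<dots> = ennreal (\<psi> x) * ennreal (1 / \<psi> c - L)"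
        using dens_meas'(1)[of c] by (subst nn_integral_cmult) (simp, simp only: D_int[OF c])
      ultimately show ?thesis using S.psi_pos[OF x] by (simp add: ennreal_mult')
    next
      case False
      have "?E \<inter> {\<omega> \<in> space (P x). ?Y \<omega> \<in> {z<..}} = {}"
      proof -
        have "\<not> z < ?Y \<omega>" if "\<omega> \<in> ?E" for \<omega>
        proof
          assume "z < ?Y \<omega>"
          then have "ereal z < ?M \<omega>" using MY[OF that] by (metis less_ereal.simps(1))
          then show False using that False by (auto dest: less_trans)
        qed
        then show ?thesis by auto
      qed
      then have "emeasure ?N1 {z<..} = 0" using N1[of "{z<..}"] by simp
      moreover have "emeasure ?N2 {z<..} = (\<integral>\<^sup>+y. 0 \<partial>(lborel :: real measure))"
        unfolding N2
      proof (rule nn_integral_cong)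
        fix y
        have "\<not> (y \<in> Ival a b \<and> z < y)" using False less_trans[of "ereal z" "ereal y" b] by (auto simp: Ival_def)
        then show "ennreal (indicator {y \<in> Ival a b. x < y} y * (\<psi> x * (deriv \<psi> y / (\<psi> y)^2))) * indicator {z<..} y = 0"
          by (auto simp: indicator_def)
      qed
      ultimately show ?thesis by simp
    qed
  qed simp_all
qed

text \<open>The density of the maximum cancels the factor \<psi>^2 / \<psi>' in \<open>fhat\<close>,
  so the expectation is \<psi> x times the integral of \<open>hfun\<close> from the larger of
  \<open>x\<close> and \<open>ystar\<close> to \<open>b\<close>. That integral is
  \<open>vfun\<close> at this point, and \<open>vfun\<close> is constant up to
  \<open>ystar\<close>.\<close>

lemma expectation_fhat_running_max:
  assumes td: "threshold_data a b \<mu> \<sigma> \<psi> r g ystar Pset"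
  shows "(\<integral>\<omega>. indicator {ereal ystar..<b} (rmax T \<omega>)
                     * fhat g \<psi> (real_of_ereal (rmax T \<omega>)) \<partial>P x) = Vy \<psi> g ystar x"
proof -
  interpret S: threshold_data a b \<mu> \<sigma> \<psi> r g ystar Pset by (rule td)
  interpret prob_space "P x" by (rule prob_P[OF x])
  let ?M = "rmax T"
  let ?Y = "\<lambda>\<omega>. real_of_ereal (?M \<omega>)"
  let ?E = "{\<omega> \<in> space (P x). ereal x < ?M \<omega> \<and> ?M \<omega> < b}"
  let ?J = "{z \<in> Ival a b. ystar \<le> z}"
  let ?F = "\<lambda>\<omega>. indicator {ereal ystar..<b} (?M \<omega>) * fhat g \<psi> (?Y \<omega>)"
  \<comment> \<open>Extension by 0 to the whole line, which gives a Borel function that can be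
    pushed through the law of the maximum.\<close>
  define K where "K z = indicator ?J z * fhat g \<psi> z" for z
  have K_meas [measurable]: "K \<in> borel_measurable borel"
  proof -
    have "continuous_on (Ival a b) (\<lambda>z. (\<psi> z)^2 / deriv \<psi> z)"
      using S.psi_cont by (intro continuous_intros) (auto dest: S.psi_deriv_pos)
    then have "(\<lambda>z. indicator (Ival a b) z *\<^sub>R ((\<psi> z)^2 / deriv \<psi> z)) \<in> borel_measurable borel"
      by (intro borel_measurable_continuous_on_indicator) auto
    then have "(\<lambda>z. (indicator ?J z * S.hfun z) * (indicator (Ival a b) z *\<^sub>R ((\<psi> z)^2 / deriv \<psi> z))) \<in> borel_measurable borel"
      by (rule borel_measurable_times[OF S.hfun_meas])
    moreover have "(\<lambda>z. (indicator ?J z * S.hfun z) * (indicator (Ival a b) z *\<^sub>R ((\<psi> z)^2 / deriv \<psi> z))) = K"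
      by (auto simp: fun_eq_iff K_def indicator_def S.fhat_eq_hfun)
    ultimately show ?thesis by simp
  qed
  have K_nonneg: "0 \<le> K z" for z
    using S.fhat_eq_hfun[of z] S.hfun_nonneg[of z] S.psi_deriv_pos[of z] by (auto simp: K_def indicator_def)
  have F_eq: "?F \<omega> = indicator ?E \<omega> * K (?Y \<omega>)" if w: "\<omega> \<in> space (P x)" "ereal x < ?M \<omega>" for \<omega>
  proof (cases "?M \<omega> < b")
    case True
    then have "?M \<omega> = ereal (?Y \<omega>)" using w by (cases "?M \<omega>") auto
    then obtain y where y: "?M \<omega> = ereal y" by blast
    have "a < ereal y" using w x y by (auto simp: Ival_def intro: less_trans[of a "ereal x"])
    then have "y \<in> Ival a b" using True y by (simp add: Ival_def)
    then show ?thesis using w True y by (auto simp: K_def indicator_def)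
  next
    case False
    then show ?thesis by (auto simp: indicator_def)
  qed
  have F_AE: "AE \<omega> in P x. ?F \<omega> = indicator ?E \<omega> * K (?Y \<omega>)"
    using running_max_law(2) AE_space by eventually_elim (rule F_eq)
  define c where "c = max x ystar"
  have c: "c \<in> Ival a b" "ystar \<le> c" using x S.ystar_in by (auto simp: c_def max_def)
  have E: "?E \<in> events" by measurable
  have "(\<integral>\<^sup>+\<omega>. ennreal (?F \<omega>) \<partial>P x) = (\<integral>\<^sup>+\<omega>. indicator ?E \<omega> * ennreal (K (?Y \<omega>)) \<partial>P x)"
    using F_AE by (intro nn_integral_cong_AE) (auto elim!: eventually_mono simp: indicator_def)
  also have "\<dots> = (\<integral>\<^sup>+\<omega>. ennreal (K (?Y \<omega>)) \<partial>density (P x) (indicator ?E))"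
    by (rule nn_integral_density[symmetric]) (use E in measurable)
  also have "\<dots> = (\<integral>\<^sup>+z. ennreal (K z) \<partial>distr (density (P x) (indicator ?E)) borel ?Y)"
    by (rule nn_integral_distr[symmetric]) measurable
  also have "\<dots> = (\<integral>\<^sup>+z. ennreal (indicator {z \<in> Ival a b. x < z} z * (\<psi> x * (deriv \<psi> z / (\<psi> z)^2))) * ennreal (K z) \<partial>lborel)"
    unfolding running_max_law(1)
  proof (rule nn_integral_density)
    have "continuous_on (Ival a b) (\<lambda>z. \<psi> x * (deriv \<psi> z / (\<psi> z)^2))"
      using S.psi_cont by (intro continuous_intros) (auto dest: S.psi_pos)
    from borel_measurable_indicator_Ival[OF this, of "{x<..}"]
    show "(\<lambda>z. ennreal (indicator {z \<in> Ival a b. x < z} z * (\<psi> x * (deriv \<psi> z / (\<psi> z)^2)))) \<in> borel_measurable lborel"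
      by simp
  qed measurable
  also have "\<dots> = (\<integral>\<^sup>+z. ennreal (\<psi> x) * ennreal (indicator {z \<in> Ival a b. c < z} z * S.hfun z) \<partial>lborel)"
  proof (rule nn_integral_cong_AE)
    show "AE z in lborel. ennreal (indicator {z \<in> Ival a b. x < z} z * (\<psi> x * (deriv \<psi> z / (\<psi> z)^2))) * ennreal (K z) =
      ennreal (\<psi> x) * ennreal (indicator {z \<in> Ival a b. c < z} z * S.hfun z)"
      \<comment> \<open>For \<open>x < ystar\<close> one has \<open>c = ystar\<close>;
        \<open>K\<close> includes this point while \<open>c < z\<close> excludes it.\<close>
      using AE_lborel_singleton[of ystar]
    proof eventually_elim
      case (elim z)
      show ?case
      proof (cases "z \<in> Ival a b \<and> c < z")
        case True
        then have z: "z \<in> Ival a b" "x < z" "ystar \<le> z" by (auto simp: c_def)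
        have p: "0 < \<psi> z" "0 < deriv \<psi> z" "0 < \<psi> x" using S.psi_pos S.psi_deriv_pos z x by auto
        have "\<psi> x * (deriv \<psi> z / (\<psi> z)^2) * K z = \<psi> x * S.hfun z"
          using p z by (simp add: K_def S.fhat_eq_hfun)
        then have "ennreal (\<psi> x * (deriv \<psi> z / (\<psi> z)^2)) * ennreal (K z) = ennreal (\<psi> x) * ennreal (S.hfun z)"
          using p by (simp add: ennreal_mult'[symmetric] mult_nonneg_nonneg less_imp_le)
        then show ?thesis using True z by simp
      next
        case False
        then have "z \<in> Ival a b \<Longrightarrow> x < z \<Longrightarrow> \<not> ystar \<le> z" using elim by (auto simp: c_def)
        then show ?thesis using False by (auto simp: K_def indicator_def)
      qed
    qed
  qed
  also have "\<dots> = ennreal (\<psi> x) * ennreal (S.vfun c)"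
  proof (subst nn_integral_cmult)
    have "(\<lambda>z. indicator {c<..} z * (indicator ?J z * S.hfun z)) \<in> borel_measurable borel"
      by (rule borel_measurable_times[OF _ S.hfun_meas]) simp
    moreover have "(\<lambda>z. indicator {c<..} z * (indicator ?J z * S.hfun z)) = (\<lambda>z. indicator {z \<in> Ival a b. c < z} z * S.hfun z)"
      using c by (auto simp: fun_eq_iff indicator_def)
    ultimately show "(\<lambda>z. ennreal (indicator {z \<in> Ival a b. c < z} z * S.hfun z)) \<in> borel_measurable lborel" by simp
  qed (simp add: S.hfun_integral[OF c])
  also have "\<dots> = ennreal (Vy \<psi> g ystar x)"
  proof -
    have "S.vfun c = S.vfun x"
      unfolding S.vfun_eq[OF c(1)] S.vfun_eq[OF x] by (auto simp: c_def max_def)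
    then show ?thesis
      using S.psi_pos[OF x] S.psi_vfun[OF x] by (simp add: ennreal_mult'[symmetric] less_imp_le)
  qed
  finally have nn: "(\<integral>\<^sup>+\<omega>. ennreal (?F \<omega>) \<partial>P x) = ennreal (Vy \<psi> g ystar x)" .
  have "(\<integral>\<omega>. ?F \<omega> \<partial>P x) = enn2real (\<integral>\<^sup>+\<omega>. ennreal (?F \<omega>) \<partial>P x)"
  proof (rule integral_eq_nn_integral)
    \<comment> \<open>An identity at every \<omega>, since measurability of the integrand cannot be
      inferred from the almost sure equality \<open>F_AE\<close>.\<close>
    have Fsplit: "?F \<omega> = indicator {\<omega> \<in> space (P x). ereal ystar \<le> ?M \<omega> \<and> ?M \<omega> < b} \<omega> * K (?Y \<omega>)" if w: "\<omega> \<in> space (P x)" for \<omega>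
    proof (cases "ereal ystar \<le> ?M \<omega> \<and> ?M \<omega> < b")
      case True
      then obtain y where y: "?M \<omega> = ereal y" by (cases "?M \<omega>") auto
      have "a < ereal y" using True y S.ystar_in by (auto simp: Ival_def intro: less_le_trans[of a "ereal ystar"])
      then have "y \<in> Ival a b" using True y by (simp add: Ival_def)
      then show ?thesis using w True y by (auto simp: K_def)
    next
      case False
      then show ?thesis by (auto simp: indicator_def)
    qed
    have "(\<lambda>\<omega>. indicator {\<omega> \<in> space (P x). ereal ystar \<le> ?M \<omega> \<and> ?M \<omega> < b} \<omega> * K (?Y \<omega>)) \<in> borel_measurable (P x)"
      by measurable
    then show "?F \<in> borel_measurable (P x)"
      by (rule measurable_cong[THEN iffD2, rotated]) (rule Fsplit)
    show "AE \<omega> in P x. 0 \<le> ?F \<omega>"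
      using F_AE by eventually_elim (simp only: K_nonneg mult_nonneg_nonneg indicator_pos_le)
  qed
  then show ?thesis using nn S.Vy_nonneg[OF x] by simp
qed

end

end

theorem theorem3p4:
  fixes a b :: ereal
    and \<mu> \<sigma> \<psi> g :: "real \<Rightarrow> real"
    and \<Omega> :: "'w measure" and P F :: "real \<Rightarrow> 'w measure"
    and X :: "real \<Rightarrow> 'w \<Rightarrow> real" and \<zeta> :: "'w \<Rightarrow> ennreal"
    and T :: "'w \<Rightarrow> real" and r ystar :: real and Pset :: "real set"
  assumes diff: "diffusion_model a b \<mu> \<sigma> \<Omega> P F X \<zeta>"
    and r_pos: "0 < r"
    and psi: "psi_fundamental a b \<mu> \<sigma> r P X \<zeta> \<psi>"
    and g_cont: "continuous_on (Ival a b) g"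
    and g_nonneg_somewhere: "\<exists>x\<in>Ival a b. 0 \<le> g x"
    and g_int: "\<forall>x\<in>Ival a b.
          (\<integral>\<^sup>+\<omega>. (SUP t\<in>{t. 0 \<le> t \<and> ennreal t < \<zeta> \<omega>}. ennreal (exp (- r * t) * g (X t \<omega>))) \<partial>P x) < \<infinity>"
    and Pset_fin: "finite Pset"
    and g_C2: "\<forall>x\<in>Ival a b - Pset. g differentiable at x \<and> deriv g differentiable at x"
    and g_C2_cont: "continuous_on (Ival a b - Pset) (deriv (deriv g))"
    and g_onesided: "\<forall>p\<in>Pset \<inter> Ival a b. onesided_C2_at g p"
    and T_exp: "\<forall>x\<in>Ival a b. distributed (P x) lborel T (exponential_density r)"
    and T_indep: "\<forall>x\<in>Ival a b. indep_rv (P x) borel T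
          (borel \<Otimes>\<^sub>M (\<Pi>\<^sub>M t\<in>{0::real..}. borel)) (\<lambda>\<omega>. (\<zeta> \<omega>, restrict (\<lambda>t. X t \<omega>) {0..}))"
    and ystar_in: "ystar \<in> Ival a b"
    and ystar_argmax: "\<forall>x\<in>Ival a b. g x / \<psi> x \<le> g ystar / \<psi> ystar"
    and gen_neg: "\<forall>x\<in>Ival a b. ystar \<le> x \<longrightarrow> x \<notin> Pset \<longrightarrow> gen \<mu> \<sigma> g x - r * g x \<le> 0"
    and kinks: "\<forall>x\<in>Ival a b \<inter> Pset. ystar \<le> x \<longrightarrow> rderiv g x \<le> lderiv g x"
    and lim_b: "((\<lambda>x. g x / \<psi> x) \<longlongrightarrow> 0) (at_upper b)"
  shows "\<forall>x\<in>Ival a b.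
           value_fn P F r g X \<zeta> x = Vy \<psi> g ystar x \<and>
           value_fn P F r g X \<zeta> x =
             (\<integral>\<omega>. indicator {ereal ystar..<b} (running_max X \<zeta> T \<omega>)
                     * fhat g \<psi> (real_of_ereal (running_max X \<zeta> T \<omega>)) \<partial>P x)"
proof
  fix x assume x: "x \<in> Ival a b"
  interpret diffusion a b \<mu> \<sigma> \<Omega> P F X \<zeta> by (rule diffusion.intro[OF diff])
  note psi' = psi[unfolded psi_fundamental_def]
  have sol: "increasing_solution a b \<mu> \<sigma> \<psi> r"
    using psi' ab cont_mu cont_sigma sigma_pos r_pos
    by unfold_locales (auto simp: C2_on_def)
  have td: "threshold_data a b \<mu> \<sigma> \<psi> r g ystar Pset"
    using sol g_cont Pset_fin g_C2 g_onesided ystar_in ystar_argmax gen_neg kinks lim_b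
    by (intro threshold_data.intro threshold_data_axioms.intro) auto
  have laplace: "(\<integral>\<omega>. disc_time r (hit_time X \<zeta> y \<omega>) \<partial>P x) = \<psi> x / \<psi> y"
    if "y \<in> Ival a b" "x \<le> y" for y
    using psi' x that by blast
  have "value_fn P F r g X \<zeta> x = Vy \<psi> g ystar x"
    by (rule value_fn_eq_Vy[OF td x]) (rule laplace)
  moreover have "(\<integral>\<omega>. indicator {ereal ystar..<b} (running_max X \<zeta> T \<omega>)
                     * fhat g \<psi> (real_of_ereal (running_max X \<zeta> T \<omega>)) \<partial>P x) = Vy \<psi> g ystar x"
    by (rule expectation_fhat_running_max[OF sol x _ bspec[OF T_exp x] bspec[OF T_indep x] td]) (rule laplace)
  ultimately show "value_fn P F r g X \<zeta> x = Vy \<psi> g ystar x \<and>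
           value_fn P F r g X \<zeta> x =
             (\<integral>\<omega>. indicator {ereal ystar..<b} (running_max X \<zeta> T \<omega>)
                     * fhat g \<psi> (real_of_ereal (running_max X \<zeta> T \<omega>)) \<partial>P x)"
    by simp
qed

end
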